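(* Let $G=\langle\alpha,\beta\mid\alpha^2=\beta^3=e\rangle$, let $c$ be an isolated circular order of $G$ and let $\phi$ be a dynamical realization of $c$ based at $x_0\in S^1$. Then there exist subsets $[a],[b],[b^{-1}]\subset S^1$ such that $(a,b,[a],[b],[b^{-1}])$ with $a=\phi(\alpha)$, $b=\phi(\beta)$ is a Markov system.
   Context: A circular order on a countable group $H$ is a map $c:H^3\to\{0,\pm1\}$ with (1) $c(g_1,g_2,g_3)=0$ iff two of the $g_i$ coincide; (2) $c(g_2,g_3,g_4)-c(g_1,g_3,g_4)+c(g_1,g_2,g_4)-c(g_1,g_2,g_3)=0$; (3) $c(g_4g_1,g_4g_2,g_4g_3)=c(g_1,g_2,g_3)$. $CO(H)$ has the topology induced from $\{0,\pm1\}^{H^3}$; isolated means isolated in $CO(H)$. An action $\rho$ of $H$ on $S^1$ by orientation-preserving homeomorphisms is tight at $x_0$ if the stabilizer of $x_0$ is trivial and both endpoints of every gap of $\overline{\rho(H)x_0}$ lie in $\rho(H)x_0$. A dynamical realization of $c$ based at $x_0$ is an action tight at $x_0$ with $c(g_1,g_2,g_3)=\pm1$ according as $\rho(g_1)x_0,\rho(g_2)x_0,\rho(g_3)x_0$ are distinct and anticlockwise/clockwise. A Markov system is a tuple $(a,b,[a],[b],[b^{-1}])$ with $a$ an orientation-preserving involution of $S^1$, $b$ an orientation-preserving homeomorphism of $S^1$ of period three, and $[a],[b],[b^{-1}]\subset S^1$ such that: (A) they are pairwise disjoint, each a union of $k$ disjoint closed intervals ($k\in\mathbb{N}$); components are called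 $a$-, $b$-, $b^{-1}$-intervals; $X=[a]\cup[b]\cup[b^{-1}]$; (B) no two $a$-intervals are consecutive among the components of $X$ in circular order; likewise for $b$- and for $b^{-1}$-intervals; with principal gaps (gaps of $X$ between an $a$-interval and a $b^{\pm1}$-interval), complementary gaps (between a $b$- and a $b^{-1}$-interval), $b$-blocks (maximal intervals made of $b^{\pm1}$-intervals and complementary gaps), $[[b]]$ = union of $b$-blocks: (C) $a([a])=[[b]]$; (D) $b([a])=[b]$, $b([b])=[b^{-1}]$; (E) the graph on principal gaps joining $J$ to $a(J)$ and to the image of $J$ under the (unique) one of $b^{\pm1}$ mapping $J$ to a principal gap is connected (the principal gaps form one cycle). *)

theory Defs
  imports "HOL-Analysis.Analysis"
begin

section \<open>The group G = < alpha, beta | alpha^2 = beta^3 = e > as reduced words\<close>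

datatype gen = GA | GB | GBi   (* alpha, beta, beta^-1 *)

fun in_B :: "gen \<Rightarrow> bool" where
  "in_B GA = False"
| "in_B GB = True"
| "in_B GBi = True"

text \<open>Normal forms of the free product Z/2 * Z/3: letters alternate between the two factors.\<close>
fun reduced :: "gen list \<Rightarrow> bool" where
  "reduced (x # y # w) = (in_B x \<noteq> in_B y \<and> reduced (y # w))"
| "reduced _ = True"

text \<open>Left multiplication of a reduced word by a generator letter.\<close>
fun lmul :: "gen \<Rightarrow> gen list \<Rightarrow> gen list" where
  "lmul GA (GA # w) = w"
| "lmul GA w = GA # w"
| "lmul GB (GB # w) = GBi # w"
| "lmul GB (GBi # w) = w"
| "lmul GB w = GB # w"
| "lmul GBi (GBi # w) = GB # w"
| "lmul GBi (GB # w) = w"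
| "lmul GBi w = GBi # w"

typedef G = "{w. reduced w}"
  morphisms Rep_G Abs_G
  by (rule exI[of _ "[]"]) simp

definition gmul :: "G \<Rightarrow> G \<Rightarrow> G" where
  "gmul u v = Abs_G (foldr lmul (Rep_G u) (Rep_G v))"

definition gone :: G where "gone = Abs_G []"
definition galpha :: G where "galpha = Abs_G [GA]"
definition gbeta :: G where "gbeta = Abs_G [GB]"

section \<open>Circular orders on G and isolation in CO(G)\<close>

definition circ_order :: "(G \<times> G \<times> G \<Rightarrow> int) \<Rightarrow> bool" where
  "circ_order c \<longleftrightarrow>
     (\<forall>g1 g2 g3. c (g1, g2, g3) \<in> {-1, 0, 1}) \<and>
     (\<forall>g1 g2 g3. c (g1, g2, g3) = 0 \<longleftrightarrow> (g1 = g2 \<or> g2 = g3 \<or> g1 = g3)) \<and>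
     (\<forall>g1 g2 g3 g4. c (g2, g3, g4) - c (g1, g3, g4) + c (g1, g2, g4) - c (g1, g2, g3) = 0) \<and>
     (\<forall>g1 g2 g3 g4. c (gmul g4 g1, gmul g4 g2, gmul g4 g3) = c (g1, g2, g3))"

definition CO :: "(G \<times> G \<times> G \<Rightarrow> int) set" where
  "CO = {c. circ_order c}"

text \<open>Isolated in CO(G) for the product topology (Function_Topology) on functions to the discrete int.\<close>
definition isolated_co :: "(G \<times> G \<times> G \<Rightarrow> int) \<Rightarrow> bool" where
  "isolated_co c \<longleftrightarrow> c \<in> CO \<and> \<not> (c islimpt CO)"

section \<open>The circle\<close>

abbreviation S1 :: "complex set" where "S1 \<equiv> sphere 0 1"

text \<open>Anticlockwise angle from w to z, in [0, 2 pi).\<close>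
definition cang :: "complex \<Rightarrow> complex \<Rightarrow> real" where
  "cang w z = Arg2pi (z / w)"

text \<open>(p,q,r) distinct points of S1 in anticlockwise order.\<close>
definition ccw :: "complex \<Rightarrow> complex \<Rightarrow> complex \<Rightarrow> bool" where
  "ccw p q r \<longleftrightarrow> p \<in> S1 \<and> q \<in> S1 \<and> r \<in> S1 \<and> p \<noteq> q \<and> q \<noteq> r \<and> p \<noteq> r
      \<and> cang p q < cang p r"

definition homeo_plus :: "(complex \<Rightarrow> complex) \<Rightarrow> bool" where
  "homeo_plus f \<longleftrightarrow> (\<exists>g. homeomorphism S1 S1 f g) \<and>
     (\<forall>p q r. ccw p q r \<longrightarrow> ccw (f p) (f q) (f r))"

definition circle_action :: "(G \<Rightarrow> complex \<Rightarrow> complex) \<Rightarrow> bool" where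
  "circle_action \<rho> \<longleftrightarrow> (\<forall>g. homeo_plus (\<rho> g)) \<and> (\<forall>x\<in>S1. \<rho> gone x = x) \<and>
     (\<forall>g h. \<forall>x\<in>S1. \<rho> (gmul g h) x = \<rho> g (\<rho> h x))"

definition tight_at :: "(G \<Rightarrow> complex \<Rightarrow> complex) \<Rightarrow> complex \<Rightarrow> bool" where
  "tight_at \<rho> x0 \<longleftrightarrow> x0 \<in> S1 \<and> (\<forall>g. \<rho> g x0 = x0 \<longrightarrow> g = gone) \<and>
     (\<forall>C\<in>components (S1 - closure (range (\<lambda>g. \<rho> g x0))).
        closure C - C \<subseteq> range (\<lambda>g. \<rho> g x0))"

definition dyn_realization :: "(G \<times> G \<times> G \<Rightarrow> int) \<Rightarrow> (G \<Rightarrow> complex \<Rightarrow> complex) \<Rightarrow> complex \<Rightarrow> bool" where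
  "dyn_realization c \<rho> x0 \<longleftrightarrow> circle_action \<rho> \<and> tight_at \<rho> x0 \<and>
     (\<forall>g1 g2 g3. c (g1, g2, g3) =
        (if ccw (\<rho> g1 x0) (\<rho> g2 x0) (\<rho> g3 x0) then 1
         else if ccw (\<rho> g1 x0) (\<rho> g3 x0) (\<rho> g2 x0) then -1 else 0))"

section \<open>Markov systems\<close>

text \<open>Nondegenerate closed arc of S1 from p anticlockwise to q.\<close>
definition closed_arc :: "complex set \<Rightarrow> bool" where
  "closed_arc I \<longleftrightarrow> (\<exists>p q. p \<in> S1 \<and> q \<in> S1 \<and> p \<noteq> q \<and> I = {z. z = p \<or> z = q \<or> ccw p z q})"

definition union_k_arcs :: "nat \<Rightarrow> complex set \<Rightarrow> bool" where
  "union_k_arcs k A \<longleftrightarrow> (\<exists>I. (\<forall>i<k. closed_arc (I i)) \<and>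
      (\<forall>i<k. \<forall>j<k. i \<noteq> j \<longrightarrow> I i \<inter> I j = {}) \<and> A = (\<Union>i<k. I i))"

definition markov_system ::
  "(complex \<Rightarrow> complex) \<Rightarrow> (complex \<Rightarrow> complex) \<Rightarrow> complex set \<Rightarrow> complex set \<Rightarrow> complex set \<Rightarrow> bool" where
  "markov_system a b Aa Ab Abi \<longleftrightarrow>
    (let X = Aa \<union> Ab \<union> Abi;
         comps = components X;
         gaps = components (S1 - X);
         consec = (\<lambda>C D. C \<noteq> D \<and> (\<exists>J\<in>gaps. closure J \<inter> C \<noteq> {} \<and> closure J \<inter> D \<noteq> {}));
         gap_between = (\<lambda>J P Q. J \<in> gaps \<and> closure J \<inter> P \<noteq> {} \<and> closure J \<inter> Q \<noteq> {});
         principal = {J. gap_between J Aa (Ab \<union> Abi)};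
         complementary = {J. gap_between J Ab Abi};
         BB = Ab \<union> Abi \<union> \<Union>complementary;
         binv = inv_into S1 b;
         R = {(J, f ` J) | J f. J \<in> principal \<and> f \<in> {a, b, binv} \<and> f ` J \<in> principal}
     in
      homeo_plus a \<and> (\<forall>x\<in>S1. a (a x) = x) \<and> (\<exists>x\<in>S1. a x \<noteq> x) \<and>
      homeo_plus b \<and> (\<forall>x\<in>S1. b (b (b x)) = x) \<and> (\<exists>x\<in>S1. b x \<noteq> x) \<and>
      \<comment> \<open>(A)\<close>
      Aa \<inter> Ab = {} \<and> Aa \<inter> Abi = {} \<and> Ab \<inter> Abi = {} \<and>
      (\<exists>k::nat. k \<ge> 1 \<and> union_k_arcs k Aa \<and> union_k_arcs k Ab \<and> union_k_arcs k Abi) \<and>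
      \<comment> \<open>(B)\<close>
      (\<forall>C\<in>comps. \<forall>D\<in>comps. C \<subseteq> Aa \<and> D \<subseteq> Aa \<longrightarrow> \<not> consec C D) \<and>
      (\<forall>C\<in>comps. \<forall>D\<in>comps. C \<subseteq> Ab \<and> D \<subseteq> Ab \<longrightarrow> \<not> consec C D) \<and>
      (\<forall>C\<in>comps. \<forall>D\<in>comps. C \<subseteq> Abi \<and> D \<subseteq> Abi \<longrightarrow> \<not> consec C D) \<and>
      \<comment> \<open>(C)\<close>
      a ` Aa = BB \<and>
      \<comment> \<open>(D)\<close>
      b ` Aa = Ab \<and> b ` Ab = Abi \<and>
      \<comment> \<open>(E)\<close>
      (\<forall>J\<in>principal. \<forall>J'\<in>principal. (J, J') \<in> (R \<union> R\<inverse>)\<^sup>*))"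

end

theory Submission
  imports Defs
begin

text \<open>
  The order \<open>c\<close> is determined by its values on a finite set of words. Conjugating one of the two
  generators by a homeomorphism supported in a small arc preserves the relations, so an orbit point
  whose position were not forced by the shorter words could be moved past another one. This would give
  a second circular order with the same values. Hence each long word is inserted between two shorter
  words with the same first letter, and the first letter changes only finitely often around the orbit,
  always between an element \<open>g\<close> and its immediate successor \<open>g s\<close>. After a change of base point the word
  \<open>s\<close> is cyclically reduced. The union of the arcs between consecutive points \<open>s\<^sup>i x\<^sub>0\<close> is then a gap, the
  prefixes of \<open>s\<close> translate it to the principal and the complementary gaps, and the arcs in between,
  sorted by first letters, form the Markov system.
\<close>

section \<open>Words in the free product\<close>

text \<open>A conjugated generator still satisfies its relation, but the perturbed orbit need not be
  free, and an orbit with coincidences defines no circular order of the group. Therefore pairs of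
  points are ordered lexicographically, with the perturbed orbit first and the original free orbit
  second. The comparison takes place on lifts to the line, where a circular order is the defect of
  additivity of an integer-valued floor function; it is left invariant if both actions have lifts
  with the same deck translations, which conjugation by a lifted homeomorphism preserves. The
  perturbation must not disturb the finitely many prescribed points. For this the words to which
  letters of the conjugated factor are applied have to form a set invariant under that factor. Balls
  for the word length lack this property, so words are counted by a clock that alternates between
  the two factors. The gaps used here are not gaps of the orbit closure: each contains a whole orbit
  of a conjugate of the cyclic group generated by \<open>s\<close>. Its ends are the limits of that
  orbit, hence fixed by the conjugate of \<open>s\<close>, and a free orbit cannot contain
  them.\<close>

fun ginv :: "gen \<Rightarrow> gen" where
  "ginv GA = GA" | "ginv GB = GBi" | "ginv GBi = GB"

lemma ginv_ginv [simp]: "ginv (ginv x) = x" by (cases x) auto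
lemma in_B_ginv [simp]: "in_B (ginv x) = in_B x" by (cases x) auto
lemma not_in_B_iff: "\<not> in_B x \<longleftrightarrow> x = GA" by (cases x) auto

definition winv :: "gen list \<Rightarrow> gen list" where "winv w = rev (map ginv w)"

lemma winv_simps [simp]: "winv [] = []" "winv (x # w) = winv w @ [ginv x]"
  "winv (u @ v) = winv v @ winv u" "winv (winv w) = w" "length (winv w) = length w"
  "winv w = [] \<longleftrightarrow> w = []"
  by (auto simp: winv_def rev_map o_def)

lemma hd_winv: "w \<noteq> [] \<Longrightarrow> hd (winv w) = ginv (last w)"
  by (simp add: winv_def hd_rev last_map)

lemma last_winv: "w \<noteq> [] \<Longrightarrow> last (winv w) = ginv (hd w)"
  by (simp add: winv_def last_rev hd_map)

lemma reduced_Cons: "reduced (x # w) \<longleftrightarrow> reduced w \<and> (w \<noteq> [] \<longrightarrow> in_B x \<noteq> in_B (hd w))"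
  by (cases w) auto

lemma reduced_append:
  "reduced (u @ v) \<longleftrightarrow> reduced u \<and> reduced v \<and>
     (u \<noteq> [] \<longrightarrow> v \<noteq> [] \<longrightarrow> in_B (last u) \<noteq> in_B (hd v))"
  by (induction u) (auto simp: reduced_Cons)

lemma reduced_winv [simp]: "reduced (winv w) = reduced w"
proof (induction w)
  case (Cons x w)
  then show ?case
    by (cases "w = []") (auto simp: reduced_append reduced_Cons last_winv)
qed simp

lemma lmul_reduced: "reduced (x # w) \<Longrightarrow> lmul x w = x # w"
  by (cases "(x, w)" rule: lmul.cases) auto

lemma reduced_lmul: "reduced w \<Longrightarrow> reduced (lmul x w)"
  by (cases "(x, w)" rule: lmul.cases) (auto simp: reduced_Cons)

abbreviation wmul :: "gen list \<Rightarrow> gen list \<Rightarrow> gen list" where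
  "wmul \<equiv> foldr lmul"

lemma reduced_wmul: "reduced v \<Longrightarrow> reduced (wmul u v)"
  by (induction u) (auto intro: reduced_lmul)

lemma wmul_reduced: "reduced (u @ v) \<Longrightarrow> wmul u v = u @ v"
  by (induction u) (auto simp: reduced_Cons lmul_reduced)

lemma lmul_inverse:
  assumes "reduced w" shows "lmul (ginv x) (lmul x w) = w"
proof (cases w)
  case Nil then show ?thesis by (cases x) auto
next
  case (Cons y v)
  show ?thesis
  proof (cases "in_B x = in_B y")
    case False
    then show ?thesis by (cases x; cases y) (auto simp: Cons)
  next
    case True
    have v: "v \<noteq> [] \<longrightarrow> in_B y \<noteq> in_B (hd v)" using assms Cons by (simp add: reduced_Cons)
    show ?thesis
    proof (cases v)
      case Nil then show ?thesis using True Cons by (cases x; cases y) auto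
    next
      case (Cons z u)
      then show ?thesis using v True \<open>w = y # v\<close> by (cases x; cases y; cases z) auto
    qed
  qed
qed

lemma lmul_GB_GB:
  assumes "reduced w" shows "lmul GB (lmul GB w) = lmul GBi w" "lmul GBi (lmul GBi w) = lmul GB w"
proof -
  have "lmul GB (lmul GB w) = lmul GBi w \<and> lmul GBi (lmul GBi w) = lmul GB w"
  proof (cases w)
    case (Cons y v)
    have v: "v \<noteq> [] \<longrightarrow> in_B y \<noteq> in_B (hd v)" using assms Cons by (simp add: reduced_Cons)
    show ?thesis
    proof (cases v)
      case Nil then show ?thesis using Cons by (cases y) auto
    next
      case (Cons z u)
      then show ?thesis using v \<open>w = y # v\<close> by (cases y; cases z) auto
    qed
  qed auto
  then show "lmul GB (lmul GB w) = lmul GBi w" "lmul GBi (lmul GBi w) = lmul GB w" by auto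
qed

text \<open>Only products of two letters matter: a letter undoes its inverse, and a repeated letter
  of order three acts as the inverse letter, so every product of two letters acts on reduced words
  as it should.\<close>

lemma wmul_lmul:
  assumes w: "reduced w" shows "wmul (lmul x v) w = lmul x (wmul v w)"
proof (cases v)
  case Nil then show ?thesis by (cases x) auto
next
  case (Cons y u)
  have r: "reduced (wmul u w)" using w by (rule reduced_wmul)
  show ?thesis
    using lmul_inverse[OF r, of GA] lmul_inverse[OF r, of GB] lmul_inverse[OF r, of GBi] lmul_GB_GB[OF r]
    by (cases x; cases y) (simp_all add: Cons)
qed

lemma wmul_assoc: "reduced w \<Longrightarrow> wmul (wmul u v) w = wmul u (wmul v w)"
  by (induction u) (auto simp: wmul_lmul)

lemma wmul_winv: "reduced w \<Longrightarrow> wmul (winv u) (wmul u w) = w"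
  by (induction u arbitrary: w) (auto simp: lmul_inverse reduced_wmul)

text \<open>The second case is the merging of two equal letters of the order-three factor, which stops the
  cancellation.\<close>

lemma wmul_decompose:
  assumes "reduced g" "reduced s"
  shows "\<exists>g1 u v.
     (g = g1 @ winv u \<and> s = u @ v \<and> wmul g s = g1 @ v \<or>
      (\<exists>y. in_B y \<and> g = g1 @ y # winv u \<and> s = u @ y # v \<and> wmul g s = g1 @ ginv y # v))"
  using assms(1)
proof (induction g)
  case Nil
  have "reduced ([] @ s) \<and> [] = [] @ winv [] \<and> s = [] @ s \<and> wmul [] s = [] @ s" using assms by simp
  then show ?case by blast
next
  case (Cons x g)
  from Cons have rg: "reduced g" and rx: "reduced (x # g)" by (auto simp: reduced_Cons)
  from Cons.IH[OF rg] obtain g1 u v where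
    D: "g = g1 @ winv u \<and> s = u @ v \<and> wmul g s = g1 @ v \<or>
      (\<exists>y. in_B y \<and> g = g1 @ y # winv u \<and> s = u @ y # v \<and> wmul g s = g1 @ ginv y # v)" by blast
  show ?case
  proof (cases "g1 = []")
    case False
    have "reduced (wmul g s)" using assms reduced_wmul by blast
    then have "lmul x (wmul g s) = x # wmul g s"
      using D False rx by (intro lmul_reduced) (auto simp: reduced_Cons)
    then have "x # g = (x # g1) @ winv u \<and> s = u @ v \<and> wmul (x # g) s = (x # g1) @ v \<or>
      (\<exists>y. in_B y \<and> x # g = (x # g1) @ y # winv u \<and> s = u @ y # v \<and> wmul (x # g) s = (x # g1) @ ginv y # v)"
      using D by auto
    then show ?thesis by blast
  next
    case g1: True
    show ?thesis
    proof (cases "g = winv u \<and> s = u @ v \<and> wmul g s = v")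
      case True
      have W: "wmul (x # g) s = lmul x v" using True by (metis foldr.simps(2) o_apply)
      have gs: "g = winv u" "s = u @ v" using True by auto
      show ?thesis
      proof (cases "v \<noteq> [] \<and> in_B (hd v) = in_B x")
        case False
        then have "reduced (x # v)" using assms(2) True by (auto simp: reduced_Cons reduced_append)
        then have "x # g = [x] @ winv u \<and> s = u @ v \<and> wmul (x # g) s = [x] @ v"
          unfolding W using gs by (simp add: lmul_reduced)
        then show ?thesis by blast
      next
        case c: True
        then obtain y v' where v: "v = y # v'" by (cases v) auto
        show ?thesis
        proof (cases "y = ginv x")
          case y: True
          have "x # g = [] @ winv (u @ [y]) \<and> s = (u @ [y]) @ v' \<and> wmul (x # g) s = [] @ v'"
            unfolding W using gs v y by (cases x) auto
          then show ?thesis by blast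
        next
          case y: False
          then have "y = x" "in_B x" using c v by (cases x; cases y; auto)+
          then have "in_B x \<and> x # g = [] @ x # winv u \<and> s = u @ x # v' \<and> wmul (x # g) s = [] @ ginv x # v'"
            unfolding W using gs v by (cases x) auto
          then show ?thesis by blast
        qed
      qed
    next
      case False
      with D g1 have "\<exists>y. in_B y \<and> g = y # winv u \<and> s = u @ y # v \<and> wmul g s = ginv y # v"
        by (metis append_Nil)
      then obtain y where y: "in_B y" "g = y # winv u" "s = u @ y # v" "wmul g s = ginv y # v" by blast
      then have "x = GA" using rx not_in_B_iff by (auto simp: reduced_Cons)
      have "wmul (x # g) s = [x] @ ginv y # v"
        using y(1,4) \<open>x = GA\<close> by (cases y) auto
      then have "in_B y \<and> x # g = [x] @ y # winv u \<and> s = u @ y # v \<and> wmul (x # g) s = [x] @ ginv y # v"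
        using y by simp
      then show ?thesis by blast
    qed
  qed
qed


section \<open>The cyclic order of the circle\<close>

text \<open>Anticlockwise order of three angles in one common interval of length
  \<open>2 * pi\<close>. It turns statements about points on the circle into linear
  arithmetic.\<close>

definition cyc3 :: "real \<Rightarrow> real \<Rightarrow> real \<Rightarrow> bool" where
  "cyc3 a b c \<longleftrightarrow> a < b \<and> b < c \<or> b < c \<and> c < a \<or> c < a \<and> a < b"

lemma cis_Arg2pi: "z \<in> S1 \<Longrightarrow> cis (Arg2pi z) = z"
  using Arg2pi_eq[of z] by (simp add: cis_conv_exp mult.commute)

lemma cis_in_S1 [simp]: "cis t \<in> S1" by simp

lemma Arg2pi_cis: "0 \<le> t \<Longrightarrow> t < 2 * pi \<Longrightarrow> Arg2pi (cis t) = t"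
  by (rule Arg2pi_unique[of 1]) (auto simp: cis_conv_exp mult.commute)

lemma Arg2pi_inj: "z \<in> S1 \<Longrightarrow> w \<in> S1 \<Longrightarrow> Arg2pi z = Arg2pi w \<longleftrightarrow> z = w"
  using cis_Arg2pi by metis

lemma cis_eq_cis_iff: "cis s = cis t \<longleftrightarrow> (\<exists>n::int. s = t + 2 * pi * of_int n)"
proof -
  have "cis s = cis t \<longleftrightarrow> exp (\<i> * of_real s) = exp (\<i> * of_real t)" by (simp add: cis_conv_exp)
  also have "\<dots> \<longleftrightarrow> (\<exists>n::int. \<i> * of_real s = \<i> * of_real t + of_int (2 * n) * pi * \<i>)"
    by (rule exp_eq)
  also have "\<dots> \<longleftrightarrow> (\<exists>n::int. s = t + 2 * pi * of_int n)"
  proof (rule arg_cong[where f=Ex], rule ext)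
    fix n :: int
    have "\<i> * complex_of_real s = \<i> * of_real t + of_int (2 * n) * pi * \<i> \<longleftrightarrow>
      \<i> * complex_of_real s = \<i> * of_real (t + 2 * pi * of_int n)"
      by (simp add: algebra_simps)
    also have "\<dots> \<longleftrightarrow> s = t + 2 * pi * of_int n" by (simp only: mult_cancel_left of_real_eq_iff) simp
    finally show "(\<i> * complex_of_real s = \<i> * of_real t + of_int (2 * n) * pi * \<i>) = (s = t + 2 * pi * of_int n)" .
  qed
  finally show ?thesis .
qed

lemma cang_eq:
  assumes "w \<in> S1" "z \<in> S1"
  shows "cang w z = (if Arg2pi w \<le> Arg2pi z then Arg2pi z - Arg2pi w else Arg2pi z - Arg2pi w + 2 * pi)"
proof -
  let ?t = "if Arg2pi w \<le> Arg2pi z then Arg2pi z - Arg2pi w else Arg2pi z - Arg2pi w + 2 * pi"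
  have b: "0 \<le> Arg2pi z" "Arg2pi z < 2 * pi" "0 \<le> Arg2pi w" "Arg2pi w < 2 * pi"
    by (auto simp: Arg2pi_ge_0 Arg2pi_lt_2pi)
  have "z / w = cis (Arg2pi z) / cis (Arg2pi w)" using assms by (simp only: cis_Arg2pi)
  also have "\<dots> = cis (Arg2pi z - Arg2pi w)" by (simp add: cis_divide)
  also have "\<dots> = cis ?t" unfolding cis_eq_cis_iff
    by (rule exI[of _ "if Arg2pi w \<le> Arg2pi z then 0 else -1"]) auto
  finally have "cang w z = Arg2pi (cis ?t)" by (simp add: cang_def)
  also have "\<dots> = ?t" using b by (intro Arg2pi_cis) auto
  finally show ?thesis .
qed

lemma cang_bounds: "0 \<le> cang w z" "cang w z < 2 * pi"
  by (auto simp: cang_def Arg2pi_ge_0 Arg2pi_lt_2pi)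

lemma cang_cis: "w \<in> S1 \<Longrightarrow> w * cis (cang w z) = z" if "z \<in> S1"
  using that cis_Arg2pi[of "z / w"] by (auto simp: cang_def norm_divide)

lemma ccw_iff:
  "ccw p q r \<longleftrightarrow> p \<in> S1 \<and> q \<in> S1 \<and> r \<in> S1 \<and> cyc3 (Arg2pi p) (Arg2pi q) (Arg2pi r)"
proof (cases "p \<in> S1 \<and> q \<in> S1 \<and> r \<in> S1")
  case True
  then have S: "p \<in> S1" "q \<in> S1" "r \<in> S1" by auto
  have b: "0 \<le> Arg2pi z" "Arg2pi z < 2 * pi" for z by (auto simp: Arg2pi_ge_0 Arg2pi_lt_2pi)
  show ?thesis
    unfolding ccw_def cang_eq[OF S(1,2)] cang_eq[OF S(1,3)] cyc3_def
    using b[of p] b[of q] b[of r] Arg2pi_inj[OF S(1,2)] Arg2pi_inj[OF S(2,3)] Arg2pi_inj[OF S(1,3)] S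
    by auto
qed (auto simp: ccw_def)

lemma ccw_S1: "ccw p q r \<Longrightarrow> p \<in> S1 \<and> q \<in> S1 \<and> r \<in> S1" by (simp add: ccw_def)
lemma ccw_distinct: "ccw p q r \<Longrightarrow> p \<noteq> q \<and> q \<noteq> r \<and> p \<noteq> r" by (simp add: ccw_def)
lemma ccw_rotate: "ccw p q r \<Longrightarrow> ccw q r p" by (auto simp: ccw_iff cyc3_def)
lemma ccw_asym: "ccw p q r \<Longrightarrow> \<not> ccw p r q" by (auto simp: ccw_iff cyc3_def)
lemma ccw_total: "p \<in> S1 \<Longrightarrow> q \<in> S1 \<Longrightarrow> r \<in> S1 \<Longrightarrow> p \<noteq> q \<Longrightarrow> q \<noteq> r \<Longrightarrow> p \<noteq> r \<Longrightarrow> ccw p q r \<or> ccw p r q"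
  using Arg2pi_inj[of p q] Arg2pi_inj[of q r] Arg2pi_inj[of p r] unfolding ccw_iff cyc3_def by auto
lemma ccw_trans: "ccw p q r \<Longrightarrow> ccw p r t \<Longrightarrow> ccw p q t" by (auto simp: ccw_iff cyc3_def)
lemma ccw_cang: "ccw p q r \<longleftrightarrow> p \<in> S1 \<and> q \<in> S1 \<and> r \<in> S1 \<and> 0 < cang p q \<and> cang p q < cang p r"
proof (cases "p \<in> S1 \<and> q \<in> S1 \<and> r \<in> S1")
  case True
  have "0 < cang p q \<longleftrightarrow> p \<noteq> q" if "p \<in> S1" "q \<in> S1" for p q
    using cang_eq[OF that] Arg2pi_inj[OF that] Arg2pi_lt_2pi[of p] Arg2pi_ge_0[of q] by auto
  from this[of p q] this[of p r] True have "0 < cang p q \<longleftrightarrow> p \<noteq> q" "0 < cang p r \<longleftrightarrow> p \<noteq> r" by auto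
  with True cang_bounds(1)[of p q] show ?thesis unfolding ccw_def by (smt (verit))
qed (auto simp: ccw_def)

lemma cang_inj: "p \<in> S1 \<Longrightarrow> q \<in> S1 \<Longrightarrow> r \<in> S1 \<Longrightarrow> cang p q = cang p r \<longleftrightarrow> q = r"
  using cang_cis by metis

lemma homeo_plus_S1: "homeo_plus f \<Longrightarrow> z \<in> S1 \<Longrightarrow> f z \<in> S1"
  unfolding homeo_plus_def homeomorphism_def by blast

lemma homeo_plus_inj: "homeo_plus f \<Longrightarrow> z \<in> S1 \<Longrightarrow> w \<in> S1 \<Longrightarrow> f z = f w \<longleftrightarrow> z = w"
  unfolding homeo_plus_def homeomorphism_def by metis

lemma homeo_plus_ccw:
  assumes "homeo_plus f" "p \<in> S1" "q \<in> S1" "r \<in> S1"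
  shows "ccw (f p) (f q) (f r) \<longleftrightarrow> ccw p q r"
proof
  assume "ccw p q r" then show "ccw (f p) (f q) (f r)" using assms by (simp add: homeo_plus_def)
next
  assume c: "ccw (f p) (f q) (f r)"
  then have "p \<noteq> q" "q \<noteq> r" "p \<noteq> r" by (auto simp: ccw_def)
  then have "ccw p q r \<or> ccw p r q" using assms by (intro ccw_total) auto
  moreover have "\<not> ccw p r q" using c assms ccw_asym by (auto simp: homeo_plus_def)
  ultimately show "ccw p q r" by blast
qed

lemma homeo_plus_continuous: "homeo_plus f \<Longrightarrow> continuous_on S1 f"
  unfolding homeo_plus_def homeomorphism_def by blast


section \<open>Lifting circle maps to the line\<close>

definition periodic_mono :: "(real \<Rightarrow> real) \<Rightarrow> bool" where
  "periodic_mono F \<longleftrightarrow> strict_mono F \<and> (\<forall>x. F (x + 2 * pi) = F x + 2 * pi)"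

lemma periodic_mono_shift:
  assumes "periodic_mono F" shows "F (x + 2 * pi * of_int k) = F x + 2 * pi * of_int k"
proof (induction k rule: int_induct[of _ 0])
  case (step1 i)
  have "F ((x + 2 * pi * of_int i) + 2 * pi) = F (x + 2 * pi * of_int i) + 2 * pi"
    using assms by (simp only: periodic_mono_def)
  then show ?case using step1 by (simp add: distrib_left add.assoc)
next
  case (step2 i)
  have "F ((x + 2 * pi * of_int (i - 1)) + 2 * pi) = F (x + 2 * pi * of_int (i - 1)) + 2 * pi"
    using assms by (simp only: periodic_mono_def)
  then show ?case using step2 by (simp add: right_diff_distrib add.assoc)
qed simp

lemma periodic_mono_minus:
  assumes "periodic_mono F" shows "F (x - 2 * pi * of_int k) = F x - 2 * pi * of_int k"
  using periodic_mono_shift[OF assms, of x "- k"] by simp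

lemma periodic_mono_less: "periodic_mono F \<Longrightarrow> F x < F y \<longleftrightarrow> x < y"
  unfolding periodic_mono_def by (simp add: strict_mono_less)

lemma periodic_mono_eq: "periodic_mono F \<Longrightarrow> F x = F y \<longleftrightarrow> x = y"
  unfolding periodic_mono_def by (simp add: strict_mono_eq)

lemma cis_shift [simp]: "cis (x + 2 * pi * of_int k) = cis x"
  unfolding cis_eq_cis_iff by auto

lemma real_mod_2pi:
  obtains n :: int and t where "x = P + t + 2 * pi * of_int n" "0 \<le> t" "t < 2 * pi"
proof -
  define n where "n = \<lfloor>(x - P) / (2 * pi)\<rfloor>"
  have "of_int n \<le> (x - P) / (2 * pi)" "(x - P) / (2 * pi) < of_int n + 1" unfolding n_def by linarith+
  then show ?thesis by (intro that[of "x - P - 2 * pi * of_int n" n]) (auto simp: field_simps)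
qed

lemma homeo_plus_lift:
  assumes f: "homeo_plus f"
  obtains F where "periodic_mono F" "\<And>x. cis (F x) = f (cis x)"
proof -
  \<comment> \<open>The angle from \<open>f 1\<close> grows strictly along one turn because
    \<open>f\<close> preserves the cyclic order, and the floor adds a full turn at each passage
    through 1.\<close>
  define F where "F x = Arg2pi (f 1) + cang (f 1) (f (cis x)) + 2 * pi * of_int \<lfloor>x / (2 * pi)\<rfloor>" for x
  have S: "f (cis x) \<in> S1" "f 1 \<in> S1" for x using f homeo_plus_S1 by auto
  have cisF: "cis (F x) = f (cis x)" for x
  proof -
    have "cis (F x) = cis (Arg2pi (f 1)) * cis (cang (f 1) (f (cis x)))"
      unfolding F_def by (simp add: cis_mult)
    then show ?thesis using S by (simp add: cis_Arg2pi cang_cis)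
  qed
  have per: "F (x + 2 * pi) = F x + 2 * pi" for x
  proof -
    have "(x + 2 * pi) / (2 * pi) = x / (2 * pi) + 1" by (simp add: field_simps)
    then have "\<lfloor>(x + 2 * pi) / (2 * pi)\<rfloor> = \<lfloor>x / (2 * pi)\<rfloor> + 1" by simp
    moreover have "cis (x + 2 * pi) = cis x" using cis_shift[of x 1] by simp
    ultimately show ?thesis unfolding F_def by (simp add: algebra_simps)
  qed
  have mono: "F x < F y" if "x < y" for x y
  proof -
    define n where "n = \<lfloor>x / (2 * pi)\<rfloor>" 
    define n' where "n' = \<lfloor>y / (2 * pi)\<rfloor>"
    have "n \<le> n'" unfolding n_def n'_def using that by (intro floor_mono divide_right_mono) auto
    show ?thesis
    proof (cases "n = n'")
      case False
      with \<open>n \<le> n'\<close> have "of_int n + 1 \<le> (of_int n' :: real)" by linarith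
      then have "2 * pi * of_int n + 2 * pi \<le> 2 * pi * (of_int n' :: real)"
        by (metis (no_types, opaque_lifting) distrib_left mult.right_neutral mult_left_mono pi_ge_zero
            mult_nonneg_nonneg zero_le_numeral)
      then show ?thesis unfolding F_def n_def[symmetric] n'_def[symmetric]
        using cang_bounds(2)[of "f 1" "f (cis x)"] cang_bounds(1)[of "f 1" "f (cis y)"] by linarith
    next
      case True
      define s where "s = x - 2 * pi * of_int n"
      define t where "t = y - 2 * pi * of_int n"
      have "of_int n \<le> x / (2 * pi)" "y / (2 * pi) < of_int n + 1"
        using True unfolding n_def n'_def by linarith+
      then have st: "0 \<le> s" "s < t" "t < 2 * pi"
        using that by (auto simp: s_def t_def field_simps)
      have cs: "cis x = cis s" "cis y = cis t" 
        using cis_shift[of s n] cis_shift[of t n] by (auto simp: s_def t_def)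
      have a: "Arg2pi (cis s) = s" "Arg2pi (cis t) = t" "Arg2pi (cis 0) = 0"
        using st Arg2pi_cis[of s] Arg2pi_cis[of t] Arg2pi_cis[of 0] pi_gt_zero by (simp_all del: cis_zero)
      have "cang (f 1) (f (cis s)) < cang (f 1) (f (cis t))"
      proof (cases "s = 0")
        case True
        have "cis t \<noteq> 1" using a st True by (metis cis_zero less_irrefl)
        then have "f (cis t) \<noteq> f 1" using homeo_plus_inj[OF f, of "cis t" 1] by auto
        then have "cang (f 1) (f (cis t)) \<noteq> cang (f 1) (f 1)"
          using cang_inj[of "f 1" "f (cis t)" "f 1"] S by auto
        moreover have "cang (f 1) (f 1) = 0" using cang_eq[of "f 1" "f 1"] S by simp
        ultimately show ?thesis using True cang_bounds(1)[of "f 1" "f (cis t)"] by simp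
      next
        case False
        have "ccw (cis 0) (cis s) (cis t)"
          unfolding ccw_iff using a st False by (simp add: cyc3_def)
        then have "ccw (f 1) (f (cis s)) (f (cis t))"
          using f unfolding homeo_plus_def by fastforce
        then show ?thesis by (simp add: ccw_cang)
      qed
      then show ?thesis unfolding F_def n_def[symmetric] n'_def[symmetric] using True cs by simp
    qed
  qed
  show ?thesis using that[of F] cisF per mono by (auto simp: periodic_mono_def strict_mono_def)
qed

text \<open>The number of turns cannot vary: for \<open>t\<close> between 0 and
  \<open>2 * pi\<close> the value \<open>F t\<close> lies between \<open>F 0\<close> and
  \<open>F 0 + 2 * pi\<close>, which leaves only the number belonging to 0, and periodicity does the
  rest.\<close>

lemma lift_of_identity:
  assumes F: "periodic_mono F" and c: "\<And>x. cis (F x) = cis x"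
  obtains k :: int where "\<And>x. F x = x + 2 * pi * of_int k"
proof -
  have "\<exists>n::int. F x = x + 2 * pi * of_int n" for x using c[of x] by (simp add: cis_eq_cis_iff)
  then obtain n :: "real \<Rightarrow> int" where n: "F x = x + 2 * pi * of_int (n x)" for x by metis
  have eq: "n t = n 0" if t: "0 \<le> t" "t < 2 * pi" for t
  proof (cases "t = 0")
    case False
    have "F (0 + 2 * pi) = F 0 + 2 * pi" using F by (simp only: periodic_mono_def)
    moreover have "F 0 < F t" "F t < F (0 + 2 * pi)" using t False F by (simp_all add: periodic_mono_less)
    ultimately have "2 * pi * of_int (n 0) < t + 2 * pi * of_int (n t)"
      "t + 2 * pi * of_int (n t) < 2 * pi * of_int (n 0) + 2 * pi"
      using n[of 0] n[of t] by linarith+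
    then have "2 * pi * of_int (n 0) < 2 * pi * (of_int (n t) + 1)"
      "2 * pi * of_int (n t) < 2 * pi * (of_int (n 0) + 1)"
      using t unfolding distrib_left by linarith+
    then have "of_int (n 0) < (of_int (n t) + 1 :: real)" "of_int (n t) < (of_int (n 0) + 1 :: real)"
      by (simp_all add: mult_less_cancel_left_pos)
    then show ?thesis by linarith
  qed simp
  have "F x = x + 2 * pi * of_int (n 0)" for x
  proof -
    obtain j t where x: "x = 0 + t + 2 * pi * of_int j" and t: "0 \<le> t" "t < 2 * pi" by (rule real_mod_2pi)
    from t have "n t = n 0" by (rule eq)
    then have "F t = t + 2 * pi * of_int (n 0)" using n[of t] by metis
    moreover have "F x = F t + 2 * pi * of_int j"
      using periodic_mono_shift[OF F, of t j] by (simp add: x)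
    ultimately show ?thesis by (simp add: x)
  qed
  then show ?thesis using that by blast
qed

lemma periodic_mono_comp: "periodic_mono F \<Longrightarrow> periodic_mono H \<Longrightarrow> periodic_mono (\<lambda>x. F (H x))"
  unfolding periodic_mono_def strict_mono_def by simp

text \<open>\<open>B\<close> has order three only up to \<open>m\<close> turns. Subtracting them
  makes the lift of \<open>GBi\<close> an exact inverse of \<open>B\<close>, so deck translations
  enter only when a letter is multiplied by itself.\<close>

definition lletter :: "(real \<Rightarrow> real) \<Rightarrow> (real \<Rightarrow> real) \<Rightarrow> int \<Rightarrow> gen \<Rightarrow> real \<Rightarrow> real" where
  "lletter A B m s = (case s of GA \<Rightarrow> A | GB \<Rightarrow> B | GBi \<Rightarrow> (\<lambda>x. B (B x) - 2 * pi * of_int m))"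

lemma lletter_simps [simp]:
  "lletter A B m GA = A" "lletter A B m GB = B" "lletter A B m GBi = (\<lambda>x. B (B x) - 2 * pi * of_int m)"
  by (auto simp: lletter_def)

definition lifted :: "(real \<Rightarrow> real) \<Rightarrow> (real \<Rightarrow> real) \<Rightarrow> int \<Rightarrow> int \<Rightarrow> bool" where
  "lifted A B k m \<longleftrightarrow> periodic_mono A \<and> periodic_mono B \<and>
     (\<forall>x. A (A x) = x + 2 * pi * of_int k) \<and> (\<forall>x. B (B (B x)) = x + 2 * pi * of_int m)"

lemma periodic_mono_lletter: "lifted A B k m \<Longrightarrow> periodic_mono (lletter A B m s)"
proof (cases s)
  case GBi
  assume "lifted A B k m"
  then have B: "periodic_mono B" by (simp add: lifted_def)
  have "periodic_mono (\<lambda>x. B (B x))" using periodic_mono_comp[OF B B] .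
  then show ?thesis unfolding GBi lletter_simps periodic_mono_def strict_mono_def
    by (metis add_diff_eq diff_add_eq diff_strict_right_mono)
qed (simp_all add: lifted_def)

text \<open>The lifts satisfy the relations of the group only up to deck transformations, and the
  deck transformation depends on the exponents \<open>k\<close> and \<open>m\<close> alone. So it is the same for any two
  lifted actions with equal exponents.\<close>

lemma lift_lmul:
  "\<exists>j::int. \<forall>A B x. lifted A B k m \<longrightarrow> foldr (lletter A B m) (lmul s w) x =
     lletter A B m s (foldr (lletter A B m) w x) + 2 * pi * of_int j"
proof (cases "(s, w)" rule: lmul.cases)
  case (1 v) then show ?thesis by (intro exI[of _ "- k"]) (simp add: lifted_def)
next
  case (3 v) then show ?thesis by (intro exI[of _ "- m"]) (simp add: lifted_def)
next
  case (4 v) then show ?thesis by (intro exI[of _ 0]) (simp add: lifted_def periodic_mono_minus)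
next
  case (6 v) then show ?thesis by (intro exI[of _ m]) (simp add: lifted_def periodic_mono_minus)
next
  case (7 v) then show ?thesis by (intro exI[of _ 0]) (simp add: lifted_def periodic_mono_minus)
qed (simp_all add: exI[of _ 0])

section \<open>Lexicographic circular orders\<close>

text \<open>Think of \<open>fl x y\<close> as the number of full turns that fit between lifts of
  \<open>x\<close> and \<open>y\<close>. Its defect of additivity is 0 if the three points are met
  anticlockwise within one turn and 1 otherwise; \<open>1 - 2 * defect\<close> makes this a
  sign.\<close>

definition circ_of :: "('a \<Rightarrow> 'a \<Rightarrow> int) \<Rightarrow> 'a \<times> 'a \<times> 'a \<Rightarrow> int" where
  "circ_of fl = (\<lambda>(x, y, z). if x = y \<or> y = z \<or> x = z then 0 else 1 - 2 * (fl x z - fl x y - fl y z))"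

text \<open>The defect is a coboundary, so its alternating sum cancels on distinct points. If points
  coincide, at least two terms vanish and the rest cancel, by antisymmetry of \<open>fl\<close>
  where needed.\<close>

lemma circ_of_cocycle:
  assumes "\<And>x y z. 0 \<le> fl x z - fl x y - fl y z \<and> fl x z - fl x y - fl y z \<le> 1"
    and a: "\<And>x y. x \<noteq> y \<Longrightarrow> fl x y + fl y x = -1"
  shows "circ_of fl (x, y, z) \<in> {-1, 0, 1}"
    and "circ_of fl (x, y, z) = 0 \<longleftrightarrow> x = y \<or> y = z \<or> x = z"
    and "circ_of fl (y, z, w) - circ_of fl (x, z, w) + circ_of fl (x, y, w) - circ_of fl (x, y, z) = 0"
proof -
  have b: "fl x z - fl x y - fl y z = 0 \<or> fl x z - fl x y - fl y z = 1" for x y z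
    using assms(1)[where x=x and y=y and z=z] by linarith
  show "circ_of fl (x, y, z) \<in> {-1, 0, 1}" "circ_of fl (x, y, z) = 0 \<longleftrightarrow> x = y \<or> y = z \<or> x = z"
    using b[where x=x and y=y and z=z] by (auto simp: circ_of_def)
  consider "x = y" | "y = z" | "z = w" | "x = z" "x \<noteq> y" "z \<noteq> w" | "x = w" "x \<noteq> y" "x \<noteq> z" "y \<noteq> z"
     | "y = w" "x \<noteq> y" "y \<noteq> z" "x \<noteq> z" | "x \<noteq> y" "y \<noteq> z" "z \<noteq> w" "x \<noteq> z" "x \<noteq> w" "y \<noteq> w" by blast
  then show "circ_of fl (y, z, w) - circ_of fl (x, z, w) + circ_of fl (x, y, w) - circ_of fl (x, y, z) = 0"
    using a[of x y] a[of y z] a[of z w] a[of x z] a[of x w] a[of y w]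
    by cases (simp_all add: circ_of_def)
qed

definition lexle :: "real \<times> real \<Rightarrow> real \<times> real \<Rightarrow> bool" where
  "lexle P Q \<longleftrightarrow> fst P < fst Q \<or> fst P = fst Q \<and> snd P \<le> snd Q"

definition deck :: "int \<Rightarrow> real \<times> real \<Rightarrow> real \<times> real" where
  "deck j P = (fst P + 2 * pi * of_int j, snd P + 2 * pi * of_int j)"

text \<open>If \<open>d\<close> is an integer, the first coordinates agree after \<open>d\<close>
  turns and the second ones decide: when they are then in the wrong order, one turn fewer
  fits.\<close>

definition lexfloor :: "real \<times> real \<Rightarrow> real \<times> real \<Rightarrow> int" where
  "lexfloor P Q = (let d = (fst Q - fst P) / (2 * pi); e = (snd Q - snd P) / (2 * pi) in
     if of_int \<lfloor>d\<rfloor> = d \<and> e < d then \<lfloor>d\<rfloor> - 1 else \<lfloor>d\<rfloor>)"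

text \<open>This adjunction characterizes \<open>lexfloor\<close>: most of its properties follow by
  comparing the integers \<open>j\<close> below both sides.\<close>

lemma lexle_deck_iff: "lexle (deck j P) Q \<longleftrightarrow> j \<le> lexfloor P Q"
proof -
  define d where "d = (fst Q - fst P) / (2 * pi)"
  define e where "e = (snd Q - snd P) / (2 * pi)"
  have "fst P + 2 * pi * of_int j < fst Q \<longleftrightarrow> of_int j < d" "fst P + 2 * pi * of_int j = fst Q \<longleftrightarrow> of_int j = d"
     "snd P + 2 * pi * of_int j \<le> snd Q \<longleftrightarrow> of_int j \<le> e"
    using pi_gt_zero by (auto simp: d_def e_def field_simps)
  then have "lexle (deck j P) Q \<longleftrightarrow> of_int j < d \<or> of_int j = d \<and> of_int j \<le> e"
    by (simp add: lexle_def deck_def)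
  also have "\<dots> \<longleftrightarrow> j \<le> (if of_int \<lfloor>d\<rfloor> = d \<and> e < d then \<lfloor>d\<rfloor> - 1 else \<lfloor>d\<rfloor>)"
  proof (cases "of_int \<lfloor>d\<rfloor> = d")
    case True
    then obtain n :: int where "d = of_int n" by metis
    then show ?thesis by auto
  next
    case False
    then have "of_int j \<noteq> d" by (metis floor_of_int)
    then have "of_int j < d \<longleftrightarrow> j \<le> \<lfloor>d\<rfloor>" by (simp add: le_floor_iff less_le)
    then show ?thesis using False \<open>of_int j \<noteq> d\<close> by auto
  qed
  finally show ?thesis by (simp add: lexfloor_def d_def e_def Let_def)
qed

lemma int_eqI_le: "(\<And>j::int. j \<le> a \<longleftrightarrow> j \<le> b) \<Longrightarrow> a = b"
  by (meson order_antisym order_refl)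

lemma lexfloor_eqI: "(\<And>j. lexle (deck j P) Q \<longleftrightarrow> lexle (deck j P') Q') \<Longrightarrow> lexfloor P Q = lexfloor P' Q'"
  unfolding lexle_deck_iff by (rule int_eqI_le) blast

lemma lexle_deck_deck [simp]: "lexle (deck j P) (deck j Q) = lexle P Q"
  by (auto simp: lexle_def deck_def)

lemma deck_deck [simp]: "deck i (deck j P) = deck (i + j) P" "deck 0 P = P"
  by (auto simp: deck_def algebra_simps)

lemma lexle_trans: "lexle P Q \<Longrightarrow> lexle Q R \<Longrightarrow> lexle P R" by (auto simp: lexle_def)
lemma lexle_linear: "lexle P Q \<or> lexle Q P" by (auto simp: lexle_def)
lemma lexle_antisym: "lexle P Q \<Longrightarrow> lexle Q P \<Longrightarrow> P = Q" by (auto simp: lexle_def prod_eq_iff)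

lemma lexfloor_deck: "lexfloor (deck a P) (deck b Q) = lexfloor P Q - a + b"
proof -
  have "j \<le> lexfloor (deck a P) (deck b Q) \<longleftrightarrow> j \<le> lexfloor P Q - a + b" for j
  proof -
    have "lexle (deck j (deck a P)) (deck b Q) \<longleftrightarrow> lexle (deck b (deck (j + a - b) P)) (deck b Q)" by simp
    then show ?thesis unfolding lexle_deck_deck unfolding lexle_deck_iff by linarith
  qed
  then show ?thesis by (rule int_eqI_le)
qed

text \<open>As for the ordinary floor: admissible shifts compose, which gives superadditivity, and
  two shifts that are each one turn too large compose to an overshoot, which limits the error to
  one.\<close>

lemma lexfloor_bounds:
  "0 \<le> lexfloor P R - lexfloor P Q - lexfloor Q R" "lexfloor P R - lexfloor P Q - lexfloor Q R \<le> 1"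
proof -
  let ?a = "lexfloor P Q" and ?b = "lexfloor Q R"
  have "lexle (deck ?b (deck ?a P)) (deck ?b Q)" "lexle (deck ?b Q) R"
    unfolding lexle_deck_deck by (simp_all add: lexle_deck_iff)
  then have "lexle (deck (?b + ?a) P) R" using lexle_trans by fastforce
  then show "0 \<le> lexfloor P R - ?a - ?b" by (simp add: lexle_deck_iff)
  have n: "\<not> lexle (deck (?a + 1) P) Q" "\<not> lexle (deck (?b + 1) Q) R" by (simp_all add: lexle_deck_iff)
  have "\<not> lexle (deck (?a + ?b + 2) P) R"
  proof
    assume *: "lexle (deck (?a + ?b + 2) P) R"
    have "lexle R (deck (?b + 1) Q)" using n lexle_linear by blast
    with * have "lexle (deck (?a + ?b + 2) P) (deck (?b + 1) Q)" by (rule lexle_trans)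
    moreover have "deck (?a + ?b + 2) P = deck (?b + 1) (deck (?a + 1) P)" by (simp add: algebra_simps)
    ultimately have "lexle (deck (?a + 1) P) Q" by (simp only: lexle_deck_deck)
    then show False using n by simp
  qed
  then show "lexfloor P R - ?a - ?b \<le> 1" by (simp add: lexle_deck_iff)
qed

lemma lexfloor_antisym:
  assumes "\<And>j. deck j P \<noteq> Q" shows "lexfloor P Q + lexfloor Q P = -1"
proof -
  have "j \<le> lexfloor P Q \<longleftrightarrow> j \<le> - lexfloor Q P - 1" for j
  proof -
    have "lexle (deck j P) Q \<longleftrightarrow> \<not> lexle Q (deck j P)"
      using assms lexle_linear lexle_antisym by metis
    also have "lexle Q (deck j P) \<longleftrightarrow> lexle (deck (- j) Q) (deck (- j) (deck j P))"
      by (simp only: lexle_deck_deck)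
    also have "\<dots> \<longleftrightarrow> - j \<le> lexfloor Q P" by (simp add: lexle_deck_iff)
    finally show ?thesis unfolding lexle_deck_iff by linarith
  qed
  then have "lexfloor P Q = - lexfloor Q P - 1" by (rule int_eqI_le)
  then show ?thesis by simp
qed

lemma lexfloor_ccw:
  assumes d: "cis (fst P) \<noteq> cis (fst Q)" "cis (fst Q) \<noteq> cis (fst R)" "cis (fst P) \<noteq> cis (fst R)"
  shows "lexfloor P R - lexfloor P Q - lexfloor Q R = (if ccw (cis (fst P)) (cis (fst Q)) (cis (fst R)) then 0 else 1)"
proof -
  have repr: "\<exists>(i::int) s. fst Q = fst P + 2 * pi * of_int i + s \<and> 0 < s \<and> s < 2 * pi \<and> 
        cang (cis (fst P)) (cis (fst Q)) = s \<and> lexfloor P Q = i" if d: "cis (fst P) \<noteq> cis (fst Q)" for P Q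
  proof -
    define i where "i = \<lfloor>(fst Q - fst P) / (2 * pi)\<rfloor>"
    define s where "s = fst Q - fst P - 2 * pi * of_int i"
    have Q: "fst Q = fst P + 2 * pi * of_int i + s" by (simp add: s_def)
    have "of_int i \<le> (fst Q - fst P) / (2 * pi)" "(fst Q - fst P) / (2 * pi) < of_int i + 1"
      unfolding i_def by linarith+
    then have s: "0 \<le> s" "s < 2 * pi" by (auto simp: s_def field_simps)
    have "s \<noteq> 0" using d Q by auto
    moreover have "cang (cis (fst P)) (cis (fst Q)) = Arg2pi (cis s)"
    proof -
      have "cis (fst Q) / cis (fst P) = cis (s + 2 * pi * of_int i)" by (simp add: cis_divide s_def)
      then show ?thesis unfolding cang_def by simp
    qed
    moreover have "lexfloor P Q = i"
    proof -
      have "of_int i \<noteq> (fst Q - fst P) / (2 * pi)" using \<open>s \<noteq> 0\<close> unfolding s_def by (auto simp: field_simps)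
      then show ?thesis by (auto simp: lexfloor_def i_def Let_def)
    qed
    ultimately show ?thesis using s Q Arg2pi_cis[of s] by (intro exI[of _ i] exI[of _ s]) auto
  qed
  obtain i s where 1: "fst Q = fst P + 2 * pi * of_int i + s" "0 < s" "s < 2 * pi"
    "cang (cis (fst P)) (cis (fst Q)) = s" "lexfloor P Q = i" using repr[OF d(1)] by blast
  obtain j t where 2: "fst R = fst P + 2 * pi * of_int j + t" "0 < t" "t < 2 * pi"
    "cang (cis (fst P)) (cis (fst R)) = t" "lexfloor P R = j" using repr[OF d(3)] by blast
  obtain l r where 3: "fst R = fst Q + 2 * pi * of_int l + r" "0 < r" "r < 2 * pi"
    "lexfloor Q R = l" using repr[OF d(2)] by blast
  define n where "n = j - i - l"
  \<comment> \<open>\<open>s\<close>, \<open>r\<close> and \<open>t\<close> lie strictly between 0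
    and one turn, so \<open>n\<close> is 0 or 1, and it is 0 exactly when \<open>Q\<close> is met
    before \<open>R\<close> on the way from \<open>P\<close>.\<close>
  have e: "2 * pi * of_int n = s + r - t" using 1 2 3 by (simp add: n_def algebra_simps)
  have c: "ccw (cis (fst P)) (cis (fst Q)) (cis (fst R)) \<longleftrightarrow> s < t" using 1 2 by (simp add: ccw_cang)
  show ?thesis
  proof (cases "s < t")
    case True
    then have "2 * pi * of_int n < 2 * pi * 1" "2 * pi * (- 1) < 2 * pi * of_int n" using e 1 2 3 by linarith+
    then have "of_int n < (1::real)" "-1 < (of_int n :: real)" by (simp_all only: mult_less_cancel_left_pos pi_gt_zero mult_pos_pos zero_less_numeral)
    then have "n = 0" by linarith
    then show ?thesis using c True 1(5) 2(5) 3(4) by (simp add: n_def)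
  next
    case False
    moreover have "s \<noteq> t" 
      using d(2) 1(1) 2(1) cis_shift[of "fst P + s" i] cis_shift[of "fst P + s" j] by (auto simp: algebra_simps)
    ultimately have "2 * pi * of_int n < 2 * pi * 2" "2 * pi * 0 < 2 * pi * of_int n" using e 1 2 3 by linarith+
    then have "of_int n < (2::real)" "0 < (of_int n :: real)" by (simp_all only: mult_less_cancel_left_pos pi_gt_zero mult_pos_pos zero_less_numeral)
    then have "n = 1" by linarith
    then show ?thesis using c False 1(5) 2(5) 3(4) by (simp add: n_def)
  qed
qed


section \<open>The lexicographic order of two orbits as a circular order of the group\<close>

lemma Rep_gmul: "Rep_G (gmul u v) = wmul (Rep_G u) (Rep_G v)"
  unfolding gmul_def by (rule Abs_G_inverse) (use Rep_G reduced_wmul in auto)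

lemma reduced_Rep [simp]: "reduced (Rep_G g)" using Rep_G by auto

lemma Rep_Abs: "reduced w \<Longrightarrow> Rep_G (Abs_G w) = w" by (simp add: Abs_G_inverse)

lemma lexfloor_letter:
  assumes "periodic_mono F" "periodic_mono H"
  shows "lexfloor (F (fst P), H (snd P)) (F (fst Q), H (snd Q)) = lexfloor P Q"
proof (rule lexfloor_eqI)
  fix j
  have "deck j (F (fst P), H (snd P)) = (F (fst (deck j P)), H (snd (deck j P)))"
    using assms by (simp add: deck_def periodic_mono_shift)
  moreover have "H a \<le> H b \<longleftrightarrow> a \<le> b" for a b
    using assms(2) by (simp add: linorder_not_less[symmetric] periodic_mono_less)
  ultimately show "lexle (deck j (F (fst P), H (snd P))) (F (fst Q), H (snd Q)) \<longleftrightarrow> lexle (deck j P) Q"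
    using assms by (simp add: lexle_def periodic_mono_less periodic_mono_eq)
qed

text \<open>The second lifted action has a free orbit and only serves to break the ties that occur
  in the orbit of the first one.\<close>

definition lex_order :: "(gen \<Rightarrow> real \<Rightarrow> real) \<Rightarrow> (gen \<Rightarrow> real \<Rightarrow> real) \<Rightarrow> real \<Rightarrow> G \<times> G \<times> G \<Rightarrow> int" where
  "lex_order L' L x = circ_of (\<lambda>g h. lexfloor (foldr L' (Rep_G g) x, foldr L (Rep_G g) x)
      (foldr L' (Rep_G h) x, foldr L (Rep_G h) x))"

text \<open>The floor itself is not left invariant. Multiplication by a letter applies that letter
  to both coordinates up to one common deck translation, depending on the letter and the word only;
  this changes the floor by a coboundary, which disappears from the defect. Freeness of the second
  orbit gives the antisymmetry.\<close>

lemma lex_order_circ_order: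
  assumes l: "lifted A B k m" "lifted A' B' k m"
    and free: "\<And>u v. reduced u \<Longrightarrow> reduced v \<Longrightarrow>
      cis (foldr (lletter A B m) u x) = cis (foldr (lletter A B m) v x) \<Longrightarrow> u = v"
  shows "circ_order (lex_order (lletter A' B' m) (lletter A B m) x)"
proof -
  let ?L = "lletter A B m" and ?L' = "lletter A' B' m"
  define P where "P w = (foldr ?L' w x, foldr ?L w x)" for w
  define fl where "fl u v = lexfloor (P u) (P v)" for u v
  have c: "lex_order ?L' ?L x = circ_of (\<lambda>g h. fl (Rep_G g) (Rep_G h))"
    unfolding lex_order_def fl_def P_def ..
  have b: "0 \<le> fl u w - fl u v - fl v w \<and> fl u w - fl u v - fl v w \<le> 1" for u v w
    unfolding fl_def by (intro conjI lexfloor_bounds)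
  have a: "fl (Rep_G g) (Rep_G h) + fl (Rep_G h) (Rep_G g) = -1" if "g \<noteq> h" for g h
    unfolding fl_def
  proof (rule lexfloor_antisym)
    fix j show "deck j (P (Rep_G g)) \<noteq> P (Rep_G h)"
    proof
      assume "deck j (P (Rep_G g)) = P (Rep_G h)"
      then have "foldr ?L (Rep_G g) x + 2 * pi * of_int j = foldr ?L (Rep_G h) x" by (simp add: deck_def P_def)
      then have "cis (foldr ?L (Rep_G g) x) = cis (foldr ?L (Rep_G h) x)" using cis_shift by metis
      then have "Rep_G g = Rep_G h" using free by simp
      with that show False by (simp add: Rep_G_inject)
    qed
  qed
  have "\<exists>j. P (lmul s w) = deck j (?L' s (fst (P w)), ?L s (snd (P w)))" for s w
  proof -
    obtain j :: int where "\<forall>A B x. lifted A B k m \<longrightarrow> foldr (lletter A B m) (lmul s w) x =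
        lletter A B m s (foldr (lletter A B m) w x) + 2 * pi * of_int j"
      using lift_lmul by blast
    then have "foldr ?L (lmul s w) x = ?L s (foldr ?L w x) + 2 * pi * of_int j"
      "foldr ?L' (lmul s w) x = ?L' s (foldr ?L' w x) + 2 * pi * of_int j" using l by blast+
    then have "P (lmul s w) = deck j (?L' s (fst (P w)), ?L s (snd (P w)))"
      by (simp only: P_def deck_def fst_conv snd_conv)
    then show ?thesis by blast
  qed
  then obtain J where J: "\<And>s w. P (lmul s w) = deck (J s w) (?L' s (fst (P w)), ?L s (snd (P w)))" by metis
  have fll: "fl (lmul s u) (lmul s v) = fl u v - J s u + J s v" for s u v
    unfolding fl_def J lexfloor_deck
      lexfloor_letter[OF periodic_mono_lletter[OF l(2)] periodic_mono_lletter[OF l(1)]] by simp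
  define D where "D u v w = fl u w - fl u v - fl v w" for u v w
  have Dl: "D (lmul s u) (lmul s v) (lmul s w) = D u v w" for s u v w
    unfolding D_def fll by simp
  have Dw: "D (wmul t u) (wmul t v) (wmul t w) = D u v w" for t u v w
    by (induction t) (simp_all add: Dl)
  have inj: "gmul g u = gmul g v \<longleftrightarrow> u = v" for g u v
  proof
    assume "gmul g u = gmul g v"
    then have "wmul (Rep_G g) (Rep_G u) = wmul (Rep_G g) (Rep_G v)" by (metis Rep_gmul)
    then have "Rep_G u = Rep_G v" by (metis wmul_winv reduced_Rep)
    then show "u = v" by (simp add: Rep_G_inject)
  qed simp
  have inv: "circ_of (\<lambda>g h. fl (Rep_G g) (Rep_G h)) (gmul g u, gmul g v, gmul g w) =
      circ_of (\<lambda>g h. fl (Rep_G g) (Rep_G h)) (u, v, w)" for g u v w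
    using Dw[of "Rep_G g" "Rep_G u" "Rep_G v" "Rep_G w"]
    unfolding circ_of_def D_def by (simp add: inj Rep_gmul)
  show ?thesis unfolding c circ_order_def
    by (intro conjI allI circ_of_cocycle[where fl="\<lambda>g h. fl (Rep_G g) (Rep_G h)", OF b a] inv)
qed

text \<open>Ties occur only where the first orbit identifies points; elsewhere the second coordinate
  has no influence.\<close>

lemma lex_order_ccw:
  assumes r: "reduced u" "reduced v" "reduced w"
    and d: "cis (foldr L' u x) \<noteq> cis (foldr L' v x)" "cis (foldr L' v x) \<noteq> cis (foldr L' w x)"
      "cis (foldr L' u x) \<noteq> cis (foldr L' w x)"
  shows "lex_order L' L x (Abs_G u, Abs_G v, Abs_G w) =
    (if ccw (cis (foldr L' u x)) (cis (foldr L' v x)) (cis (foldr L' w x)) then 1 else -1)"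
proof -
  have "u \<noteq> v" "v \<noteq> w" "u \<noteq> w" using d by auto
  then have "Abs_G u \<noteq> Abs_G v" "Abs_G v \<noteq> Abs_G w" "Abs_G u \<noteq> Abs_G w" using r Rep_Abs by metis+
  then show ?thesis
    using lexfloor_ccw[of "(foldr L' u x, foldr L u x)" "(foldr L' v x, foldr L v x)" "(foldr L' w x, foldr L w x)"] d
    unfolding lex_order_def circ_of_def by (simp add: Rep_Abs r)
qed

section \<open>A local perturbation of the line\<close>

text \<open>\<open>E\<close> extends a self-map of one turn, measured from \<open>P\<close>, to a
  map of the line that commutes with full turns.\<close>

lemma periodic_extension:
  fixes e :: "real \<Rightarrow> real" and P :: real
  defines "E \<equiv> \<lambda>e x. P + 2 * pi * of_int \<lfloor>(x - P) / (2 * pi)\<rfloor> + e (x - P - 2 * pi * of_int \<lfloor>(x - P) / (2 * pi)\<rfloor>)"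
  shows "\<And>(n::int) t. 0 \<le> t \<Longrightarrow> t < 2 * pi \<Longrightarrow> E e (P + t + 2 * pi * of_int n) = P + e t + 2 * pi * of_int n"
    and "\<lbrakk>\<And>t. 0 \<le> t \<Longrightarrow> t < 2 * pi \<Longrightarrow> 0 \<le> e t \<and> e t < 2 * pi;
          \<And>s t. 0 \<le> s \<Longrightarrow> s < t \<Longrightarrow> t < 2 * pi \<Longrightarrow> e s < e t\<rbrakk> \<Longrightarrow> periodic_mono (E e)"
proof -
  have E: "E e (P + t + 2 * pi * of_int n) = P + e t + 2 * pi * of_int n" if "0 \<le> t" "t < 2 * pi" for n :: int and t
  proof -
    have "(P + t + 2 * pi * of_int n - P) / (2 * pi) = t / (2 * pi) + of_int n" by (simp add: field_simps)
    moreover have "\<lfloor>t / (2 * pi)\<rfloor> = 0" using that by (simp add: floor_eq_iff)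
    ultimately have "\<lfloor>(P + t + 2 * pi * of_int n - P) / (2 * pi)\<rfloor> = n" by simp
    then show ?thesis unfolding E_def by simp
  qed
  then show "\<And>(n::int) t. 0 \<le> t \<Longrightarrow> t < 2 * pi \<Longrightarrow> E e (P + t + 2 * pi * of_int n) = P + e t + 2 * pi * of_int n" .
  assume e: "\<And>t. 0 \<le> t \<Longrightarrow> t < 2 * pi \<Longrightarrow> 0 \<le> e t \<and> e t < 2 * pi"
     "\<And>s t. 0 \<le> s \<Longrightarrow> s < t \<Longrightarrow> t < 2 * pi \<Longrightarrow> e s < e t"
  have per: "E e (x + 2 * pi) = E e x + 2 * pi" for x
  proof -
    obtain n t where x: "x = P + t + 2 * pi * of_int n" "0 \<le> t" "t < 2 * pi" by (rule real_mod_2pi)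
    have "x + 2 * pi = P + t + 2 * pi * of_int (n + 1)" unfolding x by (simp add: algebra_simps)
    then show ?thesis using E[OF x(2,3), of n] E[OF x(2,3), of "n + 1"] x(1) by (simp add: algebra_simps)
  qed
  have "E e x < E e y" if "x < y" for x y
  proof -
    obtain n t where x: "x = P + t + 2 * pi * of_int n" "0 \<le> t" "t < 2 * pi" by (rule real_mod_2pi)
    obtain l s where y: "y = P + s + 2 * pi * of_int l" "0 \<le> s" "s < 2 * pi" by (rule real_mod_2pi)
    have Ex: "E e x = P + e t + 2 * pi * of_int n" "E e y = P + e s + 2 * pi * of_int l"
      using E x y by auto
    show ?thesis
    proof (cases "n < l")
      case True
      then have "of_int n + 1 \<le> (of_int l :: real)" by linarith
      then have "2 * pi * (of_int n + 1) \<le> 2 * pi * (of_int l :: real)" by (intro mult_left_mono) auto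
      then show ?thesis using e(1)[of t] e(1)[of s] x y unfolding Ex distrib_left by linarith
    next
      case False
      have "\<not> l < n"
      proof
        assume "l < n"
        then have "of_int l + 1 \<le> (of_int n :: real)" by linarith
        then have "2 * pi * (of_int l + 1) \<le> 2 * pi * (of_int n :: real)" by (intro mult_left_mono) auto
        then show False using that x y unfolding distrib_left by linarith
      qed
      with False have "n = l" by simp
      then show ?thesis using e(2)[of t s] x y that Ex by auto
    qed
  qed
  with per show "periodic_mono (E e)" by (auto simp: periodic_mono_def strict_mono_def)
qed

lemma cang_cis_add: "0 \<le> s \<Longrightarrow> s < 2 * pi \<Longrightarrow> cang (cis P) (cis (P + s)) = s"
  unfolding cang_def cis_divide by (simp add: Arg2pi_cis)

text \<open>A power map is rescaled to the arc from \<open>P\<close> to \<open>Q\<close> and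
  extended by the identity; its inverse is the power map with the reciprocal exponent.\<close>

lemma bump_exists:
  assumes "P < Q" "Q < P + 2 * pi" "P < U" "U < Q" "P < U'" "U' < Q"
  obtains h h' where "periodic_mono h" "periodic_mono h'" "\<And>x. h (h' x) = x" "\<And>x. h' (h x) = x"
    "h U = U'" "\<And>x. \<not> ccw (cis P) (cis x) (cis Q) \<Longrightarrow> h x = x \<and> h' x = x"
proof -
  define d where "d = Q - P"
  define e where "e \<gamma> t = (if t < d then d * (t / d) powr \<gamma> else t)" for \<gamma> t :: real
  define E where "E e x = P + 2 * pi * of_int \<lfloor>(x - P) / (2 * pi)\<rfloor> + e (x - P - 2 * pi * of_int \<lfloor>(x - P) / (2 * pi)\<rfloor>)" for e x
  note PE = periodic_extension[where P=P, folded E_def]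
  have d: "0 < d" "d < 2 * pi" using assms by (auto simp: d_def)
  have e_lt: "0 \<le> e \<gamma> t \<and> e \<gamma> t < d" if "0 \<le> t" "t < d" "0 < \<gamma>" for \<gamma> t
  proof -
    have "(t / d) powr \<gamma> < 1 powr \<gamma>" using that d by (intro powr_less_mono2) auto
    then show ?thesis using that d by (simp add: e_def)
  qed
  have e_mono: "e \<gamma> s < e \<gamma> t" if "0 \<le> s" "s < t" "0 < \<gamma>" for s t \<gamma>
  proof (cases "t < d")
    case True
    then have "(s / d) powr \<gamma> < (t / d) powr \<gamma>" using that d by (intro powr_less_mono2) (auto simp: field_simps)
    then show ?thesis using True that d by (simp add: e_def)
  next
    case False
    have t: "e \<gamma> t = t" using False by (simp add: e_def)
    show ?thesis
    proof (cases "s < d")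
      case True
      then show ?thesis using e_lt[of s \<gamma>] that t False by linarith
    qed (use t that in \<open>simp add: e_def\<close>)
  qed
  have e_bd: "0 \<le> e \<gamma> t \<and> e \<gamma> t < 2 * pi" if "0 \<le> t" "t < 2 * pi" "0 < \<gamma>" for t \<gamma>
  proof (cases "t < d")
    case True
    then show ?thesis using e_lt[of t \<gamma>] that d by linarith
  qed (use that in \<open>simp add: e_def\<close>)
  have e_inv: "e (1 / \<gamma>) (e \<gamma> t) = t" if "0 \<le> t" "0 < \<gamma>" for t \<gamma>
  proof (cases "t < d")
    case True
    have "e \<gamma> t < d" using e_lt True that by auto
    then show ?thesis using True that d by (simp add: e_def powr_powr)
  qed (auto simp: e_def)
  \<comment> \<open>The logarithm of the equation
    \<open>((U - P) / d) powr \<gamma> = (U' - P) / d\<close>, solved for the exponent. Both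
    logarithms are negative, so the quotient is positive.\<close>
  define \<gamma> where "\<gamma> = ln ((U' - P) / d) / ln ((U - P) / d)"
  have u: "0 < (U - P) / d" "(U - P) / d < 1" "0 < (U' - P) / d" "(U' - P) / d < 1"
    using assms by (auto simp: d_def field_simps)
  then have ln: "ln ((U - P) / d) < 0" "ln ((U' - P) / d) < 0" by (auto simp: ln_less_zero_iff)
  then have g: "0 < \<gamma>" by (simp add: \<gamma>_def divide_neg_neg)
  have "((U - P) / d) powr \<gamma> = (U' - P) / d"
  proof -
    have "\<gamma> * ln ((U - P) / d) = ln ((U' - P) / d)" using ln by (simp add: \<gamma>_def)
    moreover have "(U - P) / d \<noteq> 0" using u by linarith
    ultimately have "((U - P) / d) powr \<gamma> = exp (ln ((U' - P) / d))" by (simp only: powr_def if_False)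
    then show ?thesis using u by (simp only: exp_ln)
  qed
  then have eU: "e \<gamma> (U - P) = U' - P" using assms d by (simp add: e_def d_def)
  have E: "E (e \<gamma>') (P + t + 2 * pi * of_int n) = P + e \<gamma>' t + 2 * pi * of_int n"
    if "0 \<le> t" "t < 2 * pi" for \<gamma>' t and n :: int using PE(1) that by blast
  have EE: "E (e (1 / \<gamma>')) (E (e \<gamma>') x) = x" if "0 < \<gamma>'" for \<gamma>' x
  proof -
    obtain n t where x: "x = P + t + 2 * pi * of_int n" "0 \<le> t" "t < 2 * pi" by (rule real_mod_2pi)
    show ?thesis unfolding x(1) using E[of "e \<gamma>' t"] E[of t] x(2,3) e_bd[of t \<gamma>'] that e_inv[of t \<gamma>'] by simp
  qed
  have pm: "periodic_mono (E (e \<gamma>'))" if "0 < \<gamma>'" for \<gamma>'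
    using e_bd e_mono that by (intro PE(2)) auto
  show ?thesis
  proof (rule that[of "E (e \<gamma>)" "E (e (1 / \<gamma>))"])
    show "periodic_mono (E (e \<gamma>))" "periodic_mono (E (e (1 / \<gamma>)))" using pm g by auto
    show "E (e (1 / \<gamma>)) (E (e \<gamma>) x) = x" for x using EE g by blast
    show "E (e \<gamma>) (E (e (1 / \<gamma>)) x) = x" for x using EE[of "1 / \<gamma>"] g by simp
    show "E (e \<gamma>) U = U'" using E[of "U - P" \<gamma> 0] eU assms by simp
    show "E (e \<gamma>) x = x \<and> E (e (1 / \<gamma>)) x = x" if n: "\<not> ccw (cis P) (cis x) (cis Q)" for x
    proof -
      obtain n t where x: "x = P + t + 2 * pi * of_int n" "0 \<le> t" "t < 2 * pi" by (rule real_mod_2pi)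
      have "cang (cis P) (cis x) = t" "cang (cis P) (cis Q) = d"
        using x cang_cis_add[of t P] cang_cis_add[of d P] d by (auto simp: d_def)
      then have "t = 0 \<or> d \<le> t" using n x d by (auto simp: ccw_cang)
      then have "e \<gamma>' t = t" for \<gamma>' using d by (auto simp: e_def)
      then show ?thesis using E x by simp
    qed
  qed
qed


section \<open>Free orbits\<close>

text \<open>Reduced words stand for the group elements, so a trivial stabilizer of \<open>x0\<close>
  becomes injectivity of the orbit map on reduced words. The relations for \<open>GB\<close> make
  \<open>f GB\<close> and \<open>f GBi\<close> mutually inverse maps of order three.\<close>

locale free_orbit =
  fixes f :: "gen \<Rightarrow> complex \<Rightarrow> complex" and x0 :: complex
  assumes homeo: "homeo_plus (f s)"
    and rel_GA: "z \<in> S1 \<Longrightarrow> f GA (f GA z) = z"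
    and rel_GB: "z \<in> S1 \<Longrightarrow> f GB (f GB z) = f GBi z"
    and rel_GB_GBi: "z \<in> S1 \<Longrightarrow> f GB (f GBi z) = z"
    and x0_S1: "x0 \<in> S1"
    and free: "reduced u \<Longrightarrow> reduced v \<Longrightarrow> foldr f u x0 = foldr f v x0 \<Longrightarrow> u = v"
begin

abbreviation act :: "gen list \<Rightarrow> complex \<Rightarrow> complex" where "act \<equiv> foldr f"

definition pt :: "gen list \<Rightarrow> complex" where "pt w = act w x0"

lemma f_norm [simp]: "cmod z = 1 \<Longrightarrow> cmod (f s z) = 1"
  using homeo_plus_S1[OF homeo, of z s] by simp

lemma act_norm [simp]: "cmod z = 1 \<Longrightarrow> cmod (act w z) = 1"
  by (induction w) simp_all

lemma x0_norm [simp]: "cmod x0 = 1" using x0_S1 by simp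

lemma pt_norm [simp]: "cmod (pt w) = 1" by (simp add: pt_def)

lemma f_inj: "z \<in> S1 \<Longrightarrow> w \<in> S1 \<Longrightarrow> f s z = f s w \<longleftrightarrow> z = w"
  using homeo homeo_plus_inj by blast

lemma rel_GBi_GB: "z \<in> S1 \<Longrightarrow> f GBi (f GB z) = z"
  using rel_GB_GBi[of "f GB z"] f_inj[of "f GBi (f GB z)" z GB] by simp

lemma rel_GBi: "z \<in> S1 \<Longrightarrow> f GBi (f GBi z) = f GB z"
  using rel_GB[of "f GBi z"] rel_GB_GBi by simp

lemma f_ginv: "z \<in> S1 \<Longrightarrow> f (ginv s) (f s z) = z" "z \<in> S1 \<Longrightarrow> f s (f (ginv s) z) = z"
  by (cases s; simp add: rel_GA rel_GB_GBi rel_GBi_GB)+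

lemma act_lmul: "z \<in> S1 \<Longrightarrow> act (lmul s w) z = f s (act w z)"
  by (cases "(s, w)" rule: lmul.cases)
     (simp_all add: rel_GA rel_GB rel_GBi rel_GB_GBi rel_GBi_GB)

lemma act_wmul: "z \<in> S1 \<Longrightarrow> act (wmul u v) z = act u (act v z)"
  by (induction u) (simp_all add: act_lmul)

lemma act_winv: "z \<in> S1 \<Longrightarrow> act (winv w) (act w z) = z" "z \<in> S1 \<Longrightarrow> act w (act (winv w) z) = z"
proof -
  show "act (winv w) (act w z) = z" if "z \<in> S1" for z w
    using that by (induction w) (simp_all add: f_ginv)
  from this[where w="winv w"] show "z \<in> S1 \<Longrightarrow> act w (act (winv w) z) = z" by simp
qed

lemma act_inj: "z \<in> S1 \<Longrightarrow> w \<in> S1 \<Longrightarrow> act u z = act u w \<longleftrightarrow> z = w"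
  using act_winv by metis

lemma act_ccw: "p \<in> S1 \<Longrightarrow> q \<in> S1 \<Longrightarrow> r \<in> S1 \<Longrightarrow> ccw (act w p) (act w q) (act w r) \<longleftrightarrow> ccw p q r"
  by (induction w) (simp_all add: homeo_plus_ccw[OF homeo])

lemma pt_Cons: "pt (s # w) = f s (pt w)" by (simp add: pt_def)
lemma pt_append: "pt (u @ v) = act u (pt v)" by (simp add: pt_def)
lemma pt_lmul: "pt (lmul s w) = f s (pt w)" by (simp add: pt_def act_lmul)
lemma pt_wmul: "pt (wmul u w) = act u (pt w)" by (simp add: pt_def act_wmul)
lemma pt_inj: "reduced u \<Longrightarrow> reduced v \<Longrightarrow> pt u = pt v \<longleftrightarrow> u = v"
  using free by (auto simp: pt_def)

definition orbit_order :: "gen list \<Rightarrow> gen list \<Rightarrow> gen list \<Rightarrow> int" where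
  "orbit_order u v w = (if ccw (pt u) (pt v) (pt w) then 1 else if ccw (pt u) (pt w) (pt v) then -1 else 0)"

text \<open>For finite \<open>F\<close> this is isolation unwound: a basic neighbourhood in the
  product topology prescribes the values at finitely many triples.\<close>

definition determined_by :: "gen list set \<Rightarrow> bool" where
  "determined_by F \<longleftrightarrow> (\<forall>c. circ_order c \<longrightarrow>
     (\<forall>u\<in>F. \<forall>v\<in>F. \<forall>w\<in>F. c (Abs_G u, Abs_G v, Abs_G w) = orbit_order u v w) \<longrightarrow>
     (\<forall>u v w. reduced u \<longrightarrow> reduced v \<longrightarrow> reduced w \<longrightarrow> c (Abs_G u, Abs_G v, Abs_G w) = orbit_order u v w))"

lemma lifted_exists:
  obtains A B k m X where "lifted A B k m" "\<And>s x. cis (lletter A B m s x) = f s (cis x)"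
    "\<And>w. cis (foldr (lletter A B m) w X) = pt w"
proof -
  obtain A where A: "periodic_mono A" "\<And>x. cis (A x) = f GA (cis x)" using homeo_plus_lift[OF homeo] by metis
  obtain B where B: "periodic_mono B" "\<And>x. cis (B x) = f GB (cis x)" using homeo_plus_lift[OF homeo] by metis
  obtain k where k: "\<And>x. A (A x) = x + 2 * pi * of_int k"
    using lift_of_identity[OF periodic_mono_comp[OF A(1) A(1)]] A(2) rel_GA by auto
  have "cis (B (B (B x))) = cis x" for x
  proof -
    have "cis (B (B (B x))) = f GB (f GB (f GB (cis x)))" by (simp add: B(2))
    also have "\<dots> = cis x" using rel_GB[of "f GB (cis x)"] rel_GBi_GB[of "cis x"] by simp
    finally show ?thesis .
  qed
  then obtain m where m: "\<And>x. B (B (B x)) = x + 2 * pi * of_int m"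
    using lift_of_identity[OF periodic_mono_comp[OF B(1) periodic_mono_comp[OF B(1) B(1)]]] by auto
  have l: "lifted A B k m" using A B k m by (auto simp: lifted_def)
  have c: "cis (lletter A B m s x) = f s (cis x)" for s x
  proof (cases s)
    case GBi
    have "cis (B (B x) - 2 * pi * of_int m) = cis (B (B x))" using cis_shift[of _ "- m"] by simp
    then show ?thesis using GBi B(2) rel_GB[of "cis x"] by simp
  qed (use A B in auto)
  have "cis (foldr (lletter A B m) w (Arg2pi x0)) = pt w" for w
    by (induction w) (simp_all add: c pt_def cis_Arg2pi[OF x0_S1])
  with l c show ?thesis using that by blast
qed

lemma lmul_neq: "lmul s w \<noteq> w"
proof (cases w)
  case (Cons y v)
  then show ?thesis by (cases s; cases y) (auto dest: arg_cong[of _ _ length])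
qed (cases s; auto)

text \<open>Going back from the common point \<open>g\<close>, the starting point that is met first
  would lie inside the other arc, unless both are met at once.\<close>

lemma arcs_share:
  assumes "ccw p g q" "ccw p' g q'" "\<not> ccw p p' q" "\<not> ccw p' p q'" shows "p = p'"
  using assms Arg2pi_inj[of p p'] unfolding ccw_iff cyc3_def by (smt (verit))

text \<open>If the position of a new orbit point relative to \<open>E\<close> were not forced, then moving it past
  \<open>e\<close> by conjugating one of the two generators would give a second circular order that agrees with
  the given one on \<open>E\<close>.\<close>

lemma forced_position:
  assumes F: "determined_by F" "F \<subseteq> E" and E: "\<And>w. w \<in> E \<Longrightarrow> reduced w" and DE: "D \<subseteq> E"
    and suffix: "\<And>t w. t # w \<in> E \<Longrightarrow> w \<in> E"
    and leaf: "\<And>t w. t # w \<in> E \<Longrightarrow> in_B t = in_B s \<Longrightarrow> w \<in> D \<and> t # w \<in> D"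
    and inv: "\<And>t d. d \<in> D \<Longrightarrow> in_B t = in_B s \<Longrightarrow> lmul t d \<in> D"
    and pq: "p \<in> D" "q \<in> D" and g: "g \<in> E" "reduced (s # g)" "ccw (pt p) (pt g) (pt q)"
    and gap: "\<And>d. d \<in> D \<Longrightarrow> \<not> ccw (pt p) (pt d) (pt q)" and e: "e \<in> E"
  shows "\<not> ccw (f s (pt p)) (pt e) (f s (pt q))"
proof
  assume ce: "ccw (f s (pt p)) (pt e) (f s (pt q))"
  have gD: "g \<notin> D" using g gap by blast
  then have sgE: "s # g \<notin> E" using leaf by blast
  have gap': "\<not> ccw (f s (pt p)) (pt d) (f s (pt q))" if "d \<in> D" for d
  proof
    assume "ccw (f s (pt p)) (pt d) (f s (pt q))"
    then have "ccw (f s (pt p)) (f s (f (ginv s) (pt d))) (f s (pt q))" by (simp add: f_ginv)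
    then have "ccw (pt p) (f (ginv s) (pt d)) (pt q)" by (simp add: homeo_plus_ccw[OF homeo])
    then have "ccw (pt p) (pt (lmul (ginv s) d)) (pt q)" by (simp add: pt_lmul)
    then show False using gap inv[of d "ginv s"] that by auto
  qed
  \<comment> \<open>The conjugated letter sends the lift of \<open>g\<close> through
    \<open>h'\<close> first. Since \<open>g\<close> is outside the arc that \<open>h\<close> moves,
    \<open>h'\<close> does nothing there and only the image point is displaced.\<close>
  have gout: "\<not> ccw (f s (pt p)) (pt g) (f s (pt q))"
  proof
    assume c: "ccw (f s (pt p)) (pt g) (f s (pt q))"
    have "\<not> ccw (pt p) (f s (pt p)) (pt q)" using gap[of "lmul s p"] inv[of p s] pq by (simp add: pt_lmul)
    with c g(3) have "pt p = f s (pt p)" using gap'[OF pq(1)] by (intro arcs_share)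
    then have "lmul s p = p" using pt_inj[of "lmul s p" p] E DE pq(1) by (auto simp: pt_lmul intro: reduced_lmul)
    then show False using lmul_neq by blast
  qed
  obtain A B k m X where l: "lifted A B k m" and cL: "\<And>s x. cis (lletter A B m s x) = f s (cis x)"
    and cX: "\<And>w. cis (foldr (lletter A B m) w X) = pt w" using lifted_exists by metis
  define L where "L = lletter A B m"
  define x where "x w = foldr L w X" for w
  have cx: "cis (x w) = pt w" for w using cX by (simp add: x_def L_def)
  define P where "P = x (lmul s p)"
  have cP: "cis P = f s (pt p)" by (simp add: P_def cx pt_lmul)
  define Q where "Q = P + cang (cis P) (f s (pt q))"
  define U where "U = P + cang (cis P) (pt (s # g))"
  define V where "V = P + cang (cis P) (pt e)"
  have csg: "ccw (f s (pt p)) (pt (s # g)) (f s (pt q))" using g(3) by (simp add: pt_Cons homeo_plus_ccw[OF homeo])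
  have cQ: "cis Q = f s (pt q)" "cis U = pt (s # g)" "cis V = pt e"
    by (simp_all add: Q_def U_def V_def cis_mult[symmetric] cP cang_cis)
  have "pt e \<noteq> pt (s # g)" using pt_inj[of e "s # g"] e E g sgE by auto
  then have "U \<noteq> V" using cQ by metis
  have ord: "P < U" "U < Q" "P < V" "V < Q" "Q < P + 2 * pi"
    using csg ce cang_bounds(2)[of "cis P" "f s (pt q)"] by (auto simp: ccw_cang cP U_def V_def Q_def)
  \<comment> \<open>The midpoint on the far side of \<open>V\<close>, the lift of \<open>e\<close>:
    moving \<open>U\<close> there changes the order of the two points while staying inside the
    arc.\<close>
  define U' where "U' = (if U < V then (V + Q) / 2 else (P + V) / 2)"
  have U': "P < U'" "U' < Q" "U' < V \<longleftrightarrow> V < U" "U' \<noteq> V"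
    using ord \<open>U \<noteq> V\<close> by (auto simp: U'_def field_simps)
  obtain h h' where h: "periodic_mono h" "periodic_mono h'" "\<And>x. h (h' x) = x" "\<And>x. h' (h x) = x"
    "h U = U'" and hid: "\<And>x. \<not> ccw (cis P) (cis x) (cis Q) \<Longrightarrow> h x = x \<and> h' x = x"
    by (rule bump_exists[OF less_trans[OF ord(1,2)] ord(5) ord(1,2) U'(1,2)]) (rule that; assumption)
  \<comment> \<open>Only the generator of the factor containing \<open>s\<close> is conjugated; the
    two factors are unrelated, so both relations survive.\<close>
  define A' where "A' = (if in_B s then A else (\<lambda>x. h (A (h' x))))"
  define B' where "B' = (if in_B s then (\<lambda>x. h (B (h' x))) else B)"
  have l': "lifted A' B' k m"
    using l periodic_mono_comp[OF h(1) periodic_mono_comp[OF _ h(2)]]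
    unfolding lifted_def A'_def B'_def by (simp add: h(3,4) periodic_mono_shift[OF h(1)])
  define L' where "L' = lletter A' B' m"
  have L': "L' t = (if in_B t = in_B s then (\<lambda>x. h (L t (h' x))) else L t)" for t
    by (cases t) (simp_all add: L'_def L_def A'_def B'_def h(3,4) periodic_mono_minus[OF h(1)])
  define x' where "x' w = foldr L' w X" for w
  have fixd: "h (x w) = x w" "h' (x w) = x w" if "\<not> ccw (f s (pt p)) (pt w) (f s (pt q))" for w
    using hid[of "x w"] that by (simp_all add: cP cQ cx)
  \<comment> \<open>A letter of the conjugated factor is applied only inside \<open>D\<close>, and
    no point of \<open>D\<close> lies in the arc that \<open>h\<close> moves. So the words of
    \<open>E\<close> do not notice the change.\<close>
  have eq: "w \<in> E \<Longrightarrow> x' w = x w" for w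
  proof (induction w)
    case (Cons t w)
    then have IH: "x' w = x w" using suffix by blast
    show ?case
    proof (cases "in_B t = in_B s")
      case True
      then have "w \<in> D" "t # w \<in> D" using leaf Cons by auto
      then have "h' (x w) = x w" "h (x (t # w)) = x (t # w)" using fixd gap' by auto
      then show ?thesis using IH True by (simp add: x'_def x_def L')
    qed (use IH in \<open>simp add: x'_def x_def L'\<close>)
  qed (simp add: x'_def x_def)
  define c where "c = lex_order L' L X"
  have cc: "circ_order c"
    unfolding c_def L_def L'_def by (rule lex_order_circ_order[OF l l']) (simp add: cX pt_inj)
  have val: "c (Abs_G u, Abs_G v, Abs_G w) = (if ccw (cis (x' u)) (cis (x' v)) (cis (x' w)) then 1 else -1)"
    if "reduced u" "reduced v" "reduced w" "cis (x' u) \<noteq> cis (x' v)" "cis (x' v) \<noteq> cis (x' w)" "cis (x' u) \<noteq> cis (x' w)"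
    for u v w using lex_order_ccw[of u v w L' X L] that unfolding c_def x'_def by blast
  have agree: "c (Abs_G u, Abs_G v, Abs_G w) = orbit_order u v w" if uvw: "u \<in> E" "v \<in> E" "w \<in> E" for u v w
  proof (cases "u = v \<or> v = w \<or> u = w")
    case True
    then have "c (Abs_G u, Abs_G v, Abs_G w) = 0" using cc unfolding circ_order_def by auto
    moreover have "orbit_order u v w = 0" using True ccw_distinct by (auto simp: orbit_order_def)
    ultimately show ?thesis by simp
  next
    case False
    then have d: "pt u \<noteq> pt v" "pt v \<noteq> pt w" "pt u \<noteq> pt w" using pt_inj E uvw by auto
    have "c (Abs_G u, Abs_G v, Abs_G w) = (if ccw (pt u) (pt v) (pt w) then 1 else -1)"
      using val[of u v w] d uvw E by (simp add: eq cx)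
    then show ?thesis using ccw_total[of "pt u" "pt v" "pt w"] d by (auto simp: orbit_order_def)
  qed
  have rp: "reduced (lmul s p)" using pq DE E by (blast intro: reduced_lmul)
  \<comment> \<open>On this triple the forced value and the value computed from the perturbed orbit
    disagree, because \<open>s # g\<close> has passed \<open>e\<close>.\<close>
  have "c (Abs_G (lmul s p), Abs_G (s # g), Abs_G e) = orbit_order (lmul s p) (s # g) e"
    using F agree cc rp g(2) e E unfolding determined_by_def by (meson subset_iff)
  moreover have "cis (x' (lmul s p)) = cis P" using eq[of "lmul s p"] inv[of p s] pq DE by (auto simp: P_def)
  moreover have "cis (x' e) = pt e" using eq e cx by simp
  moreover have "cis (x' (s # g)) = cis U'"
  proof -
    have "h' (x g) = x g" using fixd gout by blast
    then have "x' (s # g) = h (x (s # g))" using eq[OF g(1)] by (simp add: x'_def x_def L')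
    moreover obtain n :: int where "x (s # g) = U + 2 * pi * of_int n"
      using cis_eq_cis_iff[of "x (s # g)" U] cx[of "s # g"] cQ(2) by auto
    ultimately have "x' (s # g) = U' + 2 * pi * of_int n" by (simp add: periodic_mono_shift[OF h(1)] h(5))
    then show ?thesis by simp
  qed
  moreover have "cang (cis P) (cis U') = U' - P" "cang (cis P) (pt e) = V - P" "cang (cis P) (pt (s # g)) = U - P"
    using cang_cis_add[of "U' - P" P] U' ord by (auto simp: V_def U_def)
  moreover from this have "cis U' \<noteq> pt e" using U' by auto
  moreover have "cis P \<noteq> pt e" "cis P \<noteq> pt (s # g)" using ce csg ccw_distinct cP by auto
  moreover have "cis P \<noteq> cis U'"
    using \<open>cang (cis P) (cis U') = U' - P\<close> cang_eq[of "cis P" "cis P"] U' by (metis cis_in_S1 diff_gt_0_iff_gt diff_self less_irrefl order_refl)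
  ultimately show False
    using val[of "lmul s p" "s # g" e] rp g(2) e E U' \<open>U \<noteq> V\<close> ord
    by (auto simp: orbit_order_def ccw_cang cP pt_lmul split: if_splits)
qed

end


section \<open>Eventual stability of first letters\<close>

text \<open>Letters of the two factors are read at odd and even times respectively, counted from the right
  end of the word. So the words read at a given time all start in the same factor.\<close>

definition time :: "gen list \<Rightarrow> nat" where
  "time w = length w + (if w \<noteq> [] \<and> in_B (last w) then 1 else 0)"

definition wball :: "nat \<Rightarrow> gen list set" where
  "wball m = {w. reduced w \<and> time w \<le> m}"

lemma time_Nil [simp]: "time [] = 0" by (simp add: time_def)

lemma time_Cons: "time (s # w) = (if w = [] then (if in_B s then 2 else 1) else Suc (time w))"
  by (simp add: time_def)

lemma time_parity: "reduced w \<Longrightarrow> w \<noteq> [] \<Longrightarrow> in_B (hd w) \<longleftrightarrow> even (time w)"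
proof (induction w)
  case (Cons s w)
  then show ?case by (cases "w = []") (auto simp: time_Cons reduced_Cons)
qed simp

lemma length_le_time: "length w \<le> time w" by (simp add: time_def)

lemma time_drop: "k < length w \<Longrightarrow> time (drop k w) = time w - k"
  by (auto simp: time_def)

lemma finite_wball [simp]: "finite (wball m)"
proof (rule finite_subset)
  show "wball m \<subseteq> {w. set w \<subseteq> {GA, GB, GBi} \<and> length w \<le> m}"
  proof
    fix w assume "w \<in> wball m"
    moreover have "x \<in> {GA, GB, GBi}" for x by (cases x) auto
    ultimately show "w \<in> {w. set w \<subseteq> {GA, GB, GBi} \<and> length w \<le> m}"
      using length_le_time[of w] by (auto simp: wball_def)
  qed
qed (rule finite_lists_length_le, simp)

lemma wball_mono: "m \<le> n \<Longrightarrow> wball m \<subseteq> wball n" by (auto simp: wball_def)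

lemma finite_subset_wball:
  assumes "finite F" "\<And>w. w \<in> F \<Longrightarrow> reduced w" obtains m where "F \<subseteq> wball m"
proof (cases "F = {}")
  case False
  then have "F \<subseteq> wball (Max (time ` F))" using assms by (auto simp: wball_def)
  then show ?thesis using that by blast
qed (use that in auto)

text \<open>Words of time exactly \<open>m\<close> begin in the same factor as \<open>t\<close>, so
  there \<open>t\<close> merges or cancels instead of lengthening; shorter words may grow. This
  invariance under the factor read at time \<open>m\<close> is what the perturbation argument
  requires. A lone letter of order three has time 2, and even \<open>m\<close> with
  \<open>1 \<le> m\<close> leaves room for it.\<close>

lemma wball_lmul:
  assumes d: "d \<in> wball m" and m: "1 \<le> m" and t: "in_B t \<longleftrightarrow> even m"
  shows "lmul t d \<in> wball m"
proof -
  have r: "reduced d" "reduced (lmul t d)" "time d \<le> m" using d by (auto simp: wball_def reduced_lmul)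
  have "time (lmul t d) \<le> m"
  proof (cases d)
    case Nil
    have "lmul t [] = [t]" by (cases t) auto
    then show ?thesis using Nil t m by (cases "in_B t") (auto simp: time_Cons elim!: evenE)
  next
    case (Cons y v)
    show ?thesis
    proof (cases "in_B y = in_B t")
      case True
      have "lmul t (y # v) = v \<or> (\<exists>z. in_B z = in_B y \<and> lmul t (y # v) = z # v)"
        using True by (cases t; cases y; cases v) auto
      then show ?thesis using r(3) Cons by (auto simp: time_Cons split: if_splits)
    next
      case False
      have "in_B y \<longleftrightarrow> even (time d)" using time_parity[of d] r Cons by simp
      then have "time d \<noteq> m" using False t by auto
      moreover have "lmul t d = t # d" using False r(1) Cons by (intro lmul_reduced) (auto simp: reduced_Cons)
      ultimately show ?thesis using r(3) Cons by (simp add: time_Cons)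
    qed
  qed
  then show ?thesis using r by (simp add: wball_def)
qed

text \<open>Cancellation and merging use up at most as many letters of \<open>w\<close> as
  \<open>p\<close> has.\<close>

lemma hd_wmul:
  assumes "reduced w" "reduced p" "length p < length w"
  shows "wmul w p \<noteq> []" "hd (wmul w p) = hd w"
proof -
  obtain g1 u v where D: "w = g1 @ winv u \<and> p = u @ v \<and> wmul w p = g1 @ v \<or>
      (\<exists>y. in_B y \<and> w = g1 @ y # winv u \<and> p = u @ y # v \<and> wmul w p = g1 @ ginv y # v)"
    using wmul_decompose[OF assms(1,2)] by blast
  then have "g1 \<noteq> []" using assms(3) by auto
  with D show "wmul w p \<noteq> []" "hd (wmul w p) = hd w" by auto
qed

text \<open>The identity gets a type of its own, so that it differs in type from every other
  element; this yields the very first change of type.\<close>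

definition ty :: "gen list \<Rightarrow> gen option" where
  "ty w = (if w = [] then None else Some (hd w))"

lemma ty_Nil [simp]: "ty w = None \<longleftrightarrow> w = []" by (simp add: ty_def)
lemma ty_Cons [simp]: "ty (x # w) = Some x" by (simp add: ty_def)

lemma ccw_cang_left: "ccw p d z \<Longrightarrow> cang d z < cang p z"
  using cang_eq[of d z] cang_eq[of p z] Arg2pi_lt_2pi[of d] Arg2pi_ge_0[of p] Arg2pi_lt_2pi[of p] Arg2pi_ge_0[of d]
    Arg2pi_lt_2pi[of z] Arg2pi_ge_0[of z]
  by (auto simp: ccw_iff cyc3_def)

text \<open>\<open>p\<close> and \<open>q\<close> are the nearest points of \<open>D\<close> behind
  and ahead of \<open>z\<close>. If they were equal, any other point of \<open>D\<close> would be
  nearer on one side.\<close>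

lemma cyclic_neighbours:
  assumes D: "finite D" "D \<subseteq> S1" "z \<in> S1" "z \<notin> D" and ab: "a \<in> D" "b \<in> D" "a \<noteq> b"
  obtains p q where "p \<in> D" "q \<in> D" "ccw p z q" "\<And>d. d \<in> D \<Longrightarrow> \<not> ccw p d q"
proof -
  have "finite ((\<lambda>p. cang p z) ` D)" "D \<noteq> {}" using D ab by auto
  then obtain p where p: "p \<in> D" "\<And>d. d \<in> D \<Longrightarrow> cang p z \<le> cang d z"
    using arg_min_if_finite[of D "\<lambda>p. cang p z"] D(1) by (metis linorder_not_less)
  obtain q where q: "q \<in> D" "\<And>d. d \<in> D \<Longrightarrow> cang z q \<le> cang z d"
    using arg_min_if_finite[of D "cang z"] D(1) \<open>D \<noteq> {}\<close> by (metis linorder_not_less)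
  have S: "p \<in> S1" "q \<in> S1" "p \<noteq> z" "q \<noteq> z" using p q D by auto
  have 1: "\<not> ccw p d z" "\<not> ccw z d q" if "d \<in> D" for d
    using p(2)[OF that] q(2)[OF that] ccw_cang_left[of p d z] by (auto simp: ccw_cang)
  have "p \<noteq> q"
  proof
    assume "p = q"
    obtain d where d: "d \<in> D" "d \<noteq> p" using ab by metis
    have "ccw p d z \<or> ccw p z d" using d D S by (intro ccw_total) auto
    then show False using 1[OF d(1)] \<open>p = q\<close> ccw_rotate by blast
  qed
  then have "ccw p z q" using ccw_total[of p z q] S D 1(1)[OF q(1)] by blast
  moreover have "\<not> ccw p d q" if "d \<in> D" for d
  proof
    assume "ccw p d q"
    with \<open>ccw p z q\<close> have "ccw p d z \<or> ccw z d q"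
      using D that Arg2pi_inj[of d z] by (fastforce simp: ccw_iff cyc3_def)
    then show False using 1[OF that] by blast
  qed
  ultimately show ?thesis using that p q by blast
qed

section \<open>Neighbours of an orbit point inside a ball of words\<close>

context free_orbit begin

definition nbrs :: "nat \<Rightarrow> gen list \<Rightarrow> gen list \<Rightarrow> gen list \<Rightarrow> bool" where
  "nbrs m g p q \<longleftrightarrow> p \<in> wball m \<and> q \<in> wball m \<and> ccw (pt p) (pt g) (pt q) \<and>
     (\<forall>d\<in>wball m. \<not> ccw (pt p) (pt d) (pt q))"

lemma nbrs_exist:
  assumes "1 \<le> m" "reduced g" "g \<notin> wball m" obtains p q where "nbrs m g p q"
proof -
  have *: "[] \<in> wball m" "[GA] \<in> wball m" using assms(1) by (auto simp: wball_def time_Cons)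
  have "pt [] \<noteq> pt [GA]" using pt_inj by auto
  moreover have "pt g \<notin> pt ` wball m" using assms pt_inj by (auto simp: wball_def)
  moreover have "pt ` wball m \<subseteq> S1" by auto
  moreover have "finite (pt ` wball m)" "pt g \<in> S1" "pt [] \<in> pt ` wball m" "pt [GA] \<in> pt ` wball m"
    using * by auto
  ultimately obtain a b where "a \<in> pt ` wball m" "b \<in> pt ` wball m" "ccw a (pt g) b"
      "\<And>d. d \<in> pt ` wball m \<Longrightarrow> \<not> ccw a d b"
    using cyclic_neighbours[of "pt ` wball m" "pt g" "pt []" "pt [GA]"] by blast
  then show ?thesis using that unfolding nbrs_def by blast
qed

lemma nbrs_unique:
  assumes "nbrs m g p q" "p' \<in> wball m" "q' \<in> wball m" "ccw (pt p') (pt g) (pt q')"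
    "\<And>d. d \<in> wball m \<Longrightarrow> \<not> ccw (pt p') (pt d) (pt q')"
  shows "p' = p" "q' = q"
proof -
  have "pt p' = pt p" using assms by (intro arcs_share[of _ "pt g" "pt q'" _ "pt q"]) (auto simp: nbrs_def)
  then show "p' = p" using assms pt_inj by (auto simp: nbrs_def wball_def)
  have "pt q' = pt q"
  proof (rule ccontr)
    assume n: "pt q' \<noteq> pt q"
    have c: "ccw (pt p) (pt g) (pt q)" "ccw (pt p) (pt g) (pt q')" using assms \<open>p' = p\<close> by (auto simp: nbrs_def)
    then have "ccw (pt p) (pt q) (pt q') \<or> ccw (pt p) (pt q') (pt q)"
      using n ccw_distinct by (intro ccw_total) auto
    then show False using assms \<open>p' = p\<close> by (auto simp: nbrs_def)
  qed
  then show "q' = q" using assms pt_inj by (auto simp: nbrs_def wball_def)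
qed

text \<open>This is \<open>forced_position\<close> with \<open>D = wball m\<close> and
  \<open>E = wball (Suc m)\<close>. The letter \<open>s\<close> belongs to the factor read at times
  \<open>m\<close> and \<open>m + 2\<close>: it preserves the smaller ball, and the words added in
  the larger one begin in the other factor. So no point of the larger ball can lie between the
  translated neighbours.\<close>

lemma nbrs_step:
  assumes F: "determined_by F" "F \<subseteq> wball (Suc m)" and m: "1 \<le> m" and n: "nbrs m g p q"
    and g: "time g = Suc m" "reduced (s # g)" "g \<noteq> []"
  shows "nbrs (Suc m) (s # g) (lmul s p) (lmul s q)"
proof -
  have rg: "reduced g" using g by (simp add: reduced_Cons)
  have s: "in_B s \<longleftrightarrow> even m" using g time_parity[OF rg] by (auto simp: reduced_Cons)
  have pq: "p \<in> wball m" "q \<in> wball m" "ccw (pt p) (pt g) (pt q)" using n by (auto simp: nbrs_def)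
  have "\<not> ccw (f s (pt p)) (pt e) (f s (pt q))" if "e \<in> wball (Suc m)" for e
  proof (rule forced_position[OF F, where D="wball m" and g=g])
    show "w \<in> wball (Suc m)" if "t # w \<in> wball (Suc m)" for t w
      using that by (auto simp: wball_def reduced_Cons time_Cons split: if_splits)
    show "w \<in> wball m \<and> t # w \<in> wball m" if tw: "t # w \<in> wball (Suc m)" and t: "in_B t = in_B s" for t w
    proof -
      have "time (t # w) \<noteq> Suc m" using time_parity[of "t # w"] tw t s by (auto simp: wball_def)
      then have "t # w \<in> wball m" using tw by (auto simp: wball_def)
      then show ?thesis by (auto simp: wball_def reduced_Cons time_Cons split: if_splits)
    qed
    show "g \<in> wball (Suc m)" using g rg by (simp add: wball_def)
  qed (use pq n g that s m wball_lmul in \<open>auto simp: nbrs_def wball_def[of "Suc m"] intro: wball_mono[THEN subsetD, of m]\<close>,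
       auto simp: wball_def)
  moreover have "lmul s p \<in> wball (Suc m)" "lmul s q \<in> wball (Suc m)"
    using pq wball_lmul m s wball_mono[of m "Suc m"] by auto
  ultimately show ?thesis using pq(3) by (auto simp: nbrs_def pt_lmul pt_Cons homeo_plus_ccw[OF homeo])
qed

lemma nbrs_iterate:
  assumes F: "determined_by F" "F \<subseteq> wball (Suc m)" and m: "1 \<le> m" and n: "nbrs m g p q"
    and g: "time g = Suc m" "g \<noteq> []"
  shows "reduced (w @ g) \<Longrightarrow> nbrs (m + length w) (w @ g) (wmul w p) (wmul w q)"
proof (induction w)
  case Nil then show ?case using n by simp
next
  case (Cons s w)
  then have IH: "nbrs (m + length w) (w @ g) (wmul w p) (wmul w q)" by (simp add: reduced_Cons)
  have "time (w @ g) = Suc (m + length w)" using g by (simp add: time_def)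
  moreover have "F \<subseteq> wball (Suc (m + length w))" using F(2) wball_mono[of "Suc m" "Suc (m + length w)"] by auto
  ultimately show ?case
    using nbrs_step[OF F(1) _ _ IH, of s] Cons.prems m g by simp
qed

text \<open>Neighbours of a long word arise from neighbours of a short one by a common prefix, and a
  prefix longer than those neighbours imposes its first letter on all three.\<close>

lemma stable_type:
  assumes F: "determined_by F" "finite F" "\<And>w. w \<in> F \<Longrightarrow> reduced w"
  obtains N where "\<And>n g. N \<le> n \<Longrightarrow> reduced g \<Longrightarrow> time g = Suc n \<Longrightarrow>
     \<exists>p q. nbrs n g p q \<and> ty p = ty g \<and> ty q = ty g"
proof -
  obtain m' where m': "F \<subseteq> wball m'" using finite_subset_wball F by metis
  define m where "m = Suc m'"
  have m: "F \<subseteq> wball (Suc m)" "1 \<le> m" using m' wball_mono[of m' "Suc m"] by (auto simp: m_def)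
  have "\<exists>p q. nbrs n g p q \<and> ty p = ty g \<and> ty q = ty g"
    if n: "2 * m + 2 \<le> n" and g: "reduced g" "time g = Suc n" for n g
  proof -
    \<comment> \<open>The cut leaves an end \<open>g0\<close> of time \<open>Suc m\<close>, just
      outside the ball. The bound on \<open>n\<close> makes the remaining prefix longer than every
      word of the ball.\<close>
    define k where "k = n - m"
    define w where "w = take k g"
    define g0 where "g0 = drop k g"
    have len: "k < length g" using n g m(2) by (simp add: k_def time_def split: if_splits)
    have gw: "g = w @ g0" by (simp add: w_def g0_def)
    have "time g0 = Suc m" using time_drop[OF len] g n by (simp add: g0_def k_def)
    have "g0 \<noteq> []" "length w = k" "m + k = n" using len n by (auto simp: g0_def w_def k_def)
    have r: "reduced w" "reduced g0" using g gw by (auto simp: reduced_append)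
    have "g0 \<notin> wball m" using \<open>time g0 = Suc m\<close> by (simp add: wball_def)
    then obtain p q where pq: "nbrs m g0 p q" using nbrs_exist m r by metis
    have "nbrs n g (wmul w p) (wmul w q)"
      using nbrs_iterate[OF F(1) m pq \<open>time g0 = Suc m\<close> \<open>g0 \<noteq> []\<close>, of w] g gw \<open>length w = k\<close> \<open>m + k = n\<close> by simp
    moreover have "ty (wmul w x) = ty g" if "x \<in> wball m" for x
    proof -
      have "length x \<le> m" using that length_le_time[of x] by (simp add: wball_def)
      then have "length x < length w" using n \<open>length w = k\<close> by (simp add: k_def)
      then have "wmul w x \<noteq> []" "hd (wmul w x) = hd w" "w \<noteq> []" using hd_wmul[OF r(1)] that by (auto simp: wball_def)
      then show ?thesis by (simp add: ty_def gw)
    qed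
    ultimately show ?thesis using pq unfolding nbrs_def by blast
  qed
  then show ?thesis using that by blast
qed

text \<open>In a large ball take the last point \<open>w\<close> before \<open>q\<close> that has
  the type of \<open>p\<close>, and the ball point \<open>w'\<close> after it. A word entering
  between them later would have exactly these two as neighbours in the preceding ball, and then both
  would have its type.\<close>

lemma type_change:
  assumes F: "determined_by F" "finite F" "\<And>w. w \<in> F \<Longrightarrow> reduced w"
    and pq: "reduced p" "reduced q" "ty p \<noteq> ty q"
  obtains w w' where "reduced w" "reduced w'" "w = p \<or> ccw (pt p) (pt w) (pt q)"
    "w' = q \<or> ccw (pt p) (pt w') (pt q)" "ty w = ty p" "ty w' \<noteq> ty p"
    "\<And>u. reduced u \<Longrightarrow> \<not> ccw (pt w) (pt u) (pt w')"
proof -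
  obtain N where N: "\<And>n g. N \<le> n \<Longrightarrow> reduced g \<Longrightarrow> time g = Suc n \<Longrightarrow>
     \<exists>p q. nbrs n g p q \<and> ty p = ty g \<and> ty q = ty g" using stable_type[OF F] by metis
  define m where "m = N + time p + time q"
  have m: "N \<le> m" "p \<in> wball m" "q \<in> wball m" using pq by (auto simp: m_def wball_def)
  define A where "A = {w \<in> wball m. ty w = ty p \<and> (w = p \<or> ccw (pt p) (pt w) (pt q))}"
  have "finite A" "p \<in> A" using m by (auto simp: A_def)
  then obtain w where w: "w \<in> A" "\<And>d. d \<in> A \<Longrightarrow> cang (pt p) (pt d) \<le> cang (pt p) (pt w)"
    using arg_min_if_finite[of A "\<lambda>d. - cang (pt p) (pt d)"] by (metis empty_iff linorder_not_less neg_le_iff_le)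
  define B where "B = {d \<in> wball m. d = q \<or> ccw (pt w) (pt d) (pt q)}"
  have "finite B" "q \<in> B" using m by (auto simp: B_def)
  then obtain w' where w': "w' \<in> B" "\<And>d. d \<in> B \<Longrightarrow> cang (pt w) (pt w') \<le> cang (pt w) (pt d)"
    using arg_min_if_finite[of B "\<lambda>d. cang (pt w) (pt d)"] by (metis empty_iff linorder_not_less)
  have wq: "w \<noteq> q" using w pq by (auto simp: A_def)
  have up: "ccw (pt p) (pt d) (pt q)" "w = p \<or> ccw (pt p) (pt w) (pt d)" if "ccw (pt w) (pt d) (pt q)" for d
  proof -
    have "w = p \<or> ccw (pt p) (pt w) (pt q)" using w(1) by (simp add: A_def)
    then show "ccw (pt p) (pt d) (pt q)" "w = p \<or> ccw (pt p) (pt w) (pt d)"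
      using that by (auto simp: ccw_iff cyc3_def)
  qed
  have w't: "ty w' \<noteq> ty p"
  proof
    assume t: "ty w' = ty p"
    then have c: "ccw (pt w) (pt w') (pt q)" using w'(1) pq by (auto simp: B_def)
    have "w' \<in> A" using up(1)[OF c] t w'(1) by (auto simp: A_def B_def)
    then have "cang (pt p) (pt w') \<le> cang (pt p) (pt w)" by (rule w)
    then show False using up[OF c] cang_eq[of "pt p" "pt p"] by (auto simp: ccw_cang)
  qed
  have cons: "\<not> ccw (pt w) (pt d) (pt w')" if "d \<in> wball m" for d
  proof
    assume c: "ccw (pt w) (pt d) (pt w')"
    then have "d \<in> B" using w'(1) that ccw_trans by (auto simp: B_def)
    then show False using w'(2)[of d] c by (auto simp: ccw_cang)
  qed
  have *: "\<not> ccw (pt w) (pt u) (pt w')" if "reduced u" for u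
    using that
  proof (induction "time u" arbitrary: u rule: less_induct)
    case less
    show ?case
    proof
      assume c: "ccw (pt w) (pt u) (pt w')"
      then have "u \<notin> wball m" using cons by blast
      then obtain n where n: "time u = Suc n" "m \<le> n" using less.prems by (cases "time u") (auto simp: wball_def)
      then obtain p' q' where nb: "nbrs n u p' q'" "ty p' = ty u" "ty q' = ty u"
        using N[of n u] less.prems m by auto
      have "w \<in> wball n" "w' \<in> wball n" using w w' n wball_mono[of m n] by (auto simp: A_def B_def)
      moreover have "\<not> ccw (pt w) (pt d) (pt w')" if "d \<in> wball n" for d
        using less.hyps[of d] that n by (auto simp: wball_def)
      ultimately have "w = p'" "w' = q'" using nbrs_unique[OF nb(1)] c by blast+
      then show False using nb w't w(1) by (auto simp: A_def)
    qed
  qed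
  show ?thesis
  proof (rule that)
    show "reduced w" "reduced w'" using w w' by (auto simp: A_def B_def wball_def)
    show "w = p \<or> ccw (pt p) (pt w) (pt q)" "ty w = ty p" using w by (auto simp: A_def)
    show "ty w' \<noteq> ty p" by fact
    then show "w' = q \<or> ccw (pt p) (pt w') (pt q)" using w'(1) up[of w'] by (auto simp: B_def)
  qed (rule *)
qed

end


section \<open>Change of base point\<close>

lemma wmul_Nil [simp]: "reduced w \<Longrightarrow> wmul w [] = w"
  using wmul_reduced[of w "[]"] by simp

lemma lmul_letter_ginv: "lmul t [ginv t] = []" "lmul (ginv t) [t] = []"
  by (cases t; simp)+

lemma wmul_right_cancel: "reduced w \<Longrightarrow> wmul (wmul w [t]) [ginv t] = w" "reduced w \<Longrightarrow> wmul (wmul w [ginv t]) [t] = w"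
  using wmul_assoc[of "[ginv t]" w "[t]"] wmul_assoc[of "[t]" w "[ginv t]"] by (simp_all add: lmul_letter_ginv)

lemma length_wmul_le: "length (wmul u v) \<le> length u + length v"
proof (induction u)
  case (Cons x u)
  have "length (lmul x w) \<le> Suc (length w)" for w by (cases "(x, w)" rule: lmul.cases) auto
  from this[of "wmul u v"] show ?case using Cons by simp
qed simp

text \<open>Right multiplication commutes with left multiplication, so it preserves left
  invariance.\<close>

lemma circ_order_right_translate:
  assumes "circ_order c" shows "circ_order (\<lambda>(x, y, z). c (gmul x (Abs_G [t]), gmul y (Abs_G [t]), gmul z (Abs_G [t])))"
proof -
  have inj: "gmul x (Abs_G [t]) = gmul y (Abs_G [t]) \<longleftrightarrow> x = y" for x y
  proof
    assume "gmul x (Abs_G [t]) = gmul y (Abs_G [t])"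
    then have "Rep_G (gmul x (Abs_G [t])) = Rep_G (gmul y (Abs_G [t]))" by (rule arg_cong)
    then have "wmul (Rep_G x) [t] = wmul (Rep_G y) [t]" by (simp only: Rep_gmul Rep_Abs reduced.simps)
    then have "wmul (wmul (Rep_G x) [t]) [ginv t] = wmul (wmul (Rep_G y) [t]) [ginv t]" by (rule arg_cong)
    then show "x = y" by (simp only: wmul_right_cancel reduced_Rep Rep_G_inject)
  qed (rule arg_cong)
  have assoc: "gmul (gmul x y) z = gmul x (gmul y z)" for x y z
    by (rule Rep_G_inject[THEN iffD1]) (simp only: Rep_gmul wmul_assoc reduced_Rep)
  from assms have c: "\<And>x y z. c (x, y, z) \<in> {-1, 0, 1}"
    "\<And>x y z. c (x, y, z) = 0 \<longleftrightarrow> x = y \<or> y = z \<or> x = z"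
    "\<And>x y z w. c (y, z, w) - c (x, z, w) + c (x, y, w) - c (x, y, z) = 0"
    "\<And>x y z w. c (gmul w x, gmul w y, gmul w z) = c (x, y, z)"
    unfolding circ_order_def by blast+
  show ?thesis unfolding circ_order_def prod.case assoc
    by (intro conjI allI c(1,3,4)) (simp only: c(2) inj)
qed

context free_orbit begin

lemma rebase: "free_orbit f (f t x0)"
proof
  fix u v assume r: "reduced u" "reduced v" and eq: "foldr f u (f t x0) = foldr f v (f t x0)"
  have "pt (wmul w [t]) = foldr f w (f t x0)" for w by (simp add: pt_wmul) (simp add: pt_def)
  then have "wmul u [t] = wmul v [t]" using eq r pt_inj by (metis reduced_wmul reduced.simps(3))
  then show "u = v" using wmul_right_cancel(1)[OF r(1)] wmul_right_cancel(1)[OF r(2)] by metis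
qed (use homeo rel_GA rel_GB rel_GB_GBi in auto)

text \<open>The orbit of \<open>f t x0\<close> is the orbit of \<open>x0\<close> with words
  multiplied by \<open>t\<close> on the right. So words of \<open>F\<close> are corrected by the
  inverse letter, and an order competing at the new base point is translated back to the old
  one.\<close>

lemma rebase_determined:
  assumes "determined_by F" and redF: "\<And>w. w \<in> F \<Longrightarrow> reduced w"
  shows "free_orbit.determined_by f (f t x0) ((\<lambda>w. wmul w [ginv t]) ` F)"
proof -
  interpret B: free_orbit f "f t x0" by (rule rebase)
  have pt: "B.pt (wmul u [ginv t]) = pt u" for u
    by (simp add: B.pt_wmul) (simp add: B.pt_def pt_def f_ginv)
  have ord: "B.orbit_order (wmul u [ginv t]) (wmul v [ginv t]) (wmul w [ginv t]) = orbit_order u v w" for u v w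
    by (simp add: B.orbit_order_def orbit_order_def pt)
  show ?thesis unfolding B.determined_by_def
  proof (intro allI impI)
    fix c u v w
    assume c: "circ_order c" and r: "reduced u" "reduced v" "reduced w"
      and ag: "\<forall>u\<in>(\<lambda>w. wmul w [ginv t]) ` F. \<forall>v\<in>(\<lambda>w. wmul w [ginv t]) ` F. \<forall>w\<in>(\<lambda>w. wmul w [ginv t]) ` F.
           c (Abs_G u, Abs_G v, Abs_G w) = B.orbit_order u v w"
    define c' where "c' = (\<lambda>(x, y, z). c (gmul x (Abs_G [ginv t]), gmul y (Abs_G [ginv t]), gmul z (Abs_G [ginv t])))"
    have "circ_order c'" unfolding c'_def by (rule circ_order_right_translate[OF c])
    have gm: "gmul (Abs_G u) (Abs_G [ginv t]) = Abs_G (wmul u [ginv t])" if "reduced u" for u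
      by (rule Rep_G_inject[THEN iffD1]) (simp only: Rep_gmul Rep_Abs that reduced_wmul reduced.simps)
    have "c' (Abs_G u, Abs_G v, Abs_G w) = orbit_order u v w" if "u \<in> F" "v \<in> F" "w \<in> F" for u v w
      using ag that redF by (simp add: c'_def gm ord)
    then have all: "c' (Abs_G u, Abs_G v, Abs_G w) = orbit_order u v w" if "reduced u" "reduced v" "reduced w" for u v w
      using \<open>circ_order c'\<close> assms(1) that unfolding determined_by_def by blast
    define s where "s w = wmul w [t]" for w
    have s: "reduced (s w)" "wmul (s w) [ginv t] = w" if "reduced w" for w
      using that by (auto simp: s_def reduced_wmul wmul_right_cancel)
    have "c (Abs_G u, Abs_G v, Abs_G w) = c' (Abs_G (s u), Abs_G (s v), Abs_G (s w))"
      using r s by (simp add: c'_def gm)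
    also have "\<dots> = B.orbit_order u v w" using all[of "s u" "s v" "s w"] ord[of "s u" "s v" "s w"] r s by simp
    finally show "c (Abs_G u, Abs_G v, Abs_G w) = B.orbit_order u v w" .
  qed
qed

definition jump :: "gen list \<Rightarrow> bool" where
  "jump s \<longleftrightarrow> reduced s \<and> s \<noteq> [] \<and> (\<forall>u. reduced u \<longrightarrow> \<not> ccw x0 (pt u) (pt s))"

lemma pt_Nil: "pt [] = x0" by (simp add: pt_def)

lemma jump_act: "jump s \<Longrightarrow> \<not> ccw (act g x0) (pt u) (act g (pt s))"
proof
  assume "jump s" and c: "ccw (act g x0) (pt u) (act g (pt s))"
  have "pt u = act g (pt (wmul (winv g @ u) []))" by (simp only: pt_wmul) (simp add: pt_def act_winv)
  with c have "ccw x0 (pt (wmul (winv g @ u) [])) (pt s)" by (metis act_ccw x0_S1 pt_norm mem_sphere_0)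
  moreover have "reduced (wmul (winv g @ u) [])" by (rule reduced_wmul) simp
  ultimately show False using \<open>jump s\<close> unfolding jump_def by blast
qed

text \<open>Moving the base point by \<open>t\<close> replaces the successor of the identity by its
  conjugate under \<open>t\<close>.\<close>

lemma jump_rebase:
  assumes "jump s" shows "free_orbit.jump f (f t x0) (wmul (t # s) [ginv t])"
proof -
  interpret B: free_orbit f "f t x0" by (rule rebase)
  let ?s = "wmul (t # s) [ginv t]"
  have p: "B.pt ?s = act [t] (pt s)" by (simp only: B.pt_wmul) (simp add: B.pt_def pt_def f_ginv)
  have "B.pt ?s \<noteq> f t x0"
    unfolding p using assms pt_inj[of s "[]"] f_inj[of "pt s" x0 t] by (simp add: jump_def pt_Nil)
  then have "?s \<noteq> []" using B.pt_Nil by metis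
  moreover have "reduced ?s" by (rule reduced_wmul) simp
  moreover have "\<not> ccw (f t x0) (B.pt u) (B.pt ?s)" for u
    unfolding p using jump_act[OF assms, of "[t]" "u @ [t]"] by (simp add: B.pt_def pt_def)
  ultimately show ?thesis by (simp add: B.jump_def)
qed

text \<open>A single letter has finite order, so taking successors would return to \<open>x0\<close>
  after two or three steps. The orbit-free arcs in between would then close up around the circle and
  leave no place for any other orbit point.\<close>

lemma jump_length: assumes "jump s" shows "length s \<noteq> 1"
proof
  assume "length s = 1"
  then obtain y where s: "s = [y]" by (auto simp: length_Suc_conv)
  have n: "\<not> ccw (act g x0) (pt u) (act g (f y x0))" for g u using jump_act[OF assms] s by (simp add: pt_def)
  have tot: "ccw (act g x0) (act g (f y x0)) (pt u)" if "reduced u" "pt u \<noteq> act g x0" "pt u \<noteq> act g (f y x0)" for g u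
  proof -
    have "x0 \<noteq> f y x0" using pt_inj[of "[]" "[y]"] by (simp add: pt_def)
    then have "act g x0 \<noteq> act g (f y x0)" using act_inj by simp
    then have "ccw (act g x0) (act g (f y x0)) (pt u) \<or> ccw (act g x0) (pt u) (act g (f y x0))"
      using that by (intro ccw_total) auto
    then show ?thesis using n[of g u] by blast
  qed
  show False
  proof (cases "y = GA")
    case True
    have "ccw x0 (f GA x0) (pt [GB])"
      using tot[of "[GB]" "[]"] True pt_inj[of "[GB]" "[]"] pt_inj[of "[GB]" "[GA]"] by (simp add: pt_def)
    moreover have "ccw (f GA x0) x0 (pt [GB])"
      using tot[of "[GB]" "[GA]"] True pt_inj[of "[GB]" "[]"] pt_inj[of "[GB]" "[GA]"] by (simp add: pt_def rel_GA)
    ultimately show False using ccw_asym ccw_rotate by blast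
  next
    case False
    then have y: "f y (f y x0) = f (ginv y) x0" "f y (f (ginv y) x0) = x0"
      by (cases y; simp add: rel_GB rel_GBi rel_GB_GBi rel_GBi_GB)+
    have d: "pt [GA] \<noteq> x0" "pt [GA] \<noteq> f y x0" "pt [GA] \<noteq> f (ginv y) x0"
      using pt_inj[of "[GA]" "[]"] pt_inj[of "[GA]" "[y]"] pt_inj[of "[GA]" "[ginv y]"] False
      by (cases y; simp add: pt_def)+
    have "ccw x0 (f y x0) (pt [GA])" using tot[of "[GA]" "[]"] d by simp
    moreover have "ccw (f y x0) (f (ginv y) x0) (pt [GA])" using tot[of "[GA]" "[y]"] d y by simp
    moreover have "ccw (f (ginv y) x0) x0 (pt [GA])" using tot[of "[GA]" "[ginv y]"] d y by (simp add: f_ginv)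
    ultimately show False by (auto simp: ccw_iff cyc3_def)
  qed
qed

end

text \<open>First and last letters in different factors make all powers of \<open>s\<close> reduced
  without cancellation; the choice of \<open>GA\<close> in front fixes one of the two possible
  directions of the cyclic word.\<close>

definition cyclically_good :: "gen list \<Rightarrow> bool" where
  "cyclically_good s \<longleftrightarrow> reduced s \<and> s \<noteq> [] \<and> hd s = GA \<and> in_B (last s)"

text \<open>Moving the base point conjugates the successor \<open>s\<close> of the identity, which makes it cyclically
  reduced when its length is minimal.\<close>

lemma exists_good_base_point:
  assumes "free_orbit f x" "free_orbit.jump f x s" "free_orbit.determined_by f x F" "finite F"
    "\<And>w. w \<in> F \<Longrightarrow> reduced w"
  shows "\<exists>x s F. free_orbit f x \<and> free_orbit.jump f x s \<and> free_orbit.determined_by f x F \<and> finite F \<and>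
    (\<forall>w\<in>F. reduced w) \<and> cyclically_good s"
  using assms
proof (induction "length s" arbitrary: x s F rule: less_induct)
  case less
  interpret A: free_orbit f x by fact
  note H = less.prems(2-5)
  have s: "reduced s" "s \<noteq> []" "length s \<noteq> 1" using H(1) A.jump_length[OF H(1)] by (auto simp: A.jump_def)
  then obtain y s1 where ys: "s = y # s1" "s1 \<noteq> []" by (cases s) auto
  define s2 where "s2 = butlast s1"
  define z where "z = last s1"
  have s1: "s1 = s2 @ [z]" using ys by (simp add: s2_def z_def)
  define s' where "s' = wmul (ginv y # s) [y]"
  have s': "s' = wmul s1 [y]"
    using lmul_inverse[of "wmul s1 [y]" y] by (simp add: s'_def ys reduced_wmul)
  let ?x = "f (ginv y) x" and ?F = "(\<lambda>w. wmul w [y]) ` F"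
  have B: "free_orbit f ?x" by (rule A.rebase)
  have j: "free_orbit.jump f ?x s'" using A.jump_rebase[OF H(1), of "ginv y"] by (simp add: s'_def)
  have d: "free_orbit.determined_by f ?x ?F" using A.rebase_determined[OF H(2,4), of "ginv y"] by simp
  have F: "finite ?F" "\<And>w. w \<in> ?F \<Longrightarrow> reduced w" using H by (auto simp: reduced_wmul)
  show ?case
  proof (cases "in_B z = in_B y")
    \<comment> \<open>First and last letter lie in the same factor, so conjugation by the first one
      cancels or merges them and the word becomes shorter.\<close>
    case True
    have "length (lmul z [y]) \<le> 1" using True by (cases z; cases y) auto
    then have "length s' < length s"
      using length_wmul_le[of s2 "lmul z [y]"] by (simp add: s' s1 ys)
    then show ?thesis using less.hyps[OF _ B j d F] by blast
  next
    case False
    show ?thesis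
    proof (cases "y = GA")
      case True
      then have "cyclically_good s" using False s ys s1 by (cases z) (auto simp: cyclically_good_def)
      then show ?thesis using less.prems by blast
    next
      \<comment> \<open>The word begins with a letter of order three and ends in \<open>GA\<close>;
        conjugation moves the first letter to the end without cancellation.\<close>
      case y: False
      have "reduced (s1 @ [y])" using s ys s1 False by (auto simp: reduced_append reduced_Cons)
      then have e: "s' = s1 @ [y]" unfolding s' by (rule wmul_reduced)
      have "hd s1 = GA" "in_B y" using y s ys by (auto simp: reduced_Cons not_in_B_iff[symmetric])
      then have "cyclically_good s'" using e ys \<open>reduced (s1 @ [y])\<close> by (simp add: cyclically_good_def)
      then show ?thesis using B j d F by blast
    qed
  qed
qed

section \<open>Isolated circular orders are determined by finitely many values\<close>

text \<open>A basic open set of the product topology restricts only finitely many triples;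
  \<open>F\<close> collects the words occurring in them.\<close>

lemma isolated_co_finite:
  assumes "isolated_co c"
  obtains F where "finite F" "\<And>w. w \<in> F \<Longrightarrow> reduced w"
    "\<And>c'. circ_order c' \<Longrightarrow> (\<And>u v w. u \<in> F \<Longrightarrow> v \<in> F \<Longrightarrow> w \<in> F \<Longrightarrow>
        c' (Abs_G u, Abs_G v, Abs_G w) = c (Abs_G u, Abs_G v, Abs_G w)) \<Longrightarrow> c' = c"
proof -
  from assms obtain T where T: "open T" "c \<in> T" "\<And>c'. c' \<in> CO \<Longrightarrow> c' \<in> T \<Longrightarrow> c' = c"
    unfolding isolated_co_def islimpt_def by blast
  from T(1) have "openin (product_topology (\<lambda>i. euclidean) UNIV) T" by (simp add: open_fun_def)
  then obtain V where V: "c \<in> (\<Pi>\<^sub>E i\<in>UNIV. V i)" "finite {i. V i \<noteq> UNIV}" "(\<Pi>\<^sub>E i\<in>UNIV. V i) \<subseteq> T"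
    using product_topology_open_contains_basis[of "\<lambda>i. euclidean" UNIV T c] T(2) by auto
  define F where "F = (\<Union>(g, h, k)\<in>{i. V i \<noteq> UNIV}. {Rep_G g, Rep_G h, Rep_G k})"
  show ?thesis
  proof (rule that)
    show "finite F" unfolding F_def using V(2) by auto
    show "reduced w" if "w \<in> F" for w using that by (auto simp: F_def)
    fix c' assume c': "circ_order c'" and eq: "\<And>u v w. u \<in> F \<Longrightarrow> v \<in> F \<Longrightarrow> w \<in> F \<Longrightarrow>
        c' (Abs_G u, Abs_G v, Abs_G w) = c (Abs_G u, Abs_G v, Abs_G w)"
    have "c' i \<in> V i" for i
    proof (cases "V i = UNIV")
      case False
      obtain g h k where i: "i = (g, h, k)" by (cases i) auto
      have "Rep_G g \<in> F" "Rep_G h \<in> F" "Rep_G k \<in> F" using False i unfolding F_def by fastforce+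
      then have "c' i = c i" using eq[of "Rep_G g" "Rep_G h" "Rep_G k"] i by (simp add: Rep_G_inverse)
      then show ?thesis using V(1) by auto
    qed simp
    then have "c' \<in> T" using V(3) by auto
    then show "c' = c" using T(3) c' by (simp add: CO_def)
  qed
qed


section \<open>The gap of the base point\<close>

text \<open>Powers are plain concatenations, so that their length and their first and last letters
  can be read off directly.\<close>

definition cpow :: "gen list \<Rightarrow> int \<Rightarrow> gen list" where
  "cpow w i = (if 0 \<le> i then concat (replicate (nat i) w) else concat (replicate (nat (- i)) (winv w)))"

lemma cpow_0 [simp]: "cpow w 0 = []" by (simp add: cpow_def)
lemma cpow_1 [simp]: "cpow w 1 = w" by (simp add: cpow_def)
lemma cpow_m1 [simp]: "cpow w (-1) = winv w" by (simp add: cpow_def)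

lemma cpow_pos: "0 < i \<Longrightarrow> cpow w i = w @ cpow w (i - 1)"
proof -
  assume "0 < i" then have "nat i = Suc (nat (i - 1))" by simp
  then show ?thesis using \<open>0 < i\<close> by (simp add: cpow_def)
qed

lemma cpow_neg: "i < 0 \<Longrightarrow> cpow w i = winv w @ cpow w (i + 1)"
proof -
  assume "i < 0" then have "nat (- i) = Suc (nat (- (i + 1)))" by simp
  then show ?thesis using \<open>i < 0\<close> by (cases "i = -1") (simp_all add: cpow_def)
qed

lemma length_cpow: "length (cpow w i) = nat \<bar>i\<bar> * length w"
  by (auto simp: cpow_def length_concat sum_list_replicate)

lemma reduced_concat_replicate:
  assumes "reduced w" "w \<noteq> []" "in_B (hd w) \<noteq> in_B (last w)"
  shows "reduced (concat (replicate n w))"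
proof (induction n)
  case (Suc n)
  have "concat (replicate n w) \<noteq> [] \<Longrightarrow> hd (concat (replicate n w)) = hd w"
    using assms(2) by (cases n) auto
  then show ?case using Suc assms by (auto simp: reduced_append)
qed simp

lemma hd_last_cpow:
  assumes "w \<noteq> []"
  shows "0 < i \<Longrightarrow> cpow w i \<noteq> [] \<and> hd (cpow w i) = hd w \<and> last (cpow w i) = last w"
    and "i < 0 \<Longrightarrow> cpow w i \<noteq> [] \<and> hd (cpow w i) = ginv (last w) \<and> last (cpow w i) = ginv (hd w)"
proof -
  have *: "concat (replicate (Suc n) u) \<noteq> [] \<and> hd (concat (replicate (Suc n) u)) = hd u \<and>
      last (concat (replicate (Suc n) u)) = last u" if "u \<noteq> []" for n and u :: "gen list"
    using that by (induction n) auto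
  show "0 < i \<Longrightarrow> cpow w i \<noteq> [] \<and> hd (cpow w i) = hd w \<and> last (cpow w i) = last w"
    using *[OF assms, of "nat i - 1"] by (simp add: cpow_def)
  show "i < 0 \<Longrightarrow> cpow w i \<noteq> [] \<and> hd (cpow w i) = ginv (last w) \<and> last (cpow w i) = ginv (hd w)"
    using *[of "winv w" "nat (- i) - 1"] assms hd_winv last_winv by (simp add: cpow_def)
qed

lemma reduced_cpow:
  assumes "reduced w" "w \<noteq> []" "in_B (hd w) \<noteq> in_B (last w)" shows "reduced (cpow w i)"
  using reduced_concat_replicate[OF assms] reduced_concat_replicate[of "winv w"] assms
  by (auto simp: cpow_def hd_winv last_winv)

text \<open>The circle may be cut at any point \<open>e\<close>, not only at 1, before angles are
  compared.\<close>

lemma ccw_coord: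
  assumes "e \<in> S1" "p \<in> S1" "q \<in> S1" "r \<in> S1"
  shows "ccw p q r \<longleftrightarrow> cyc3 (cang e p) (cang e q) (cang e r)"
proof -
  have b: "0 \<le> Arg2pi z" "Arg2pi z < 2 * pi" for z by (auto simp: Arg2pi_ge_0 Arg2pi_lt_2pi)
  show ?thesis
    unfolding ccw_iff cyc3_def cang_eq[OF assms(1,2)] cang_eq[OF assms(1,3)] cang_eq[OF assms(1,4)]
    using assms b[of p] b[of q] b[of r] b[of e] by auto
qed

lemma ccw_split_right: "ccw l c r \<Longrightarrow> ccw a r b \<Longrightarrow> \<not> ccw a c b \<Longrightarrow> a \<noteq> c \<Longrightarrow> ccw l a r"
  using Arg2pi_inj[of a c] unfolding ccw_iff cyc3_def by linarith

lemma ccw_split_left: "ccw l c r \<Longrightarrow> ccw a l b \<Longrightarrow> \<not> ccw a c b \<Longrightarrow> b \<noteq> c \<Longrightarrow> ccw l b r"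
  using Arg2pi_inj[of b c] unfolding ccw_iff cyc3_def by linarith

context free_orbit begin

lemma pt_eq_act:
  assumes "pt u = pt v" "z \<in> S1" shows "act u z = act v z"
proof -
  have "wmul u [] = wmul v []"
    using assms(1) pt_inj[of "wmul u []" "wmul v []"] by (simp add: reduced_wmul pt_wmul) (simp add: pt_def)
  then show ?thesis using act_wmul[OF assms(2), of u "[]"] act_wmul[OF assms(2), of v "[]"] by simp
qed

text \<open>The stabilizer of any orbit point is conjugate to that of \<open>x0\<close>, hence
  trivial.\<close>

lemma act_fixed:
  assumes "reduced u" "act u (pt w) = pt w" shows "u = []"
proof -
  have "pt (u @ w) = pt w" using assms by (simp add: pt_append)
  then have "act u (act w (act (winv w) x0)) = act w (act (winv w) x0)"
    using pt_eq_act[of "u @ w" w "act (winv w) x0"] by simp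
  then have "pt u = pt []" by (simp add: act_winv pt_def)
  then show ?thesis using pt_inj assms(1) by simp
qed

lemma act_cpow_add: "z \<in> S1 \<Longrightarrow> act (cpow w (i + j)) z = act (cpow w i) (act (cpow w j) z)"
proof (induction i rule: int_induct[of _ 0])
  case (step1 i)
  have "act (cpow w (k + 1)) y = act w (act (cpow w k) y)" if "y \<in> S1" for k y
    using that cpow_pos[of "k + 1" w] cpow_neg[of k w] by (cases "0 \<le> k") (simp_all add: act_winv)
  from this[of z "i + j"] this[of "act (cpow w j) z" i] show ?case using step1 by (simp add: algebra_simps)
next
  case (step2 i)
  have "act (cpow w (k - 1)) y = act (winv w) (act (cpow w k) y)" if "y \<in> S1" for k y
    using that cpow_pos[of k w] cpow_neg[of "k - 1" w] by (cases "0 < k") (simp_all add: act_winv)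
  from this[of z "i + j"] this[of "act (cpow w j) z" i] show ?case using step2 by (simp add: algebra_simps)
qed simp

lemma act_continuous: "continuous_on S1 (act w)"
proof (induction w)
  case (Cons s w)
  have "continuous_on (act w ` S1) (f s)"
    by (rule continuous_on_subset[OF homeo_plus_continuous[OF homeo]]) auto
  then show ?case using continuous_on_compose[OF Cons] by (simp add: o_def)
qed (simp add: continuous_on_id)

lemma act_tendsto:
  assumes "X \<longlonglongrightarrow> y" "y \<in> S1" "\<And>n. X n \<in> S1" shows "(\<lambda>n. act w (X n)) \<longlonglongrightarrow> act w y"
  using continuous_on_tendsto_compose[OF act_continuous assms(1,2)] assms(3) by auto

end

section \<open>Powers of the successor \<open>s\<close> and their limit points\<close>

locale good_orbit = free_orbit +
  fixes s :: "gen list" and F :: "gen list set"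
  assumes jump_s: "jump s" and good: "cyclically_good s"
    and det: "determined_by F" "finite F" "\<And>w. w \<in> F \<Longrightarrow> reduced w"
begin

abbreviation pw :: "int \<Rightarrow> gen list" where "pw \<equiv> cpow s"
definition q :: "int \<Rightarrow> complex" where "q i = pt (pw i)"

lemma s: "reduced s" "s \<noteq> []" "hd s = GA" "in_B (last s)" "in_B (hd s) \<noteq> in_B (last s)"
  using good by (auto simp: cyclically_good_def)

lemma reduced_pw [simp]: "reduced (pw i)" using s reduced_cpow by auto

lemma q_norm [simp]: "cmod (q i) = 1" by (simp add: q_def)

lemma q_0: "q 0 = x0" by (simp add: q_def pt_def)

lemma q_add: "act (pw i) (q j) = q (i + j)"
  using act_cpow_add[of x0 s i j] by (simp add: q_def pt_def)

lemma q_eq: "q i = q j \<longleftrightarrow> i = j"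
proof
  assume "q i = q j"
  then have "q (i - j) = pt []" using q_add[of "- j" i] q_add[of "- j" j] q_0 by (simp add: pt_Nil)
  then have "pw (i - j) = []" using pt_inj[of "pw (i - j)" "[]"] by (simp add: q_def)
  then have "nat \<bar>i - j\<bar> * length s = 0" using length_cpow[of s "i - j"] by simp
  then show "i = j" using s(2) by simp
qed simp

lemma no_orbit_between_q: "\<not> ccw (act g (q i)) (pt u) (act g (q (i + 1)))"
proof -
  have "act g (q i) = act (g @ pw i) x0" "act g (q (i + 1)) = act (g @ pw i) (pt s)"
    using q_add[of i 1] q_add[of i 0] by (simp_all add: q_0) (simp add: q_def)
  then show ?thesis using jump_act[OF jump_s] by metis
qed

lemma pw_last: "i \<noteq> 0 \<Longrightarrow> pw i \<noteq> [] \<and> (0 < i \<longrightarrow> last (pw i) = last s \<and> hd (pw i) = GA) \<and>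
    (i < 0 \<longrightarrow> last (pw i) = GA \<and> hd (pw i) = ginv (last s))"
  using hd_last_cpow[OF s(2), of i] s(3) by (cases "0 < i") auto

lemma pw_neq_GA: "pw i \<noteq> [GA]"
proof
  assume e: "pw i = [GA]"
  then have "i \<noteq> 0" by auto
  then have "in_B (hd (pw i)) \<or> in_B (last (pw i))" using pw_last[of i] s(4) by (cases "0 < i") auto
  then show False using e by simp
qed

text \<open>A cutting point that no power of \<open>s\<close> can reach: such powers have a letter
  of order three at one end, whereas \<open>[GA]\<close> has none. Measured from \<open>e1\<close>,
  the angles of the points \<open>q i\<close> increase and are bounded, so they converge on both
  sides.\<close>

definition e1 :: complex where "e1 = pt [GA]"
definition \<kappa> :: "complex \<Rightarrow> real" where "\<kappa> z = cang e1 z"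

lemma e1_norm [simp]: "cmod e1 = 1" by (simp add: e1_def)

lemma \<kappa>_bounds: "0 \<le> \<kappa> z" "\<kappa> z < 2 * pi" using cang_bounds by (auto simp: \<kappa>_def)

lemma \<kappa>_e1: "\<kappa> e1 = 0" using cang_eq[of e1 e1] by (simp add: \<kappa>_def)

lemma \<kappa>_eq: "z \<in> S1 \<Longrightarrow> w \<in> S1 \<Longrightarrow> \<kappa> z = \<kappa> w \<longleftrightarrow> z = w"
  using cang_inj[of e1 z w] by (simp add: \<kappa>_def)

lemma \<kappa>_ccw: "a \<in> S1 \<Longrightarrow> b \<in> S1 \<Longrightarrow> c \<in> S1 \<Longrightarrow> ccw a b c \<longleftrightarrow> cyc3 (\<kappa> a) (\<kappa> b) (\<kappa> c)"
  using ccw_coord[of e1 a b c] by (simp add: \<kappa>_def)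

lemma \<kappa>_cis: "z \<in> S1 \<Longrightarrow> e1 * cis (\<kappa> z) = z"
  using cang_cis[of z e1] by (simp add: \<kappa>_def)

lemma \<kappa>_of_cis: "0 \<le> t \<Longrightarrow> t < 2 * pi \<Longrightarrow> \<kappa> (e1 * cis t) = t"
proof -
  assume t: "0 \<le> t" "t < 2 * pi"
  have "e1 * cis t / e1 = cis t" using e1_norm by (metis nonzero_mult_div_cancel_left norm_zero zero_neq_one)
  then show ?thesis using t by (simp add: \<kappa>_def cang_def Arg2pi_cis)
qed

lemma \<kappa>_q_step: "\<kappa> (q i) < \<kappa> (q (i + 1))" "0 < \<kappa> (q i)"
proof -
  have n: "q i \<noteq> e1" for i using pt_inj[of "pw i" "[GA]"] pw_neq_GA by (simp add: q_def e1_def)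
  then show p: "0 < \<kappa> (q i)" for i
    using \<kappa>_eq[of "q i" e1] \<kappa>_bounds(1)[of "q i"] by (simp add: \<kappa>_e1)
  have "\<not> ccw (q i) e1 (q (i + 1))" using no_orbit_between_q[of "[]" i "[GA]"] by (simp add: e1_def)
  moreover have "q i \<noteq> q (i + 1)" by (simp add: q_eq)
  ultimately have "ccw (q i) (q (i + 1)) e1"
    using ccw_total[of "q i" "q (i + 1)" e1] n[of i] n[of "i + 1"] by auto
  then show "\<kappa> (q i) < \<kappa> (q (i + 1))" using p[of i] p[of "i + 1"] by (simp add: \<kappa>_ccw cyc3_def \<kappa>_e1)
qed

lemma \<kappa>_q: "i < j \<Longrightarrow> \<kappa> (q i) < \<kappa> (q j)"
proof (induction j rule: int_gr_induct)
  case base then show ?case by (rule \<kappa>_q_step)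
next
  case (step j) then show ?case using \<kappa>_q_step(1)[of j] by simp
qed

lemma \<kappa>_q_iff: "\<kappa> (q i) < \<kappa> (q j) \<longleftrightarrow> i < j"
  using \<kappa>_q[of i j] \<kappa>_q[of j i] by (cases i j rule: linorder_cases) auto

definition Yp :: real where "Yp = (SUP n. \<kappa> (q (int n)))"
definition Ym :: real where "Ym = (INF n. \<kappa> (q (- int n)))"
definition yp :: complex where "yp = e1 * cis Yp"
definition ym :: complex where "ym = e1 * cis Ym"

lemma lim_Yp: "(\<lambda>n. \<kappa> (q (int n))) \<longlonglongrightarrow> Yp"
  unfolding Yp_def
proof (rule LIMSEQ_incseq_SUP)
  show "bdd_above (range (\<lambda>n. \<kappa> (q (int n))))" using \<kappa>_bounds(2) by (intro bdd_aboveI2[of _ _ "2 * pi"]) (simp add: less_imp_le)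
  show "incseq (\<lambda>n. \<kappa> (q (int n)))" by (rule incseq_SucI) (use \<kappa>_q[of "int n" "int (Suc n)" for n] in \<open>simp add: less_imp_le\<close>)
qed

lemma lim_Ym: "(\<lambda>n. \<kappa> (q (- int n))) \<longlonglongrightarrow> Ym"
  unfolding Ym_def
proof (rule LIMSEQ_decseq_INF)
  show "bdd_below (range (\<lambda>n. \<kappa> (q (- int n))))" using \<kappa>_bounds(1) by (intro bdd_belowI2[of _ 0])
  have "\<kappa> (q (- int (Suc n))) \<le> \<kappa> (q (- int n))" for n using \<kappa>_q[of "- int (Suc n)" "- int n"] by simp
  then show "decseq (\<lambda>n. \<kappa> (q (- int n)))" by (rule decseq_SucI)
qed

lemma q_less_Yp: "\<kappa> (q i) < Yp"
proof -
  have "\<kappa> (q i) < \<kappa> (q (int (nat i) + 1))" by (rule \<kappa>_q) simp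
  also have "int (nat i) + 1 = int (Suc (nat i))" by simp
  also have "\<kappa> (q (int (Suc (nat i)))) \<le> Yp" 
    by (rule incseq_le[OF incseq_SucI lim_Yp]) (use \<kappa>_q[of "int n" "int (Suc n)" for n] in \<open>simp add: less_imp_le\<close>)
  finally show ?thesis .
qed

lemma Ym_less_q: "Ym < \<kappa> (q i)"
proof -
  have "Ym \<le> \<kappa> (q (- int (Suc (nat (- i)))))"
  proof (rule decseq_ge[OF decseq_SucI lim_Ym])
    show "\<kappa> (q (- int (Suc n))) \<le> \<kappa> (q (- int n))" for n using \<kappa>_q[of "- int (Suc n)" "- int n"] by simp
  qed
  also have "\<dots> < \<kappa> (q i)" by (rule \<kappa>_q) simp
  finally show ?thesis .
qed

lemma yp_norm [simp]: "cmod yp = 1" "cmod ym = 1" by (simp_all add: yp_def ym_def norm_mult)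

lemma lim_yp: "(\<lambda>n. q (int n)) \<longlonglongrightarrow> yp"
proof -
  have "(\<lambda>n. e1 * cis (\<kappa> (q (int n)))) \<longlonglongrightarrow> e1 * cis Yp"
    unfolding cis_conv_exp by (intro tendsto_intros lim_Yp)
  then show ?thesis by (simp add: \<kappa>_cis yp_def)
qed

lemma lim_ym: "(\<lambda>n. q (- int n)) \<longlonglongrightarrow> ym"
proof -
  have "(\<lambda>n. e1 * cis (\<kappa> (q (- int n)))) \<longlonglongrightarrow> e1 * cis Ym"
    unfolding cis_conv_exp by (intro tendsto_intros lim_Ym)
  then show ?thesis by (simp add: \<kappa>_cis ym_def)
qed

text \<open>Applying \<open>s\<close> shifts the sequence \<open>q\<close> by one index, and
  continuity carries this to the two limits.\<close>

lemma s_fixes: "act s yp = yp" "act s ym = ym"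
proof -
  have sq: "act s (q i) = q (i + 1)" for i using q_add[of 1 i] by (simp add: add.commute)
  have "(\<lambda>n. act s (q (int n))) \<longlonglongrightarrow> act s yp" using lim_yp by (rule act_tendsto) auto
  moreover have "(\<lambda>n. q (int (Suc n))) \<longlonglongrightarrow> yp" using lim_yp by (rule LIMSEQ_Suc)
  ultimately show "act s yp = yp" by (simp add: sq add.commute LIMSEQ_unique)
  have "(\<lambda>n. act s (q (- int (Suc n)))) \<longlonglongrightarrow> act s ym"
    using LIMSEQ_Suc[OF lim_ym] by (rule act_tendsto) auto
  then show "act s ym = ym" using lim_ym by (simp add: sq LIMSEQ_unique)
qed

lemma pw_fixes: "act (pw i) yp = yp" "act (pw i) ym = ym"
proof -
  have w: "act (winv s) y = y" if "act s y = y" "y \<in> S1" for y using that act_winv(1)[of y s] by simp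
  have "act (pw i) y = y" if y: "act s y = y" "y \<in> S1" for y
  proof (induction i rule: int_induct[of _ 0])
    case (step1 i)
    then show ?case using act_cpow_add[of y s i 1] y by simp
  next
    case (step2 i)
    then show ?case using act_cpow_add[of y s i "-1"] y w[OF y] by simp
  qed simp
  then show "act (pw i) yp = yp" "act (pw i) ym = ym" using s_fixes by auto
qed

text \<open>The ends of gaps are fixed by conjugates of \<open>s\<close>, while orbit points have
  trivial stabilizers.\<close>

lemma not_orbit: "pt w \<noteq> act g yp" "pt w \<noteq> act g ym"
proof -
  have "pt w \<noteq> act g y" if y: "act s y = y" "cmod y = 1" for y
  proof
    assume "pt w = act g y"
    then have "y = pt (winv g @ w)" using y by (simp add: pt_append act_winv)
    then have "s = []" using act_fixed[OF s(1), of "winv g @ w"] y by simp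
    then show False using s by simp
  qed
  then show "pt w \<noteq> act g yp" "pt w \<noteq> act g ym" using s_fixes by auto
qed

lemma \<kappa>_y: "\<kappa> yp = Yp" "\<kappa> ym = Ym" "0 < Ym" "Ym < Yp" "Yp < 2 * pi"
proof -
  show "Ym < Yp" using Ym_less_q[of 0] q_less_Yp[of 0] by simp
  have le: "0 \<le> Ym" "Yp \<le> 2 * pi"
  proof -
    show "0 \<le> Ym" by (rule LIMSEQ_le_const[OF lim_Ym]) (use \<kappa>_bounds(1) in auto)
    show "Yp \<le> 2 * pi" by (rule LIMSEQ_le_const2[OF lim_Yp]) (use \<kappa>_bounds(2) in \<open>auto intro: less_imp_le\<close>)
  qed
  have "yp \<noteq> e1" "ym \<noteq> e1" using not_orbit[of "[GA]" "[]"] by (auto simp: e1_def)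
  then have "Yp \<noteq> 2 * pi" "Ym \<noteq> 0" by (auto simp: yp_def ym_def)
  then show b: "0 < Ym" "Yp < 2 * pi" using le by auto
  show "\<kappa> yp = Yp" "\<kappa> ym = Ym" unfolding yp_def ym_def
    using b \<open>Ym < Yp\<close> by (auto intro!: \<kappa>_of_cis)
qed

lemma ym_neq_yp: "ym \<noteq> yp" using \<kappa>_y by auto

lemma base_gap_iff: "z \<in> S1 \<Longrightarrow> ccw ym z yp \<longleftrightarrow> (\<exists>i. z = q i \<or> ccw (q i) z (q (i + 1)))"
proof -
  assume z: "z \<in> S1"
  have 1: "ccw ym z yp \<longleftrightarrow> Ym < \<kappa> z \<and> \<kappa> z < Yp"
    using z \<kappa>_y by (auto simp: \<kappa>_ccw cyc3_def)
  have 2: "z = q i \<or> ccw (q i) z (q (i + 1)) \<longleftrightarrow> \<kappa> (q i) \<le> \<kappa> z \<and> \<kappa> z < \<kappa> (q (i + 1))" for i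
    using z \<kappa>_q_step(1)[of i] \<kappa>_eq[OF z, of "q i"] by (auto simp: \<kappa>_ccw cyc3_def)
  show ?thesis unfolding 1 2
  proof
    assume z': "Ym < \<kappa> z \<and> \<kappa> z < Yp"
    obtain n where n: "\<kappa> z < \<kappa> (q (int n))"
      using order_tendstoD(1)[OF lim_Yp, of "\<kappa> z"] z' eventually_happens by fastforce
    obtain m where m: "\<kappa> (q (- int m)) < \<kappa> z"
      using order_tendstoD(2)[OF lim_Ym, of "\<kappa> z"] z' eventually_happens by fastforce
    \<comment> \<open>The first step, counted from an index whose point lies before
      \<open>z\<close>, that passes \<open>z\<close>; the point one step earlier begins the piece
      containing \<open>z\<close>.\<close>
    define k where "k = (LEAST k. \<kappa> z < \<kappa> (q (- int m + int k)))"
    have "\<kappa> (q (int n)) \<le> \<kappa> (q (- int m + int (n + m)))" by simp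
    then have ex: "\<kappa> z < \<kappa> (q (- int m + int (n + m)))" using n by linarith
    have k: "\<kappa> z < \<kappa> (q (- int m + int k))" unfolding k_def
      by (rule LeastI[of "\<lambda>k. \<kappa> z < \<kappa> (q (- int m + int k))", OF ex])
    then obtain k' where k': "k = Suc k'" using m by (cases k) auto
    then have "k' < k" by simp
    from not_less_Least[OF this[unfolded k_def]]
    have "\<not> \<kappa> z < \<kappa> (q (- int m + int k'))" .
    moreover have "- int m + int k = (- int m + int k') + 1" using k' by simp
    ultimately show "\<exists>i. \<kappa> (q i) \<le> \<kappa> z \<and> \<kappa> z < \<kappa> (q (i + 1))" using k by (metis linorder_not_less)
  next
    assume "\<exists>i. \<kappa> (q i) \<le> \<kappa> z \<and> \<kappa> z < \<kappa> (q (i + 1))"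
    then obtain i where "\<kappa> (q i) \<le> \<kappa> z" "\<kappa> z < \<kappa> (q (i + 1))" by blast
    then show "Ym < \<kappa> z \<and> \<kappa> z < Yp" using Ym_less_q[of i] q_less_Yp[of "i + 1"] by linarith
  qed
qed

lemma ccw_q: "i < j \<Longrightarrow> ccw (q i) (q j) yp" "i < j \<Longrightarrow> ccw ym (q i) (q j)" "ccw ym (q i) yp"
  using \<kappa>_q[of i j] q_less_Yp[of i] q_less_Yp[of j] Ym_less_q[of i] Ym_less_q[of j]
  by (auto simp: \<kappa>_ccw cyc3_def \<kappa>_y)

text \<open>The translate by \<open>g\<close> of the union of all arcs between consecutive points
  \<open>q i\<close>. It depends only on the coset of \<open>g\<close> modulo powers of
  \<open>s\<close>, and its orbit points are exactly the points of this coset.\<close>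

definition J :: "gen list \<Rightarrow> complex set" where
  "J g = {z. ccw (act g ym) z (act g yp)}"

lemma J_S1: "z \<in> J g \<Longrightarrow> z \<in> S1" using ccw_S1 by (auto simp: J_def)

lemma act_J: "z \<in> S1 \<Longrightarrow> act u z \<in> J (u @ g) \<longleftrightarrow> z \<in> J g"
  by (simp add: J_def act_ccw)

lemma J_iff: "z \<in> J g \<longleftrightarrow> z \<in> S1 \<and> (\<exists>i. z = act g (q i) \<or> ccw (act g (q i)) z (act g (q (i + 1))))"
proof (cases "z \<in> S1")
  case True
  define w where "w = act (winv g) z"
  have w: "w \<in> S1" "z = act g w" using True by (auto simp: w_def act_winv)
  show ?thesis using base_gap_iff[OF w(1)] True unfolding w(2) J_def
    using act_ccw[of _ w _ g] act_inj[of w _ g] w(1) by simp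
qed (use J_S1 in blast)

lemma q_in_J: "act g (q i) \<in> J g" unfolding J_iff by (auto intro: exI[of _ i])

lemma orbit_in_J: "pt w \<in> J g \<Longrightarrow> \<exists>i. pt w = act g (q i)"
  using no_orbit_between_q unfolding J_iff by blast

lemma orbit_q: "act g (q i) = pt (wmul g (pw i))" by (simp add: pt_wmul q_def)

text \<open>Equality of left cosets of the cyclic group generated by \<open>s\<close>, stated
  through the action because the words need not be reduced.\<close>

definition coset_eq :: "gen list \<Rightarrow> gen list \<Rightarrow> bool" where
  "coset_eq g h \<longleftrightarrow> (\<exists>i. \<forall>z\<in>S1. act h z = act g (act (pw i) z))"

lemma coset_eqI:
  assumes "act h (q j) = act g (q i)" shows "coset_eq g h"
proof -
  have "pt (h @ pw j) = pt (g @ pw i)" using assms by (simp add: pt_append q_def)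
  then have "act (h @ pw j) z = act (g @ pw i) z" if "z \<in> S1" for z using pt_eq_act that by blast
  then have *: "act h (act (pw j) z) = act g (act (pw i) z)" if "z \<in> S1" for z using that by simp
  have "act h z = act g (act (pw (i - j)) z)" if "z \<in> S1" for z
    using *[of "act (pw (- j)) z"] act_cpow_add[OF that, of s j "- j"] act_cpow_add[OF that, of s i "- j"] that by simp
  then show ?thesis unfolding coset_eq_def by blast
qed

lemma coset_eq_ends: "coset_eq g h \<Longrightarrow> act h yp = act g yp" "coset_eq g h \<Longrightarrow> act h ym = act g ym"
  unfolding coset_eq_def using pw_fixes by auto

lemma coset_eq_J: "coset_eq g h \<Longrightarrow> J h = J g" by (simp add: J_def coset_eq_ends)

lemma coset_eq_refl: "coset_eq g g" unfolding coset_eq_def by (intro exI[of _ 0]) simp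

lemma coset_eq_sym: "coset_eq g h \<Longrightarrow> coset_eq h g"
  unfolding coset_eq_def
proof (elim exE)
  fix i assume *: "\<forall>z\<in>S1. act h z = act g (act (pw i) z)"
  have "act g z = act h (act (pw (- i)) z)" if "z \<in> S1" for z
    using *[rule_format, of "act (pw (- i)) z"] act_cpow_add[OF that, of s i "- i"] that by simp
  then show "\<exists>i. \<forall>z\<in>S1. act g z = act h (act (pw i) z)" by blast
qed

text \<open>A common point lies in a piece of each gap, between consecutive orbit points. Since
  neither piece has orbit points inside, both pieces start at the same orbit point.\<close>

lemma J_share: assumes "z \<in> J g" "z \<in> J h" shows "coset_eq g h"
proof -
  obtain i where i: "z = act g (q i) \<or> ccw (act g (q i)) z (act g (q (i + 1)))" using assms(1) J_iff by blast
  obtain j where j: "z = act h (q j) \<or> ccw (act h (q j)) z (act h (q (j + 1)))" using assms(2) J_iff by blast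
  have n: "\<not> ccw (act g (q i)) (act h (q j)) (act g (q (i + 1)))" "\<not> ccw (act h (q j)) (act g (q i)) (act h (q (j + 1)))"
    using no_orbit_between_q[of g i "wmul h (pw j)"] no_orbit_between_q[of h j "wmul g (pw i)"]
    by (simp_all add: orbit_q)
  have "act h (q j) = act g (q i)"
    using i j n arcs_share[OF _ _ n(2) n(1)] by metis
  then show ?thesis by (rule coset_eqI)
qed

text \<open>The endpoints of a gap lie in no gap: an orbit-free arc around such an endpoint would contain
  part of the orbit that accumulates there.\<close>

lemma ends_not_in_J: "act g yp \<notin> J h" "act g ym \<notin> J h"
proof -
  have *: False if ge: "e \<in> {act g yp, act g ym}" and eh: "e \<in> J h" for e
  proof -
    obtain i where "e = act h (q i) \<or> ccw (act h (q i)) e (act h (q (i + 1)))" using eh J_iff by blast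
    then have i: "ccw (act h (q i)) e (act h (q (i + 1)))" using ge not_orbit by (auto simp: orbit_q)
    have o: "\<not> ccw (act h (q i)) (act g (q 0)) (act h (q (i + 1)))"
      unfolding orbit_q[of g 0] by (rule no_orbit_between_q)
    have g0: "ccw (act g ym) (act g (q 0)) (act g yp)" using q_in_J[of g 0] by (simp add: J_def)
    define a b c where "a = act h (q i)" "b = act h (q (i + 1))" "c = act g (q 0)"
    have "a \<in> J g \<or> b \<in> J g"
    proof (cases "a = c \<or> b = c")
      case True then show ?thesis using q_in_J[of g 0] by (auto simp: a_b_c_def)
    next
      case False
      have "ccw (act g ym) a (act g yp) \<or> ccw (act g ym) b (act g yp)"
        using ge ccw_split_right[OF g0, of a b] ccw_split_left[OF g0, of a b] i o False
        unfolding a_b_c_def by auto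
      then show ?thesis by (auto simp: J_def)
    qed
    then have "coset_eq g h" using q_in_J J_share by (auto simp: a_b_c_def)
    then have "J h = J g" by (rule coset_eq_J)
    then show False using ge eh ccw_distinct by (auto simp: J_def)
  qed
  show "act g yp \<notin> J h" "act g ym \<notin> J h" using * by auto
qed

text \<open>Two gaps sharing their right ends, or their left ends, are nested, so one contains an
  orbit point of the other.\<close>

lemma same_end: assumes "act g yp = act h yp \<or> act g ym = act h ym" shows "coset_eq g h"
proof -
  have g0: "ccw (act g ym) (act g (q 0)) (act g yp)" using q_in_J[of g 0] by (simp add: J_def)
  have h0: "ccw (act h ym) (act h (q 0)) (act h yp)" using q_in_J[of h 0] by (simp add: J_def)
  have "act g (q 0) \<in> J h \<or> act h (q 0) \<in> J g"
    using g0 h0 assms by (auto simp: J_def ccw_iff cyc3_def)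
  then show ?thesis
    using J_share q_in_J by metis
qed

end


section \<open>Arcs between gaps\<close>

text \<open>For \<open>p = q\<close> this is a single point, not the whole circle. Arcs between gaps
  could degenerate in this way, which has to be excluded later.\<close>

definition carc :: "complex \<Rightarrow> complex \<Rightarrow> complex set" where
  "carc p q = {z. z = p \<or> z = q \<or> ccw p z q}"

lemma homeo_plus_image_carc:
  assumes f: "homeo_plus f" and ab: "a \<in> S1" "b \<in> S1"
  shows "f ` carc a b = carc (f a) (f b)"
proof -
  obtain g where g: "homeomorphism S1 S1 f g" using f by (auto simp: homeo_plus_def)
  have S: "carc p q \<subseteq> S1" if "p \<in> S1" "q \<in> S1" for p q using that ccw_S1 by (auto simp: carc_def)
  have i: "f z \<in> carc (f a) (f b) \<longleftrightarrow> z \<in> carc a b" if "z \<in> S1" for z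
    using that ab homeo_plus_ccw[OF f] homeo_plus_inj[OF f] unfolding carc_def by simp
  show ?thesis
  proof
    show "f ` carc a b \<subseteq> carc (f a) (f b)" using i S[OF ab] by blast
    show "carc (f a) (f b) \<subseteq> f ` carc a b"
    proof
      fix z assume z: "z \<in> carc (f a) (f b)"
      then have "z \<in> S1" using S[of "f a" "f b"] homeo_plus_S1[OF f] ab by blast
      then have "g z \<in> S1" "f (g z) = z" using g unfolding homeomorphism_def by auto
      then show "z \<in> f ` carc a b" using i z by (metis image_eqI)
    qed
  qed
qed

text \<open>On the way from \<open>p\<close> to \<open>q\<close> the point \<open>w\<close> has left
  the gap of \<open>p\<close> and has not yet entered the gap of \<open>q\<close>, so it lies
  between the right end of the former and the left end of the latter.\<close>

lemma between_gaps:
  assumes "ccw a p b" "ccw a' q b'" "ccw p w q" "\<not> ccw a w b" "\<not> ccw a' w b'" "\<not> ccw a q b" "\<not> ccw a' p b'"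
  shows "w \<in> carc b a'"
proof -
  have "w = b \<or> w = a' \<or> ccw b w a'"
    using assms Arg2pi_inj[of w b] Arg2pi_inj[of w a'] unfolding ccw_iff cyc3_def by (smt (verit))
  then show ?thesis by (simp add: carc_def)
qed

lemma before_gap_point:
  assumes "ccw a w p" "ccw a p b" "ccw p w q" shows "ccw a q b"
  using assms unfolding ccw_iff cyc3_def by linarith

lemma after_gap_point:
  assumes "ccw q w b'" "ccw a' q b'" "ccw p w q" shows "ccw a' p b'"
  using assms unfolding ccw_iff cyc3_def by linarith

lemma carc_meet:
  assumes "z \<in> carc a b" "z \<in> carc a' b'" "a \<in> S1" "b \<in> S1" "a' \<in> S1" "b' \<in> S1"
  shows "a' \<in> carc a b \<or> a \<in> carc a' b'" "b' \<in> carc a b \<or> b \<in> carc a' b'"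
proof -
  have "z \<in> S1" using assms ccw_S1 by (auto simp: carc_def)
  have L: "a' \<in> carc a b" if "ccw a a' z" "z \<in> carc a b" for a a' b
    using that ccw_trans[OF that(1), of b] ccw_distinct[OF that(1)] by (auto simp: carc_def)
  show "a' \<in> carc a b \<or> a \<in> carc a' b'"
  proof (cases "a = a' \<or> a = z \<or> a' = z")
    case False
    then have "ccw a a' z \<or> ccw a' a z"
      using ccw_total[OF assms(3,5) \<open>z \<in> S1\<close>] ccw_rotate by blast
    then show ?thesis using L assms(1,2) by blast
  qed (use assms(1,2) in \<open>auto simp: carc_def\<close>)
  have R: "b' \<in> carc a b" if "ccw z b' b" "z \<in> carc a b" for a b b'
    using that ccw_distinct[OF that(1)] by (auto simp: carc_def ccw_iff cyc3_def)
  show "b' \<in> carc a b \<or> b \<in> carc a' b'"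
  proof (cases "b = b' \<or> b = z \<or> b' = z")
    case False
    then have "ccw z b b' \<or> ccw z b' b"
      using ccw_total[OF \<open>z \<in> S1\<close> assms(4,6)] by blast
    then show ?thesis using R assms(1,2) by blast
  qed (use assms(1,2) in \<open>auto simp: carc_def\<close>)
qed

text \<open>An arc that contains \<open>a'\<close> without starting there has come through the piece
  just before \<open>a'\<close>; as it does not start inside that piece, it contains all of
  it.\<close>

lemma carc_left: "a' \<in> carc a b \<Longrightarrow> a \<noteq> a' \<Longrightarrow> ccw l c a' \<Longrightarrow> \<not> ccw l a a' \<Longrightarrow> a \<in> S1 \<Longrightarrow> c \<in> carc a b"
  using Arg2pi_inj[of a c] Arg2pi_inj[of a a'] unfolding carc_def mem_Collect_eq ccw_iff cyc3_def by (smt (verit))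

lemma carc_right: "b' \<in> carc a b \<Longrightarrow> b \<noteq> b' \<Longrightarrow> ccw b' c r \<Longrightarrow> \<not> ccw b' b r \<Longrightarrow> b \<in> S1 \<Longrightarrow> c \<in> carc a b"
  using Arg2pi_inj[of b c] Arg2pi_inj[of b b'] unfolding carc_def mem_Collect_eq ccw_iff cyc3_def by (smt (verit))

section \<open>First letters near the two ends of a gap\<close>

context good_orbit begin

text \<open>The type of the orbit points of the gap that accumulate at its right end
  \<open>act g yp\<close>; \<open>LT\<close> does the same for the left end.\<close>

definition RT :: "gen list \<Rightarrow> gen \<Rightarrow> bool" where
  "RT g t \<longleftrightarrow> (\<exists>N. \<forall>i\<ge>N. ty (wmul g (pw i)) = Some t)"
definition LT :: "gen list \<Rightarrow> gen \<Rightarrow> bool" where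
  "LT g t \<longleftrightarrow> (\<exists>N. \<forall>i\<le>N. ty (wmul g (pw i)) = Some t)"

lemma ty_empty [simp]: "ty [] = None" by (simp add: ty_def)

lemma reduced_wpw [simp]: "reduced (wmul g (pw i))" by (simp add: reduced_wmul)

lemma RT_unique: assumes "RT g t" "RT g t'" shows "t = t'"
proof -
  obtain N M where "\<forall>i\<ge>N. ty (wmul g (pw i)) = Some t" "\<forall>i\<ge>M. ty (wmul g (pw i)) = Some t'"
    using assms unfolding RT_def by blast
  then have "Some t = Some t'" by (metis max.cobounded1 max.cobounded2)
  then show ?thesis by simp
qed

lemma wpw_eqI: "act g (q i) = act h (q j) \<Longrightarrow> wmul g (pw i) = wmul h (pw j)"
  unfolding orbit_q using pt_inj by simp

lemma wpw_inj: "wmul g (pw i) = wmul g (pw j) \<longleftrightarrow> i = j"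
  using orbit_q[of g i] orbit_q[of g j] act_inj[of "q i" "q j" g] q_eq by auto

lemma RT_coset: assumes "coset_eq g h" "RT g t" shows "RT h t"
proof -
  obtain k where k: "\<forall>z\<in>S1. act h z = act g (act (pw k) z)" using assms(1) by (auto simp: coset_eq_def)
  have "wmul h (pw i) = wmul g (pw (k + i))" for i
    by (rule wpw_eqI) (use k in \<open>simp add: q_add\<close>)
  moreover obtain N where "\<forall>i\<ge>N. ty (wmul g (pw i)) = Some t" using assms(2) by (auto simp: RT_def)
  ultimately have "\<forall>i\<ge>N - k. ty (wmul h (pw i)) = Some t" by simp
  then show ?thesis unfolding RT_def by blast
qed

text \<open>The words of one coset are distinct, so any single word is avoided from some index on.
  With the empty tail this keeps a cancelled letter from leaving the identity.\<close>

lemma RT_form: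
  assumes "RT g x" obtains N where "\<And>i. N \<le> i \<Longrightarrow> \<exists>v. wmul g (pw i) = x # v \<and> v \<noteq> u"
proof -
  obtain N where N: "\<forall>i\<ge>N. ty (wmul g (pw i)) = Some x" using assms by (auto simp: RT_def)
  obtain M where M: "\<forall>i\<ge>M. wmul g (pw i) \<noteq> x # u"
  proof (cases "\<exists>i. wmul g (pw i) = x # u")
    case True
    then obtain i where "wmul g (pw i) = x # u" by blast
    then have "\<forall>j\<ge>i + 1. wmul g (pw j) \<noteq> x # u" using wpw_inj by (metis add_le_same_cancel1 not_one_le_zero)
    then show ?thesis using that by blast
  qed (use that in blast)
  have "\<exists>v. wmul g (pw i) = x # v \<and> v \<noteq> u" if "max N M \<le> i" for i
    using N[rule_format, of i] M[rule_format, of i] that by (cases "wmul g (pw i)") auto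
  then show ?thesis using that by blast
qed

text \<open>Three cases: the letter \<open>t\<close> is put in front of \<open>GA\<close>, merges
  with an equal letter into its inverse, or cancels its inverse and uncovers the letter
  \<open>GA\<close> behind it.\<close>

lemma RT_letter:
  assumes "RT g x" "in_B t"
  shows "RT (t # g) (if x = GA then t else if x = t then ginv t else GA)"
proof -
  obtain N where N: "\<And>i. N \<le> i \<Longrightarrow> \<exists>v. wmul g (pw i) = x # v \<and> v \<noteq> []" using RT_form[OF assms(1)] by metis
  have "ty (wmul (t # g) (pw i)) = Some (if x = GA then t else if x = t then ginv t else GA)" if i: "N \<le> i" for i
  proof -
    obtain v where v: "wmul g (pw i) = x # v" "v \<noteq> []" using N[OF i] by blast
    have r: "reduced (x # v)" using reduced_wpw[of g i] v by simp
    have "wmul (t # g) (pw i) = lmul t (x # v)" by (simp add: v)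
    moreover have "x \<noteq> GA \<Longrightarrow> hd v = GA" using r v(2) by (cases x) (auto simp: reduced_Cons not_in_B_iff)
    ultimately show ?thesis using assms(2) v(2) by (cases x; cases t) (auto simp: ty_def)
  qed
  then show ?thesis unfolding RT_def by blast
qed

lemma RT_GA: "RT g x \<Longrightarrow> x \<noteq> GA \<Longrightarrow> RT (GA # g) GA"
proof -
  assume "RT g x" and x: "x \<noteq> GA"
  then obtain N where N: "\<forall>i\<ge>N. ty (wmul g (pw i)) = Some x" by (auto simp: RT_def)
  have "ty (wmul (GA # g) (pw i)) = Some GA" if "N \<le> i" for i
    using N[rule_format, OF that] x by (cases "wmul g (pw i)"; cases x) auto
  then show ?thesis unfolding RT_def by blast
qed

lemma not_RT_GA: assumes "RT g GA" shows "\<not> RT (GA # g) GA"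
proof
  assume "RT (GA # g) GA"
  then obtain N M where N: "\<forall>i\<ge>N. ty (wmul g (pw i)) = Some GA" and M: "\<forall>i\<ge>M. ty (wmul (GA # g) (pw i)) = Some GA"
    using assms unfolding RT_def by blast
  define i where "i = max N M"
  have "ty (wmul g (pw i)) = Some GA" using N by (simp add: i_def)
  then obtain v where v: "wmul g (pw i) = GA # v" by (cases "wmul g (pw i)") auto
  have "ty (wmul (GA # g) (pw i)) = Some GA" using M by (simp add: i_def)
  then have "ty v = Some GA" by (simp add: v)
  moreover have "reduced (GA # v)" using v reduced_wpw[of g i] by simp
  ultimately show False by (cases v) auto
qed

text \<open>The words whose first letter can change when \<open>s\<close> is appended: either the
  word cancels completely against a prefix of \<open>s\<close>, or all but its first letter cancels
  and this letter merges with the next one of \<open>s\<close>. The former give the principal gaps,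
  the latter, collected in \<open>GQ\<close>, the complementary gaps. The full prefix is omitted
  since \<open>winv s\<close> lies in the coset of the identity.\<close>

definition GP :: "gen list set" where "GP = {winv u | u v. s = u @ v \<and> v \<noteq> []}"
definition GQ :: "gen list set" where "GQ = {y # winv u | u y v. s = u @ y # v \<and> in_B y}"

lemma finite_GP [simp]: "finite GP"
proof (rule finite_subset)
  show "GP \<subseteq> (\<lambda>n. winv (take n s)) ` {..length s}"
  proof
    fix g assume "g \<in> GP"
    then obtain u v where "g = winv u" "s = u @ v" by (auto simp: GP_def)
    then show "g \<in> (\<lambda>n. winv (take n s)) ` {..length s}" by (intro image_eqI[of _ _ "length u"]) auto
  qed
qed simp

lemma finite_GQ [simp]: "finite GQ"
proof (rule finite_subset)
  show "GQ \<subseteq> (\<lambda>n. s ! n # winv (take n s)) ` {..length s}"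
  proof
    fix g assume "g \<in> GQ"
    then obtain u y v where "g = y # winv u" "s = u @ y # v" by (auto simp: GQ_def)
    then show "g \<in> (\<lambda>n. s ! n # winv (take n s)) ` {..length s}" by (intro image_eqI[of _ _ "length u"]) auto
  qed
qed simp

lemma Nil_GP: "[] \<in> GP" unfolding GP_def using s(2) by (intro CollectI exI[of _ "[]"] exI[of _ s]) simp

lemma wpw_pos:
  assumes "s = u @ v" "0 < i" shows "wmul (winv u) (pw i) = v @ pw (i - 1)"
proof -
  have p: "pw i = u @ (v @ pw (i - 1))" using cpow_pos[OF assms(2), of s] assms(1) by simp
  then have r: "reduced (u @ (v @ pw (i - 1)))" using reduced_pw[of i] by simp
  then have "wmul u (v @ pw (i - 1)) = pw i" using wmul_reduced p by simp
  then show ?thesis using wmul_winv[of "v @ pw (i - 1)" u] r by (simp add: reduced_append)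
qed

text \<open>Nothing cancels: a nonempty \<open>winv u\<close> ends in \<open>GA\<close>, because
  \<open>s\<close> begins with it, and negative powers of \<open>s\<close> begin with a letter of
  order three.\<close>

lemma wpw_neg:
  assumes "s = u @ v" "i < 0" shows "wmul (winv u) (pw i) = winv u @ pw i"
proof (rule wmul_reduced)
  have "reduced u" using s(1) assms(1) by (simp add: reduced_append)
  moreover have "u \<noteq> [] \<Longrightarrow> last (winv u) = GA" using assms(1) s(3) last_winv[of u] by (cases u) auto
  ultimately show "reduced (winv u @ pw i)" using pw_last[of i] assms(2) s(4) by (auto simp: reduced_append)
qed

lemma RT_P: assumes "s = u @ v" "v \<noteq> []" shows "RT (winv u) (hd v)"
  unfolding RT_def using assms wpw_pos[OF assms(1)] by (intro exI[of _ 1]) (auto simp: ty_def)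

lemma LT_P: assumes "s = u @ v" "u \<noteq> []" shows "LT (winv u) (ginv (last u))"
  unfolding LT_def using assms wpw_neg[OF assms(1)] hd_winv[of u] by (intro exI[of _ "-1"]) (auto simp: ty_def)

lemma LT_Nil: "LT [] (ginv (last s))"
  unfolding LT_def using pw_last by (intro exI[of _ "-1"]) (auto simp: ty_def)

lemma Q_prefix: assumes "s = u @ y # v" "in_B y" shows "u \<noteq> []" "last u = GA"
proof -
  show "u \<noteq> []" using assms s(3) by auto
  then show "last u = GA" using s(1) assms by (auto simp: reduced_append not_in_B_iff)
qed

lemma RT_Q: assumes "s = u @ y # v" "in_B y" shows "RT (y # winv u) (ginv y)"
proof -
  have "RT (winv u) y" using RT_P[OF assms(1)] by simp
  from RT_letter[OF this assms(2)] show ?thesis using assms(2) by (cases y) auto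
qed

lemma LT_Q: assumes "s = u @ y # v" "in_B y" shows "LT (y # winv u) y"
proof -
  note u = Q_prefix[OF assms]
  have "ty (wmul (y # winv u) (pw i)) = Some y" if "i \<le> -1" for i
  proof -
    have "wmul (winv u) (pw i) = winv u @ pw i" using wpw_neg[OF assms(1)] that by simp
    moreover obtain x where "winv u = GA # x" using hd_winv[OF u(1)] u by (cases "winv u") auto
    ultimately show ?thesis using assms(2) by (cases y) auto
  qed
  then show ?thesis unfolding LT_def by blast
qed

lemma GP_types:
  assumes "g \<in> GP" obtains t t' where "RT g t" "LT g t'" "t = GA \<longleftrightarrow> t' \<noteq> GA"
proof -
  obtain u v where u: "g = winv u" "s = u @ v" "v \<noteq> []" using assms by (auto simp: GP_def)
  show ?thesis
  proof (cases "u = []")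
    case True
    then show ?thesis using that[of GA "ginv (last s)"] RT_P[OF u(2,3)] LT_Nil u s(3,4) by (cases "last s") auto
  next
    case False
    have "in_B (last u) \<noteq> in_B (hd v)" using s(1) u False by (simp add: reduced_append)
    then show ?thesis using that[OF RT_P[OF u(2,3), folded u(1)] LT_P[OF u(2) False, folded u(1)]]
      by (cases "last u"; cases "hd v") auto
  qed
qed

lemma GQ_types:
  assumes "g \<in> GQ" obtains y where "RT g (ginv y)" "LT g y" "in_B y"
  using assms RT_Q LT_Q unfolding GQ_def by blast

lemma RT_exists: assumes "g \<in> GP \<union> GQ" obtains t where "RT g t"
  using assms GP_types GQ_types by (metis Un_iff)

lemma LT_unique: assumes "LT g t" "LT g t'" shows "t = t'"
proof -
  obtain N M where "\<forall>i\<le>N. ty (wmul g (pw i)) = Some t" "\<forall>i\<le>M. ty (wmul g (pw i)) = Some t'"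
    using assms unfolding LT_def by blast
  then have "Some t = Some t'" by (metis min.cobounded1 min.cobounded2)
  then show ?thesis by simp
qed

lemma LT_coset: assumes "coset_eq g h" "LT g t" shows "LT h t"
proof -
  obtain k where k: "\<forall>z\<in>S1. act h z = act g (act (pw k) z)" using assms(1) by (auto simp: coset_eq_def)
  have "wmul h (pw i) = wmul g (pw (k + i))" for i
    by (rule wpw_eqI) (use k in \<open>simp add: q_add\<close>)
  moreover obtain N where "\<forall>i\<le>N. ty (wmul g (pw i)) = Some t" using assms(2) by (auto simp: LT_def)
  ultimately have "\<forall>i\<le>N - k. ty (wmul h (pw i)) = Some t" by simp
  then show ?thesis unfolding LT_def by blast
qed

text \<open>Successors in the orbit are unique, so the point after \<open>w\<close> is
  \<open>w s\<close>. The product decomposition then shows how \<open>w\<close> must look for the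
  first letter to change.\<close>

lemma change_in_gap:
  assumes r: "reduced w" "reduced w'" and t: "ty w \<noteq> ty w'" and n: "\<And>u. reduced u \<Longrightarrow> \<not> ccw (pt w) (pt u) (pt w')"
  shows "w' = wmul w s" "\<exists>g\<in>GP \<union> GQ. pt w \<in> J g" "ty w = Some GA \<Longrightarrow> \<exists>g\<in>GP. pt w \<in> J g"
proof -
  let ?v = "wmul w s"
  have rv: "reduced ?v" using s(1) reduced_wmul by blast
  have pv: "pt ?v = act w (pt s)" by (simp add: pt_wmul)
  have pw: "pt w = act w x0" by (simp add: pt_def)
  have "pt s \<noteq> x0" using pt_inj[of s "[]"] s by (simp add: pt_Nil)
  then have d: "pt w \<noteq> pt ?v" unfolding pv pw using act_inj[of "pt s" x0 w] by auto
  have d': "pt w \<noteq> pt w'" using t r pt_inj by auto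
  have "pt w' = pt ?v"
  proof (rule ccontr)
    assume "pt w' \<noteq> pt ?v"
    then have "ccw (pt w) (pt w') (pt ?v) \<or> ccw (pt w) (pt ?v) (pt w')" using d d' by (intro ccw_total) auto
    then show False using n[OF rv] jump_act[OF jump_s, of w w'] by (simp add: pv pw)
  qed
  then show w': "w' = ?v" using r rv pt_inj by simp
  have self: "pt w \<in> J w" using q_in_J[of w 0] by (simp add: q_0 pw)
  obtain g1 u v where D: "w = g1 @ winv u \<and> s = u @ v \<and> wmul w s = g1 @ v \<or>
      (\<exists>y. in_B y \<and> w = g1 @ y # winv u \<and> s = u @ y # v \<and> wmul w s = g1 @ ginv y # v)"
    using wmul_decompose[OF r(1) s(1)] by blast
  \<comment> \<open>A nonempty \<open>g1\<close> begins both \<open>w\<close> and \<open>w s\<close>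
    and would preserve the first letter.\<close>
  then have "g1 = []" using t w' by (cases g1) auto
  with D consider "w = winv u" "s = u @ v" "v \<noteq> []" | "w = winv s" | y where "in_B y" "w = y # winv u" "s = u @ y # v"
    by (cases "v = []") auto
  then have *: "w \<in> GP \<or> w = winv s \<or> w \<in> GQ \<and> ty w \<noteq> Some GA"
  proof cases
    case 1
    then have "w \<in> GP" unfolding GP_def by blast
    then show ?thesis ..
  next
    case (3 y)
    then have "w \<in> GQ" unfolding GQ_def by blast
    then show ?thesis using 3 by auto
  qed blast
  have "pt w \<in> J []" if "w = winv s" using q_in_J[of "[]" "-1"] that by (simp add: q_def)
  then show "\<exists>g\<in>GP \<union> GQ. pt w \<in> J g" "ty w = Some GA \<Longrightarrow> \<exists>g\<in>GP. pt w \<in> J g"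
    using * self Nil_GP by blast+
qed

text \<open>Orbit points near the two ends of the stretch have different types, so somewhere between
  them the type changes. The change occurs in neither of the two bounding gaps, where the chosen
  points are already beyond the index of stability, and every change lies in a gap of the
  list.\<close>

lemma constancy:
  assumes RT: "RT g t" and LT: "LT h t'" and tt: "t \<noteq> t'" and gh: "\<not> coset_eq g h"
  obtains w where "pt w \<in> carc (act g yp) (act h ym)" "\<exists>k\<in>GP \<union> GQ. pt w \<in> J k"
    "t = GA \<Longrightarrow> \<exists>k\<in>GP. pt w \<in> J k"
proof -
  obtain N where N: "\<forall>i\<ge>N. ty (wmul g (pw i)) = Some t" using RT by (auto simp: RT_def)
  obtain M where M: "\<forall>i\<le>M. ty (wmul h (pw i)) = Some t'" using LT by (auto simp: LT_def)
  define p where "p = wmul g (pw N)"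
  define r where "r = wmul h (pw M)"
  have pr: "pt p = act g (q N)" "pt r = act h (q M)" by (simp_all add: p_def r_def orbit_q)
  have pJ: "pt p \<in> J g" "pt r \<in> J h" using pr q_in_J by auto
  then have ne: "pt p \<notin> J h" "pt r \<notin> J g" using gh J_share coset_eq_sym by blast+
  have "reduced p" "reduced r" "ty p \<noteq> ty r" using N M tt by (auto simp: p_def r_def)
  then obtain w w' where w: "reduced w" "reduced w'" "w = p \<or> ccw (pt p) (pt w) (pt r)"
    "w' = r \<or> ccw (pt p) (pt w') (pt r)" "ty w = ty p" "ty w' \<noteq> ty p"
    "\<And>u. reduced u \<Longrightarrow> \<not> ccw (pt w) (pt u) (pt w')"
    using type_change[OF det] by metis
  have w': "w' = wmul w s" and ex: "\<exists>g\<in>GP \<union> GQ. pt w \<in> J g" "ty w = Some GA \<Longrightarrow> \<exists>g\<in>GP. pt w \<in> J g"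
    using change_in_gap[OF w(1,2) _ w(7)] w(5,6) by auto
  have tp: "ty p = Some t" using N by (simp add: p_def)
  have ng: "pt w \<notin> J g"
  proof
    assume "pt w \<in> J g"
    then obtain i where i: "pt w = act g (q i)" using orbit_in_J by blast
    have "N \<le> i"
    proof (rule ccontr)
      assume "\<not> N \<le> i"
      then have "ccw (act g ym) (pt w) (pt p)" "ccw (act g ym) (pt p) (act g yp)"
        using ccw_q(2)[of i N] ccw_q(3)[of N] by (simp_all add: i pr act_ccw)
      moreover have "ccw (pt p) (pt w) (pt r)" using w(3) calculation(1) ccw_distinct by auto
      ultimately have "ccw (act g ym) (pt r) (act g yp)" by (rule before_gap_point)
      then show False using ne by (simp add: J_def)
    qed
    have "pt w' = act w (pt s)" unfolding w' by (simp add: pt_wmul)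
    also have "\<dots> = act (g @ pw i) (pt s)"
      by (rule pt_eq_act) (use i in \<open>simp_all add: pt_append q_def\<close>)
    also have "\<dots> = act g (q (i + 1))" using q_add[of i 1] by (simp add: q_def)
    finally have "pt w' = act g (q (i + 1))" .
    then have "w' = wmul g (pw (i + 1))" using pt_inj w(2) by (simp add: orbit_q)
    then show False using N \<open>N \<le> i\<close> w(6) tp by simp
  qed
  have nh: "pt w \<notin> J h"
  proof
    assume "pt w \<in> J h"
    then obtain i where i: "pt w = act h (q i)" using orbit_in_J by blast
    have "w = wmul h (pw i)" using i w(1) pt_inj by (simp add: orbit_q)
    then have "\<not> i \<le> M" using M tt w(5) tp by auto
    then have "ccw (pt r) (pt w) (act h yp)" "ccw (act h ym) (pt r) (act h yp)"
      using ccw_q(1)[of M i] ccw_q(3)[of M] by (simp_all add: i pr act_ccw)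
    moreover have "w \<noteq> p" using ne(1) \<open>pt w \<in> J h\<close> by auto
    then have "ccw (pt p) (pt w) (pt r)" using w(3) by simp
    ultimately have "ccw (act h ym) (pt p) (act h yp)" by (rule after_gap_point)
    then show False using ne by (simp add: J_def)
  qed
  have "w \<noteq> p" using ng pJ by auto
  then have "ccw (pt p) (pt w) (pt r)" using w(3) by simp
  then have "pt w \<in> carc (act g yp) (act h ym)"
    using between_gaps[of "act g ym" "pt p" "act g yp" "act h ym" "pt r" "act h yp" "pt w"] pJ ne ng nh
    by (simp add: J_def)
  then show ?thesis using that ex tp w(5) by auto
qed

section \<open>The arcs complementary to finitely many gaps\<close>

definition gaps_of :: "gen list set \<Rightarrow> complex set" where
  "gaps_of G = (\<Union>g\<in>G. J g)"

definition isarc :: "gen list set \<Rightarrow> gen list \<Rightarrow> gen list \<Rightarrow> bool" where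
  "isarc G g h \<longleftrightarrow> g \<in> G \<and> h \<in> G \<and> carc (act g yp) (act h ym) \<inter> gaps_of G = {}"

lemma cang_self: "z \<in> S1 \<Longrightarrow> cang z z = 0" using cang_eq[of z z] by simp

text \<open>The bounding gaps are those whose right end is nearest behind \<open>z\<close> and whose
  left end is nearest ahead of \<open>z\<close>. A gap meeting the arc between these ends would have
  to contain \<open>z\<close> or offer a nearer end.\<close>

lemma arcs_cover:
  assumes G: "finite G" "G \<noteq> {}" and z: "z \<in> S1" "z \<notin> gaps_of G"
  obtains g h where "isarc G g h" "z \<in> carc (act g yp) (act h ym)"
proof -
  obtain g where g: "g \<in> G" "\<And>k. k \<in> G \<Longrightarrow> cang (act g yp) z \<le> cang (act k yp) z"
    using arg_min_if_finite[OF G, of "\<lambda>k. cang (act k yp) z"] by (metis linorder_not_less)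
  obtain h where h: "h \<in> G" "\<And>k. k \<in> G \<Longrightarrow> cang z (act h ym) \<le> cang z (act k ym)"
    using arg_min_if_finite[OF G, of "\<lambda>k. cang z (act k ym)"] by (metis linorder_not_less)
  define p where "p = act g yp"
  define r where "r = act h ym"
  have S: "p \<in> S1" "r \<in> S1" by (simp_all add: p_def r_def)
  have zero: "cang a b = 0 \<longleftrightarrow> a = b" if "a \<in> S1" "b \<in> S1" for a b
    using cang_inj[OF that(1) that(2) that(1)] cang_self[OF that(1)] by auto
  have m1: "\<not> ccw p (act k yp) z" "act k yp = z \<Longrightarrow> p = z" if "k \<in> G" for k
    using g(2)[OF that] ccw_cang_left[of p "act k yp" z] zero[of p z] cang_bounds(1)[of p z] S z(1)
    by (auto simp: p_def cang_self)
  have m2: "\<not> ccw z (act k ym) r" "act k ym = z \<Longrightarrow> r = z" if "k \<in> G" for k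
    using h(2)[OF that] zero[of z r] cang_bounds(1)[of z r] S z(1)
    by (auto simp: r_def cang_self ccw_cang)
  have gap: "ccw (act k ym) (act k (q 0)) (act k yp)" "\<not> ccw (act k ym) z (act k yp)" "p \<notin> J k" "r \<notin> J k" if "k \<in> G" for k
    using q_in_J[of k 0] z(2) that ends_not_in_J by (auto simp: J_def gaps_of_def p_def r_def)
  have zc: "z = p \<or> z = r \<or> ccw p z r"
  proof (rule ccontr)
    assume n: "\<not> (z = p \<or> z = r \<or> ccw p z r)"
    have "\<not> ccw p (act h yp) z" "act h yp \<noteq> z" "ccw r (act h (q 0)) (act h yp)" "\<not> ccw r z (act h yp)" "\<not> ccw r p (act h yp)"
      using m1[OF h(1)] gap[OF h(1)] n by (auto simp: r_def J_def)
    then show False using n S z(1) Arg2pi_inj[of z p] Arg2pi_inj[of z r] Arg2pi_inj[of p r] Arg2pi_inj[of "act h yp" z]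
        Arg2pi_inj[of "act h yp" p]
      unfolding ccw_iff cyc3_def by (smt (verit))
  qed
  have "w \<notin> J k" if k: "k \<in> G" and w: "w \<in> carc p r" for k w
  proof
    assume wk: "w \<in> J k"
    then have wk': "ccw (act k ym) w (act k yp)" by (simp add: J_def)
    have "w \<noteq> p" "w \<noteq> r" using gap[OF k] wk by auto
    then have c: "ccw p w r" using w by (simp add: carc_def)
    have np: "\<not> ccw (act k ym) p (act k yp)" "\<not> ccw (act k ym) r (act k yp)" using gap[OF k] by (auto simp: J_def)
    show False
      using zc c wk' np gap(2)[OF k] m1[OF k] m2[OF k] S z(1)
        Arg2pi_inj[of z p] Arg2pi_inj[of z r] Arg2pi_inj[of w z] Arg2pi_inj[of "act k yp" z] Arg2pi_inj[of "act k ym" z]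
      unfolding ccw_iff cyc3_def by (smt (verit))
  qed
  then have "isarc G g h" using g h by (auto simp: isarc_def gaps_of_def p_def r_def)
  moreover have "z \<in> carc (act g yp) (act h ym)" using zc by (simp add: carc_def p_def r_def)
  ultimately show ?thesis by (rule that)
qed

text \<open>If two meeting arcs had different ends, an end of one would be passed by the other,
  which would then run into the gap attached to that end.\<close>

lemma arcs_disjoint:
  assumes 1: "isarc G g h" "z \<in> carc (act g yp) (act h ym)" and 2: "isarc G g' h'" "z \<in> carc (act g' yp) (act h' ym)"
  shows "act g yp = act g' yp" "act h ym = act h' ym"
proof -
  define a b a' b' where ab: "a = act g yp" "b = act h ym" "a' = act g' yp" "b' = act h' ym"
  have S: "a \<in> S1" "b \<in> S1" "a' \<in> S1" "b' \<in> S1" by (simp_all add: ab)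
  have out: "w \<notin> carc a b \<and> w \<notin> carc a' b'" if "k \<in> {g, h, g', h'}" "w \<in> J k" for k w
    using that 1(1) 2(1) unfolding isarc_def gaps_of_def ab by blast
  have *: "\<not> ccw (act k ym) w (act k yp)" if "k \<in> {g, h, g', h'}" "w \<in> carc a b \<or> w \<in> carc a' b'" for k w
    using out[OF that(1)] that(2) by (auto simp: J_def)
  have mid: "ccw (act k ym) (act k (q 0)) (act k yp)" "act k (q 0) \<notin> carc a b" "act k (q 0) \<notin> carc a' b'" if "k \<in> {g, h, g', h'}" for k
    using out[OF that q_in_J] q_in_J[of k 0] by (auto simp: J_def)
  note meet = carc_meet[OF 1(2)[folded ab] 2(2)[folded ab] S]
  have ends: "a \<in> carc a b" "b \<in> carc a b" "a' \<in> carc a' b'" "b' \<in> carc a' b'" by (auto simp: carc_def)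
  show "act g yp = act g' yp"
    using meet(1) carc_left[of a' a b "act g' ym" "act g' (q 0)"] carc_left[of a a' b' "act g ym" "act g (q 0)"]
      mid[of g] mid[of g'] *[of g a'] *[of g' a] ends S unfolding ab[symmetric] by blast
  show "act h ym = act h' ym"
    using meet(2) carc_right[of b' a b "act h' (q 0)" "act h' yp"] carc_right[of b a' b' "act h (q 0)" "act h yp"]
      mid[of h] mid[of h'] *[of h b'] *[of h' b] ends S unfolding ab[symmetric] by blast
qed


section \<open>How the generators permute gaps and arcs\<close>

lemma coset_eq_trans: assumes "coset_eq g h" "coset_eq h k" shows "coset_eq g k"
proof -
  obtain i where i: "\<forall>z\<in>S1. act h z = act g (act (pw i) z)" using assms(1) by (auto simp: coset_eq_def)
  obtain j where j: "\<forall>z\<in>S1. act k z = act h (act (pw j) z)" using assms(2) by (auto simp: coset_eq_def)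
  have "act k z = act g (act (pw (i + j)) z)" if "z \<in> S1" for z
    using i j that act_cpow_add[OF that, of s i j] by simp
  then show ?thesis unfolding coset_eq_def by blast
qed

lemma coset_eq_act: "(\<And>z. z \<in> S1 \<Longrightarrow> act h z = act g z) \<Longrightarrow> coset_eq g h"
  unfolding coset_eq_def by (intro exI[of _ 0]) simp

lemma coset_eq_Cons: "coset_eq g h \<Longrightarrow> coset_eq (t # g) (t # h)"
  unfolding coset_eq_def by auto

lemma coset_winv_s: "coset_eq (winv s) []"
  unfolding coset_eq_def by (intro exI[of _ 1]) (simp add: act_winv)

lemma prefix_coset_GP: assumes "s = u @ v" obtains g where "g \<in> GP" "coset_eq (winv u) g"
proof (cases "v = []")
  case True
  then show ?thesis using that[OF Nil_GP] coset_winv_s assms by simp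
next
  case False
  then have "winv u \<in> GP" using assms unfolding GP_def by blast
  then show ?thesis using that coset_eq_refl by blast
qed

text \<open>Each letter \<open>x\<close> of order three in \<open>s = u @ x # v\<close> contributes
  the gaps of \<open>winv u\<close>, \<open>winv (u @ [x])\<close> and \<open>x # winv u\<close>.
  These three are one orbit of the factor of order three.\<close>

lemma Gen_letter:
  assumes g: "g \<in> GP \<union> GQ" and t: "in_B t" shows "\<exists>g'\<in>GP \<union> GQ. coset_eq (t # g) g'"
proof -
  have last: "\<exists>g'\<in>GP \<union> GQ. coset_eq (t # winv (u @ [x])) g'"
    if sx: "s = u @ x # v" and ix: "in_B x" for u x v
  proof (cases "t = x")
    case True
    obtain g' where g': "g' \<in> GP" "coset_eq (winv u) g'" using prefix_coset_GP[OF sx] .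
    have "coset_eq (t # winv (u @ [x])) (winv u)" by (rule coset_eq_act) (simp add: True f_ginv)
    then show ?thesis using g' coset_eq_trans by blast
  next
    case False
    then have "t = ginv x" using t ix by (cases t; cases x) auto
    have "coset_eq (t # winv (u @ [x])) (x # winv u)"
      by (rule coset_eq_act) (use ix \<open>t = ginv x\<close> in \<open>cases x; simp add: rel_GB rel_GBi\<close>)
    moreover have "x # winv u \<in> GQ" using sx ix unfolding GQ_def by blast
    ultimately show ?thesis by blast
  qed
  have head: "\<exists>g'\<in>GP \<union> GQ. coset_eq (t # winv u) g'" if "s = u @ x # v" "in_B x" for u x v
  proof (cases "t = x")
    case True
    then have "t # winv u \<in> GQ" using that unfolding GQ_def by blast
    then show ?thesis using coset_eq_refl by blast
  next
    case False
    then have "t # winv u = winv (u @ [x])" using t that(2) by (cases t; cases x) auto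
    then show ?thesis using prefix_coset_GP[of "u @ [x]" v] that by auto
  qed
  show ?thesis
  proof (cases "g \<in> GQ")
    case True
    then obtain u y v where g: "g = y # winv u" "s = u @ y # v" "in_B y" by (auto simp: GQ_def)
    show ?thesis
    proof (cases "t = y")
      case True
      obtain g' where g': "g' \<in> GP" "coset_eq (winv (u @ [y])) g'" using prefix_coset_GP[of "u @ [y]" v] g by auto
      have "coset_eq (t # g) (winv (u @ [y]))"
        by (rule coset_eq_act) (use g True in \<open>cases y; simp add: rel_GB rel_GBi\<close>)
      then show ?thesis using g' coset_eq_trans by blast
    next
      case False
      then have "t = ginv y" using t g(3) by (cases t; cases y) auto
      obtain g' where g': "g' \<in> GP" "coset_eq (winv u) g'" using prefix_coset_GP[OF g(2)] .
      have "coset_eq (t # g) (winv u)" by (rule coset_eq_act) (simp add: g \<open>t = ginv y\<close> f_ginv)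
      then show ?thesis using g' coset_eq_trans by blast
    qed
  next
    case False
    then obtain u v where u: "g = winv u" "s = u @ v" "v \<noteq> []" using assms by (auto simp: GP_def)
    show ?thesis
    proof (cases "u = []")
      case True
      \<comment> \<open>The identity has no prefix to work with, but \<open>winv s\<close> lies in
        its coset and removes the last letter of \<open>s\<close>, which has order three.\<close>
      have "s = butlast s @ last s # []" using s(2) by simp
      from last[OF this s(4)] obtain g' where "g' \<in> GP \<union> GQ" "coset_eq (t # winv s) g'" using s(2) by auto
      moreover have "coset_eq (t # g) (t # winv s)"
        using True u coset_eq_Cons[OF coset_eq_sym[OF coset_winv_s]] by simp
      ultimately show ?thesis using coset_eq_trans by blast
    next
      case False
      then obtain u' x where u': "u = u' @ [x]" by (cases u rule: rev_cases) auto
      obtain y v' where v': "v = y # v'" using u(3) by (cases v) auto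
      have "in_B x \<noteq> in_B y" 
      proof -
        have "reduced (u @ v)" using s(1) u by simp
        then show ?thesis using u' v' by (simp add: reduced_append)
      qed
      then show ?thesis using last[of u' x v] head[of u y v'] u u' v' by (cases "in_B x") auto
    qed
  qed
qed

text \<open>Each \<open>GA\<close> in \<open>s\<close> pairs the gaps of the prefixes before and
  after it; no element of \<open>GQ\<close> is involved.\<close>

lemma GP_letter: assumes "g \<in> GP" shows "\<exists>g'\<in>GP. coset_eq (GA # g) g'"
proof -
  obtain u v where u: "g = winv u" "s = u @ v" "v \<noteq> []" using assms by (auto simp: GP_def)
  show ?thesis
  proof (cases "hd v = GA")
    case True
    then obtain v' where "v = GA # v'" using u by (cases v) auto
    then show ?thesis using prefix_coset_GP[of "u @ [GA]" v'] u by auto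
  next
    case False
    then have "u \<noteq> []" using u s(3) by auto
    then obtain u' x where u': "u = u' @ [x]" by (cases u rule: rev_cases) auto
    have "reduced (u @ v)" using s(1) u by simp
    then have "in_B x \<noteq> in_B (hd v)" using u' u(3) by (simp add: reduced_append[of "u' @ [x]" v] del: append_assoc)
    then have "x = GA" using False by (cases x; cases "hd v") auto
    obtain g' where g': "g' \<in> GP" "coset_eq (winv u') g'" using prefix_coset_GP[of u' "x # v"] u u' by auto
    have "coset_eq (GA # g) (winv u')" by (rule coset_eq_act) (simp add: u u' \<open>x = GA\<close> rel_GA)
    then show ?thesis using g' coset_eq_trans by blast
  qed
qed

lemma gaps_letter:
  assumes "\<And>g. g \<in> G \<Longrightarrow> \<exists>g'\<in>G. coset_eq (t # g) g'" "z \<in> gaps_of G" shows "f t z \<in> gaps_of G"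
proof -
  obtain g where g: "g \<in> G" "z \<in> J g" using assms(2) by (auto simp: gaps_of_def)
  then have "act [t] z \<in> J ([t] @ g)" using act_J[of z "[t]" g] J_S1 by simp
  moreover obtain g' where "g' \<in> G" "coset_eq (t # g) g'" using assms(1) g by blast
  ultimately show ?thesis using coset_eq_J unfolding gaps_of_def by auto
qed

lemma gaps_letter_iff:
  assumes "\<And>g. g \<in> G \<Longrightarrow> \<exists>g'\<in>G. coset_eq (t # g) g'" "\<And>g. g \<in> G \<Longrightarrow> \<exists>g'\<in>G. coset_eq (ginv t # g) g'"
    and "z \<in> S1" shows "f t z \<in> gaps_of G \<longleftrightarrow> z \<in> gaps_of G"
  using gaps_letter[of G t z] gaps_letter[of G "ginv t" "f t z"] assms f_ginv(1)[of z t] by auto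

lemma isarc_letter:
  assumes cl: "\<And>g. g \<in> G \<Longrightarrow> \<exists>g'\<in>G. coset_eq (t # g) g'" "\<And>g. g \<in> G \<Longrightarrow> \<exists>g'\<in>G. coset_eq (ginv t # g) g'"
    and a: "isarc G g h"
  obtains g' h' where "isarc G g' h'" "coset_eq (t # g) g'" "coset_eq (t # h) h'"
    "f t ` carc (act g yp) (act h ym) = carc (act g' yp) (act h' ym)"
proof -
  obtain g' where g': "g' \<in> G" "coset_eq (t # g) g'" using cl(1) a by (auto simp: isarc_def)
  obtain h' where h': "h' \<in> G" "coset_eq (t # h) h'" using cl(1) a by (auto simp: isarc_def)
  have e: "f t ` carc (act g yp) (act h ym) = carc (act g' yp) (act h' ym)"
    using homeo_plus_image_carc[OF homeo, of "act g yp" "act h ym" t] coset_eq_ends[OF g'(2)] coset_eq_ends[OF h'(2)] by simp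
  have "f t z \<notin> gaps_of G" if "z \<in> carc (act g yp) (act h ym)" for z
  proof -
    have "z \<in> S1" using that ccw_S1 by (auto simp: carc_def)
    then show ?thesis using gaps_letter_iff[OF cl] a that unfolding isarc_def by auto
  qed
  then have "carc (act g' yp) (act h' ym) \<inter> gaps_of G = {}" unfolding e[symmetric] by auto
  then have "isarc G g' h'" using g'(1) h'(1) by (simp add: isarc_def)
  then show ?thesis using that g' h' e by blast
qed

text \<open>Arcs are sorted by the type just before their starting point. \<open>A GA\<close>,
  \<open>A GB\<close> and \<open>A GBi\<close> become the three sets of the Markov system.\<close>

definition A :: "gen \<Rightarrow> complex set" where
  "A t = \<Union>{carc (act g yp) (act h ym) | g h. isarc (GP \<union> GQ) g h \<and> RT g t}"

lemma A_S1: "A t \<subseteq> S1" unfolding A_def carc_def using ccw_S1 by auto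

lemma A_gaps: "A t \<inter> gaps_of (GP \<union> GQ) = {}" unfolding A_def isarc_def by auto

lemma A_disjoint: assumes "t \<noteq> t'" shows "A t \<inter> A t' = {}"
proof (rule ccontr)
  assume "A t \<inter> A t' \<noteq> {}"
  then obtain z g h g' h' where *: "isarc (GP \<union> GQ) g h" "RT g t" "z \<in> carc (act g yp) (act h ym)"
    "isarc (GP \<union> GQ) g' h'" "RT g' t'" "z \<in> carc (act g' yp) (act h' ym)" unfolding A_def by blast
  have "act g yp = act g' yp" by (rule arcs_disjoint(1)[OF *(1,3,4,6)])
  then have "RT g' t" using same_end RT_coset *(2) by blast
  then show False using RT_unique *(5) assms by blast
qed

lemma A_cover: assumes "z \<in> S1" shows "z \<in> gaps_of (GP \<union> GQ) \<or> (\<exists>t. z \<in> A t)"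
proof (cases "z \<in> gaps_of (GP \<union> GQ)")
  case False
  have "finite (GP \<union> GQ)" "GP \<union> GQ \<noteq> {}" using Nil_GP by auto
  from arcs_cover[OF this assms False] obtain g h where a: "isarc (GP \<union> GQ) g h" "z \<in> carc (act g yp) (act h ym)" .
  then obtain t where "RT g t" using RT_exists by (auto simp: isarc_def)
  then show ?thesis using a unfolding A_def by blast
qed simp

lemma GA_GP: "[GA] \<in> GP"
proof -
  have "s = [GA] @ tl s" using s by (cases s) auto
  moreover have "tl s \<noteq> []" using s by (cases s) auto
  ultimately have "winv [GA] \<in> GP" unfolding GP_def by blast
  then show ?thesis by simp
qed

lemma not_coset_Nil_GA: "\<not> coset_eq [] [GA]"
proof
  assume "coset_eq [] [GA]"
  then have "J [GA] = J []" by (rule coset_eq_J)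
  then have "pt [GA] \<in> J []" using q_in_J[of "[GA]" 0] by (simp add: q_0 pt_def)
  then obtain i where "pt [GA] = pt (pw i)" using orbit_in_J by (fastforce simp: q_def)
  then show False using pt_inj[of "[GA]" "pw i"] pw_neq_GA by force
qed

text \<open>Different types at the two ends would force a further gap inside the arc by
  \<open>constancy\<close>.\<close>

lemma isarc_types: assumes a: "isarc (GP \<union> GQ) g h" and t: "RT g t" shows "LT h t"
proof -
  have "h \<in> GP \<union> GQ" using a by (simp add: isarc_def)
  then obtain t' where t': "LT h t'" using GP_types GQ_types by (metis Un_iff)
  have "t = t'"
  proof (rule ccontr)
    assume n: "t \<noteq> t'"
    show False
    proof (cases "coset_eq g h")
      case False
      obtain w where "pt w \<in> carc (act g yp) (act h ym)" "\<exists>k\<in>GP \<union> GQ. pt w \<in> J k"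
        using constancy[OF t t' n False] by metis
      then show False using a unfolding isarc_def gaps_of_def by blast
    next
      case True
      \<comment> \<open>If both bounding gaps are the same, the arc runs around the whole rest of
        the circle and would contain a second gap, which exists because the cosets of
        \<open>[]\<close> and \<open>[GA]\<close> differ.\<close>
      obtain k where k: "k \<in> GP" "\<not> coset_eq g k"
        using not_coset_Nil_GA Nil_GP GA_GP coset_eq_trans coset_eq_sym by metis
      define z where "z = act k (q 0)"
      have zk: "z \<in> J k" "z \<in> S1" using q_in_J by (simp_all add: z_def)
      then have "z \<notin> J g" using k J_share by blast
      then have "\<not> ccw (act g ym) z (act g yp)" by (simp add: J_def)
      moreover have "act g ym \<noteq> act g yp" using ym_neq_yp act_inj by simp
      ultimately have "z \<in> carc (act g yp) (act g ym)"
        using ccw_total[of "act g ym" z "act g yp"] zk(2) ccw_rotate by (auto simp: carc_def)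
      then have "z \<in> carc (act g yp) (act h ym)" using coset_eq_ends[OF True] by simp
      then show False using a k(1) zk(1) unfolding isarc_def gaps_of_def by blast
    qed
  qed
  then show ?thesis using t' by simp
qed

lemma A_letter:
  assumes t: "in_B t" shows "f t ` A x \<subseteq> A (if x = GA then t else if x = t then ginv t else GA)"
proof
  fix z assume "z \<in> f t ` A x"
  then obtain g h where a: "isarc (GP \<union> GQ) g h" "RT g x" "z \<in> f t ` carc (act g yp) (act h ym)"
    unfolding A_def by blast
  obtain g' h' where g': "isarc (GP \<union> GQ) g' h'" "coset_eq (t # g) g'"
    "f t ` carc (act g yp) (act h ym) = carc (act g' yp) (act h' ym)"
    using isarc_letter[OF Gen_letter[OF _ t] Gen_letter a(1)] t by (metis in_B_ginv)
  have "RT g' (if x = GA then t else if x = t then ginv t else GA)"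
    using RT_coset[OF g'(2) RT_letter[OF a(2) t]] .
  then show "z \<in> A (if x = GA then t else if x = t then ginv t else GA)"
    using g' a(3) unfolding A_def by blast
qed

text \<open>The three inclusions run around a cycle of length three, and the cube of
  \<open>f GB\<close> is the identity, so they are equalities.\<close>

lemma image_A: "f GB ` A GA = A GB" "f GB ` A GB = A GBi"
proof -
  have 1: "f GB ` A GA \<subseteq> A GB" "f GB ` A GB \<subseteq> A GBi" "f GB ` A GBi \<subseteq> A GA"
    using A_letter[of GB GA] A_letter[of GB GB] A_letter[of GB GBi] by auto
  have 3: "f GB (f GB (f GB z)) = z" if "z \<in> S1" for z
    using that by (simp add: rel_GB rel_GB_GBi)
  have "z \<in> f GB ` A GA" if "z \<in> A GB" for z
  proof -
    have "f GB (f GB z) \<in> A GA" using that 1 by blast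
    moreover have "z \<in> S1" using that A_S1 by blast
    then have "z = f GB (f GB (f GB z))" using 3[of z] by simp
    ultimately show ?thesis by (rule image_eqI[rotated])
  qed
  moreover have "z \<in> f GB ` A GB" if "z \<in> A GBi" for z
  proof -
    have "f GB (f GB z) \<in> A GB" using that 1 by blast
    moreover have "z \<in> S1" using that A_S1 by blast
    then have "z = f GB (f GB (f GB z))" using 3[of z] by simp
    ultimately show ?thesis by (rule image_eqI[rotated])
  qed
  ultimately show "f GB ` A GA = A GB" "f GB ` A GB = A GBi" using 1 by blast+
qed

text \<open>A complementary gap inside the arc would have a left type of order three, so the type
  would change on the way from \<open>GA\<close>. A change from \<open>GA\<close> happens only in a
  principal gap, and the arc contains none. Thus \<open>A GA\<close> is described by
  \<open>GP\<close> alone, which matters because \<alpha> permutes the gaps of \<open>GP\<close> but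
  not those of \<open>GQ\<close>.\<close>

lemma GP_arc_is_arc: assumes a: "isarc GP g h" and t: "RT g GA" shows "isarc (GP \<union> GQ) g h"
proof -
  let ?C = "carc (act g yp) (act h ym)"
  have "z \<notin> J k" if k: "k \<in> GQ" and z: "z \<in> ?C" for k z
  proof
    assume zk: "z \<in> J k"
    obtain y where y: "LT k y" "in_B y" using GQ_types[OF k] by blast
    have "\<not> coset_eq g k"
    proof
      assume "coset_eq g k"
      then have "z \<in> J g" using coset_eq_J zk by blast
      then show False using a z unfolding isarc_def gaps_of_def by blast
    qed
    then obtain w where w: "pt w \<in> carc (act g yp) (act k ym)" "\<exists>j\<in>GP. pt w \<in> J j"
      using constancy[OF t y(1)] y(2) by (metis in_B.simps(1))
    have z': "ccw (act k ym) z (act k yp)" "act g yp \<notin> J k" "act h ym \<notin> J k" using zk ends_not_in_J by (auto simp: J_def)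
    have n: "z \<noteq> act g yp" "z \<noteq> act h ym" using zk ends_not_in_J by auto
    have c: "ccw (act g yp) z (act h ym)" using z n by (simp add: carc_def)
    have ng: "\<not> ccw (act k ym) (act g yp) (act k yp)" "\<not> ccw (act k ym) (act h ym) (act k yp)" using z' by (auto simp: J_def)
    have km: "act k ym = act g yp \<or> ccw (act g yp) (act k ym) (act h ym)"
      using z'(1) c ng Arg2pi_inj[of "act k ym" "act g yp"] unfolding ccw_iff cyc3_def by (smt (verit))
    have "carc (act g yp) (act k ym) \<subseteq> ?C"
    proof
      fix x assume "x \<in> carc (act g yp) (act k ym)"
      then consider "x = act g yp" | "x = act k ym" | "ccw (act g yp) x (act k ym)" by (auto simp: carc_def)
      then show "x \<in> ?C"
      proof cases
        case 3
        then have "ccw (act g yp) (act k ym) (act h ym)" using km ccw_distinct by metis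
        with 3 have "ccw (act g yp) x (act h ym)" by (rule ccw_trans)
        then show ?thesis by (simp add: carc_def)
      qed (use km in \<open>auto simp: carc_def\<close>)
    qed
    then show False using w a unfolding isarc_def gaps_of_def by blast
  qed
  then show ?thesis using a unfolding isarc_def gaps_of_def by blast
qed

lemma arc_is_GP_arc: assumes a: "isarc (GP \<union> GQ) g h" and t: "RT g GA" shows "isarc GP g h"
proof -
  have "LT h GA" by (rule isarc_types[OF a t])
  have "g \<notin> GQ" using GQ_types t RT_unique by (metis in_B.simps(1) in_B_ginv)
  moreover have "h \<notin> GQ" using GQ_types \<open>LT h GA\<close> LT_unique by (metis in_B.simps(1))
  ultimately show ?thesis using a unfolding isarc_def gaps_of_def by blast
qed

lemma A_GA_eq: "z \<in> A GA \<longleftrightarrow> (\<exists>g h. isarc GP g h \<and> RT g GA \<and> z \<in> carc (act g yp) (act h ym))"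
  using GP_arc_is_arc arc_is_GP_arc unfolding A_def by blast

text \<open>\<alpha> permutes the arcs between principal gaps and toggles whether their type is
  \<open>GA\<close>: it either removes this letter or puts it in front.\<close>

lemma GA_swaps:
  assumes "z \<in> S1" "z \<notin> gaps_of GP" shows "f GA z \<in> A GA \<longleftrightarrow> z \<notin> A GA"
proof -
  have "finite GP" "GP \<noteq> {}" using Nil_GP by auto
  from arcs_cover[OF this assms] obtain g h where a: "isarc GP g h" "z \<in> carc (act g yp) (act h ym)" .
  obtain g' h' where g': "isarc GP g' h'" "coset_eq (GA # g) g'"
    "f GA ` carc (act g yp) (act h ym) = carc (act g' yp) (act h' ym)"
    using isarc_letter[OF GP_letter _ a(1)] GP_letter by (metis ginv.simps(1))
  have fz: "f GA z \<in> carc (act g' yp) (act h' ym)" using a(2) g'(3) by blast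
  have in_A: "w \<in> A GA \<longleftrightarrow> RT k GA" if "isarc GP k l" "w \<in> carc (act k yp) (act l ym)" for w k l
  proof
    assume "w \<in> A GA"
    then obtain k' l' where k': "isarc GP k' l'" "RT k' GA" "w \<in> carc (act k' yp) (act l' ym)" using A_GA_eq by blast
    have "act k' yp = act k yp" by (rule arcs_disjoint(1)[OF k'(1,3) that])
    then show "RT k GA" using same_end RT_coset k'(2) by blast
  qed (use that A_GA_eq in blast)
  obtain x where x: "RT g x" using a(1) GP_types by (metis isarc_def)
  have "RT g' GA \<longleftrightarrow> RT (GA # g) GA" using RT_coset g'(2) coset_eq_sym by blast
  also have "\<dots> \<longleftrightarrow> \<not> RT g GA" using x RT_GA not_RT_GA RT_unique by blast
  finally show ?thesis using in_A[OF a] in_A[OF g'(1) fz] by simp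
qed

lemma GQ_GP_gaps_disjoint: "gaps_of GQ \<inter> gaps_of GP = {}"
proof -
  have False if g: "g \<in> GQ" and h: "h \<in> GP" and z: "z \<in> J g" "z \<in> J h" for g h z
  proof -
    have c: "coset_eq g h" using J_share z by blast
    obtain y where y: "RT g (ginv y)" "LT g y" "in_B y" using GQ_types[OF g] .
    obtain t t' where t: "RT h t" "LT h t'" "t = GA \<longleftrightarrow> t' \<noteq> GA" using GP_types[OF h] .
    have "t = ginv y" "t' = y" using RT_unique[OF t(1)] LT_unique[OF t(2)] RT_coset[OF c y(1)] LT_coset[OF c y(2)] by auto
    then show False using t(3) y(3) by (cases y) auto
  qed
  then show ?thesis unfolding gaps_of_def by blast
qed

text \<open>Outside the principal gaps \<alpha> exchanges \<open>A GA\<close> with everything else,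
  and everything else consists of the other arcs together with the complementary gaps.\<close>

lemma image_A_GA: "f GA ` A GA = A GB \<union> A GBi \<union> gaps_of GQ"
proof -
  have P: "f GA z \<in> gaps_of GP \<longleftrightarrow> z \<in> gaps_of GP" if "z \<in> S1" for z
    by (rule gaps_letter_iff) (use GP_letter that in auto)
  have un: "gaps_of (GP \<union> GQ) = gaps_of GP \<union> gaps_of GQ" by (auto simp: gaps_of_def)
  have gS: "gaps_of G \<subseteq> S1" for G using J_S1 by (auto simp: gaps_of_def)
  have inv: "z \<in> f GA ` A GA \<longleftrightarrow> f GA z \<in> A GA" if "z \<in> S1" for z
  proof
    assume "z \<in> f GA ` A GA"
    then obtain w where w: "w \<in> A GA" "z = f GA w" by blast
    then have "w \<in> S1" using A_S1 by blast
    then show "f GA z \<in> A GA" using w rel_GA by simp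
  qed (use rel_GA[OF that] in force)
  have "z \<in> f GA ` A GA \<longleftrightarrow> z \<in> A GB \<union> A GBi \<union> gaps_of GQ" if z: "z \<in> S1" for z
  proof (cases "z \<in> gaps_of GP")
    case True
    then have "f GA z \<notin> A GA" using P[OF z] A_gaps un by blast
    then show ?thesis using inv[OF z] True A_gaps un GQ_GP_gaps_disjoint by blast
  next
    case False
    have "z \<notin> A GA \<longleftrightarrow> z \<in> A GB \<union> A GBi \<union> gaps_of GQ"
    proof
      assume "z \<notin> A GA"
      moreover have "z \<in> gaps_of (GP \<union> GQ) \<or> z \<in> A GA \<or> z \<in> A GB \<or> z \<in> A GBi"
        using A_cover[OF z] by (metis gen.exhaust)
      ultimately show "z \<in> A GB \<union> A GBi \<union> gaps_of GQ" using False un by blast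
    next
      assume "z \<in> A GB \<union> A GBi \<union> gaps_of GQ"
      then show "z \<notin> A GA" using A_disjoint[of GB GA] A_disjoint[of GBi GA] A_gaps[of GA] un by auto
    qed
    then show ?thesis using inv[OF z] GA_swaps[OF z False] by blast
  qed
  moreover have "f GA ` A GA \<subseteq> S1"
  proof
    fix z assume "z \<in> f GA ` A GA"
    then obtain w where "w \<in> A GA" "z = f GA w" by blast
    moreover from this have "w \<in> S1" using A_S1 by blast
    ultimately show "z \<in> S1" by simp
  qed
  moreover have "A GB \<union> A GBi \<union> gaps_of GQ \<subseteq> S1" using A_S1 gS by blast
  ultimately show ?thesis by blast
qed


section \<open>Nondegeneracy of the arcs and the position of their ends\<close>

lemma ginv_last_neq: "in_B x \<Longrightarrow> ginv x \<noteq> x" by (cases x) auto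

text \<open>Words in the cosets of \<open>GP\<close> are empty or end in \<open>last s\<close> or in
  \<open>GA\<close>. So the inverse of the last letter of \<open>s\<close> marks an orbit point
  outside all principal gaps.\<close>

lemma missed_word:
  assumes "s = u @ v" "v \<noteq> []" shows "wmul (winv u) (pw i) \<noteq> [ginv (last s)]"
proof
  assume e: "wmul (winv u) (pw i) = [ginv (last s)]"
  consider "0 < i" | "i = 0" | "i < 0" by linarith
  then show False
  proof cases
    case 1
    then have "[ginv (last s)] = v @ pw (i - 1)" using wpw_pos[OF assms(1)] e by simp
    then have "ginv (last s) = last (v @ pw (i - 1))" by (metis last.simps)
    also have "\<dots> = last s" using 1 pw_last[of "i - 1"] assms by (cases "i = 1") auto
    finally show False using ginv_last_neq s(4) by blast
  next
    case 2
    have "reduced (winv u)" using s(1) assms by (simp add: reduced_append)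
    then have "winv u = [ginv (last s)]" using e 2 by simp
    moreover from this have "last (winv u) = GA" using assms(1) s(3) last_winv[of u] by (cases u) auto
    ultimately show False using s(4) by (cases "last s") auto
  next
    case 3
    then have "[ginv (last s)] = winv u @ pw i" using wpw_neg[OF assms(1)] e by simp
    then have "ginv (last s) = last (winv u @ pw i)" by (metis last.simps)
    also have "\<dots> = GA" using 3 pw_last[of i] by simp
    finally show False using s(4) by (cases "last s") auto
  qed
qed

text \<open>If the arc between two adjacent gaps degenerated to a point \<open>y\<close>, then two conjugates \<open>p\<close> and
  \<open>r\<close> of \<open>s\<close> would fix \<open>y\<close>. Freeness forces \<open>p\<close> to be a power of \<open>r\<close>, and then \<open>p = r\<^sup>-\<^sup>1\<close> for reasons
  of length and first letters. Comparing the two words yields an involution that exchanges the two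
  gaps, so that the gaps fill the circle up to two points. But they miss part of the orbit.\<close>

lemma arc_nondegenerate:
  assumes a: "isarc (GP \<union> GQ) g h" and t: "RT g GA" shows "act g yp \<noteq> act h ym"
proof
  assume eq: "act g yp = act h ym"
  define y where "y = act g yp"
  have P: "g \<in> GP" "h \<in> GP" using arc_is_GP_arc[OF a t] by (auto simp: isarc_def)
  have LTh: "LT h GA" by (rule isarc_types[OF a t])
  obtain u0 v0 where g: "g = winv u0" "s = u0 @ v0" "v0 \<noteq> []" using P by (auto simp: GP_def)
  obtain u v where h: "h = winv u" "s = u @ v" "v \<noteq> []" using P by (auto simp: GP_def)
  have hd_v0: "hd v0 = GA" using RT_P[OF g(2,3)] t g(1) RT_unique by auto
  have u: "u \<noteq> []"
  proof
    assume "u = []"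
    then have "GA = ginv (last s)" using LT_unique[OF LTh] LT_Nil h(1) by simp
    then show False using s(4) by (cases "last s") auto
  qed
  have "GA = ginv (last u)" using LT_unique[OF LTh] LT_P[OF h(2) u] h(1) by simp
  then have last_u: "last u = GA" by (cases "last u") auto
  \<comment> \<open>The rotations \<open>p\<close> and \<open>r\<close> of the cyclic word
    \<open>s\<close> are its conjugates by \<open>g\<close> and \<open>h\<close>; they fix the ends
    of the respective gaps.\<close>
  define p where "p = v0 @ u0"
  define r where "r = v @ u"
  have sv0: "act v0 z = act g (act s z)" if "z \<in> S1" for z
    using that act_winv(1)[of "act v0 z" u0] by (simp add: g)
  have v0y: "act v0 yp = y" "act v0 ym = act g ym" using sv0 s_fixes by (auto simp: y_def)
  have py: "act p y = y" using v0y act_winv(2)[of yp u0] by (simp add: p_def y_def g(1))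
  have yh: "y = act h ym" using eq by (simp add: y_def)
  have yS: "cmod y = 1" by (simp add: y_def)
  define z1 where "z1 = act (winv p) (act h yp)"
  have pz1: "act p z1 = act h yp" "cmod z1 = 1" by (simp_all add: z1_def act_winv)
  have hyp: "act h yp \<noteq> y" using yh ym_neq_yp act_inj[of yp ym h] by auto
  then have z1y: "z1 \<noteq> y" using py pz1 by auto
  \<comment> \<open>An orbit point of the gap of \<open>h\<close> so close to the common fixed point
    \<open>y\<close> that \<open>p\<close> keeps it inside this gap. Its image lies in the same
    coset, which makes \<open>p\<close> a power of \<open>r\<close>.\<close>
  have "\<exists>i. ccw y (act h (q i)) z1"
  proof (cases "z1 \<in> J h")
    case True
    then obtain k where k: "z1 = act h (q k) \<or> ccw (act h (q k)) z1 (act h (q (k + 1)))" using J_iff by blast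
    have 1: "ccw y (act h (q (k - 1))) (act h (q k))" "ccw y (act h (q k)) (act h (q (k + 1)))"
      using ccw_q(2)[of "k - 1" k] ccw_q(2)[of k "k + 1"] by (simp_all add: yh act_ccw)
    from k have "ccw y (act h (q (k - 1))) z1"
    proof
      assume "ccw (act h (q k)) z1 (act h (q (k + 1)))"
      with 1 show ?thesis unfolding ccw_iff cyc3_def by linarith
    qed (use 1 in simp)
    then show ?thesis by blast
  next
    case False
    have "ccw y (act h (q 0)) (act h yp)" using q_in_J[of h 0] by (simp add: J_def yh)
    moreover have "\<not> ccw y z1 (act h yp)" using False by (simp add: J_def yh)
    moreover have "z1 \<noteq> act h yp \<Longrightarrow> ccw y z1 (act h yp) \<or> ccw y (act h yp) z1"
      using z1y hyp yS pz1(2) by (intro ccw_total) auto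
    ultimately have "ccw y (act h (q 0)) z1" using ccw_trans by metis
    then show ?thesis by blast
  qed
  then obtain i where i: "ccw y (act h (q i)) z1" by blast
  then have "ccw (act p y) (act p (act h (q i))) (act p z1)"
    using act_ccw[of y "act h (q i)" z1 p] yS pz1(2) by simp
  then have "act p (act h (q i)) \<in> J h" using py pz1 yh by (simp add: J_def)
  moreover have "act p (act h (q i)) = pt (p @ h @ pw i)" by (simp add: pt_append q_def)
  ultimately obtain j where j: "pt (p @ h @ pw i) = act h (q j)" using orbit_in_J by metis
  then have "pt (p @ h @ pw i) = pt (h @ pw j)" by (simp add: pt_append q_def)
  then have *: "act p (act h (act (pw i) z)) = act h (act (pw j) z)" if "z \<in> S1" for z
    using pt_eq_act[of "p @ h @ pw i" "h @ pw j" z] that by simp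
  define m where "m = j - i"
  have pm: "act p z = act h (act (pw m) (act (winv h) z))" if z: "z \<in> S1" for z
  proof -
    define z' where "z' = act (winv h) z"
    have z': "z' \<in> S1" "act h z' = z" using z by (simp_all add: z'_def act_winv)
    show ?thesis
      using *[of "act (pw (- i)) z'"] act_cpow_add[OF z'(1), of s i "- i"] act_cpow_add[OF z'(1), of s j "- i"] z'
      by (simp add: m_def z'_def)
  qed
  have r1: "act r z = act h (act s (act (winv h) z))" if "z \<in> S1" for z
    using that act_winv(1)[of "act v (act u z)" u] by (simp add: r_def h)
  have rm: "act (cpow r k) z = act h (act (pw k) (act (winv h) z))" if z: "z \<in> S1" for k z
    using z
  proof (induction k arbitrary: z rule: int_induct[of _ 0])
    case base then show ?case by (simp add: act_winv)
  next
    case (step1 k)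
    define z' where "z' = act (winv h) z"
    have z': "z' \<in> S1" using step1 by (simp add: z'_def)
    show ?case
      using act_cpow_add[OF step1(3), of r k 1] act_cpow_add[OF z', of s k 1] step1(2)[of "act r z"] r1[OF step1(3)]
        act_winv(1)[of "act s z'" h] step1(3) z'
      by (simp add: z'_def)
  next
    case (step2 k)
    define z' where "z' = act (winv h) z"
    have z': "z' \<in> S1" "act h z' = z" using step2 by (simp_all add: z'_def act_winv)
    have "act (winv r) z = act h (act (winv s) z')"
    proof -
      have "act r (act h (act (winv s) z')) = act h (act s (act (winv h) (act h (act (winv s) z'))))"
        by (rule r1) (use z' in simp)
      also have "\<dots> = z" using z' by (simp add: act_winv)
      finally show ?thesis using act_winv(1)[of "act h (act (winv s) z')" r] z' by simp
    qed
    then show ?case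
      using act_cpow_add[OF step2(3), of r k "-1"] act_cpow_add[OF z'(1), of s k "-1"] step2(2)[of "act (winv r) z"]
        act_winv(1)[of "act (winv s) z'" h] step2(3) z'
      by (simp add: z'_def)
  qed
  have red: "reduced u0" "reduced v0" "reduced u" "reduced v" using s(1) g h by (metis reduced_append)+
  have rp: "reduced p"
    using red g s by (cases "u0 = []") (auto simp: p_def reduced_append)
  have lv: "last v = last s" "hd u = GA" using h u s(3) by auto
  then have r_good: "reduced r" "r \<noteq> []" "in_B (hd r) \<noteq> in_B (last r)"
    using red h u s(1,4) last_u unfolding r_def h(2) by (auto simp: reduced_append)
  have "pt p = pt (cpow r m)" using pm[of x0] rm[of x0 m] by (simp add: pt_def)
  then have prm: "p = cpow r m" using pt_inj[OF rp reduced_cpow[OF r_good]] by simp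
  moreover have "length p = length s" "length r = length s"
    using arg_cong[OF g(2), of length] arg_cong[OF h(2), of length] by (simp_all add: p_def r_def)
  ultimately have "nat \<bar>m\<bar> * length s = length s" using length_cpow[of r m] by simp
  then have "\<bar>m\<bar> = 1" using s(2) by simp
  moreover have "m \<noteq> 1"
  proof
    assume "m = 1"
    then have "p = r" using prm by simp
    then have "hd (v0 @ u0) = hd (v @ u)" by (simp add: p_def r_def)
    then have "hd v0 = hd v" using g(3) h(3) by simp
    moreover have "reduced (u @ v)" using s(1) h(2) by simp
    then have "in_B (hd v) \<noteq> in_B (last u)" using h(3) u by (auto simp: reduced_append)
    ultimately show False using hd_v0 last_u by simp
  qed
  ultimately have "m = -1" by linarith
  then have pr: "v0 @ u0 = winv u @ winv v" using prm by (simp add: p_def r_def)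
  \<comment> \<open>The element taking the gap of \<open>g\<close>, that is of \<open>v0\<close>, to
    the gap of \<open>h\<close>. Comparing the words in \<open>pr\<close> shows that it equals its
    inverse, so it also takes the second gap back to the first.\<close>
  define t where "t = winv u @ winv v0"
  have "winv t = t"
  proof -
    have "u @ v = u0 @ v0" using g h by simp
    then consider x where "u = u0 @ x" "v0 = x @ v" | x where "u0 = u @ x" "v = x @ v0"
      by (auto simp: append_eq_append_conv2)
    then show ?thesis
    proof cases
      case 1
      then have "x @ (v @ u0) = winv x @ (winv u0 @ winv v)" using pr by simp
      then have "x = winv x" "v @ u0 = winv u0 @ winv v" by (simp_all add: append_eq_append_conv)
      then show ?thesis unfolding t_def 1 by (metis append.assoc winv_simps(3,4))
    next
      case 2
      then have "(v0 @ u) @ x = (winv u @ winv v0) @ winv x" using pr by simp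
      then have "v0 @ u = winv u @ winv v0" 
        using append_eq_append_conv[of "v0 @ u" "winv u @ winv v0" x "winv x"] by simp
      then show ?thesis by (simp add: t_def)
    qed
  qed
  then have tt: "act t (act t z) = z" if "z \<in> S1" for z using act_winv(1)[OF that, of t] by simp
  have tv: "act t (act v0 z) = act h z" if "z \<in> S1" for z using that by (simp add: t_def act_winv h)
  have "act h yp = act t y" using tv[of yp] v0y by simp
  also have "\<dots> = act t (act t (act v0 ym))" using tv[of ym] yh by simp
  also have "\<dots> = act g ym" using tt v0y by simp
  finally have wrap: "act h yp = act g ym" .
  define z where "z = pt [ginv (last s)]"
  have "z \<noteq> y" "z \<noteq> act g ym" using not_orbit by (auto simp: z_def y_def)
  then have "ccw (act g ym) z y \<or> ccw y z (act g ym)"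
    using ccw_total[of "act g ym" z y] hyp wrap yS ccw_rotate by (fastforce simp: z_def)
  then have "z \<in> J g \<or> z \<in> J h" using wrap yh eq by (simp add: J_def y_def)
  then obtain i where "[ginv (last s)] = wmul g (pw i) \<or> [ginv (last s)] = wmul h (pw i)"
  proof
    assume "z \<in> J g"
    then obtain i where "z = act g (q i)" using orbit_in_J by (auto simp: z_def)
    then have "[ginv (last s)] = wmul g (pw i)" using pt_inj by (simp add: z_def orbit_q)
    then show ?thesis using that by blast
  next
    assume "z \<in> J h"
    then obtain i where "z = act h (q i)" using orbit_in_J by (auto simp: z_def)
    then have "[ginv (last s)] = wmul h (pw i)" using pt_inj by (simp add: z_def orbit_q)
    then show ?thesis using that by blast
  qed
  then show False using missed_word[OF g(2,3)] missed_word[OF h(2,3)] g(1) h(1) by metis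
qed

text \<open>The arc covering this end must begin there: otherwise it would also contain points of
  the gap just before the end.\<close>

lemma right_end: assumes g: "g \<in> GP \<union> GQ" "RT g t" shows "act g yp \<in> A t"
proof -
  define z where "z = act g yp"
  have "finite (GP \<union> GQ)" "GP \<union> GQ \<noteq> {}" using Nil_GP by auto
  moreover have "z \<in> S1" "z \<notin> gaps_of (GP \<union> GQ)" using ends_not_in_J by (auto simp: z_def gaps_of_def)
  ultimately obtain g' h' where a: "isarc (GP \<union> GQ) g' h'" "z \<in> carc (act g' yp) (act h' ym)"
    using arcs_cover by metis
  have "act g' yp = z"
  proof (rule ccontr)
    assume n: "act g' yp \<noteq> z"
    have "ccw (act g ym) (act g (q 0)) z" "\<not> ccw (act g ym) (act g' yp) z"
      using q_in_J[of g 0] ends_not_in_J(1)[of g' g] by (auto simp: J_def z_def)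
    then have "act g (q 0) \<in> carc (act g' yp) (act h' ym)" using carc_left[OF a(2) n] by simp
    then show False using a(1) g(1) q_in_J[of g 0] unfolding isarc_def gaps_of_def by blast
  qed
  then have "RT g' t" using same_end[of g g'] RT_coset g(2) z_def by metis
  then show ?thesis using a unfolding A_def z_def by blast
qed

lemma left_end: assumes g: "g \<in> GP \<union> GQ" "LT g t" shows "act g ym \<in> A t"
proof -
  define z where "z = act g ym"
  have "finite (GP \<union> GQ)" "GP \<union> GQ \<noteq> {}" using Nil_GP by auto
  moreover have "z \<in> S1" "z \<notin> gaps_of (GP \<union> GQ)" using ends_not_in_J by (auto simp: z_def gaps_of_def)
  ultimately obtain g' h' where a: "isarc (GP \<union> GQ) g' h'" "z \<in> carc (act g' yp) (act h' ym)"
    using arcs_cover by metis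
  have e: "act h' ym = z"
  proof (rule ccontr)
    assume n: "act h' ym \<noteq> z"
    have "ccw z (act g (q 0)) (act g yp)" "\<not> ccw z (act h' ym) (act g yp)"
      using q_in_J[of g 0] ends_not_in_J(2)[of h' g] by (auto simp: J_def z_def)
    then have "act g (q 0) \<in> carc (act g' yp) (act h' ym)" using carc_right[OF a(2) n] by simp
    then show False using a(1) g(1) q_in_J[of g 0] unfolding isarc_def gaps_of_def by blast
  qed
  obtain x where x: "RT g' x" using a(1) RT_exists by (metis isarc_def)
  then have "LT h' x" using isarc_types a by blast
  then have "x = t" using same_end[of h' g] LT_coset LT_unique g(2) e z_def by metis
  then show ?thesis using a x unfolding A_def z_def by blast
qed

end


section \<open>Topology of arcs\<close>

lemma arc_param:
  assumes "a \<in> S1" "b \<in> S1" "a \<noteq> b"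
  shows "{z. ccw a z b} = (\<lambda>t. a * cis t) ` {0<..<cang a b}" "carc a b = (\<lambda>t. a * cis t) ` {0..cang a b}" "0 < cang a b"
proof -
  have z: "cang a a = 0" using cang_eq[of a a] assms by simp
  have pos: "0 < cang a z \<longleftrightarrow> z \<noteq> a" if "z \<in> S1" for z
    using cang_inj[OF assms(1) that assms(1)] z cang_bounds(1)[of a z] by auto
  show "0 < cang a b" using pos assms by auto
  have c: "cang a (a * cis t) = t" if "0 \<le> t" "t \<le> cang a b" for t
  proof -
    have "a * cis t / a = cis t" using assms(1) by auto
    then show ?thesis using that cang_bounds(2)[of a b] by (simp add: cang_def Arg2pi_cis)
  qed
  have S: "a * cis t \<in> S1" for t using assms(1) by (simp add: norm_mult)
  have o: "ccw a (a * cis t) b" if "0 < t" "t < cang a b" for t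
    using that c[of t] S[of t] assms by (simp add: ccw_cang)
  have i: "z \<in> (\<lambda>t. a * cis t) ` T" if "z \<in> S1" "cang a z \<in> T" for z T
    using cang_cis[OF that(1) assms(1)] that(2) by (metis image_eqI)
  show 1: "{z. ccw a z b} = (\<lambda>t. a * cis t) ` {0<..<cang a b}"
  proof
    show "{z. ccw a z b} \<subseteq> (\<lambda>t. a * cis t) ` {0<..<cang a b}" using i by (auto simp: ccw_cang)
  qed (use o in auto)
  show "carc a b = (\<lambda>t. a * cis t) ` {0..cang a b}"
  proof
    show "carc a b \<subseteq> (\<lambda>t. a * cis t) ` {0..cang a b}"
    proof
      fix w assume w: "w \<in> carc a b"
      then have "w \<in> S1" "cang a w \<in> {0..cang a b}"
        using assms z cang_bounds(1)[of a b] by (auto simp: carc_def ccw_cang)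
      then show "w \<in> (\<lambda>t. a * cis t) ` {0..cang a b}" by (rule i)
    qed
    show "(\<lambda>t. a * cis t) ` {0..cang a b} \<subseteq> carc a b"
    proof
      fix z assume "z \<in> (\<lambda>t. a * cis t) ` {0..cang a b}"
      then obtain t where "z = a * cis t" "t \<in> {0..cang a b}" by blast
      then have t: "z = a * cis t" "0 \<le> t" "t \<le> cang a b" by simp_all
      then consider "t = 0" | "t = cang a b" | "0 < t" "t < cang a b" by linarith
      then show "z \<in> carc a b" using t o cang_cis[OF assms(2,1)] by cases (auto simp: carc_def)
    qed
  qed
qed

lemma arc_topology:
  assumes "a \<in> S1" "b \<in> S1" "a \<noteq> b"
  shows "connected {z. ccw a z b}" "closed (carc a b)" "closure {z. ccw a z b} = carc a b"
proof -
  note P = arc_param[OF assms]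
  have cont: "continuous_on T (\<lambda>t. a * cis t)" for T unfolding cis_conv_exp by (intro continuous_intros)
  show "connected {z. ccw a z b}" unfolding P(1) by (intro connected_continuous_image cont) simp
  have "compact (carc a b)" unfolding P(2) by (intro compact_continuous_image cont) simp
  then show cl: "closed (carc a b)" by (rule compact_imp_closed)
  show "closure {z. ccw a z b} = carc a b"
  proof
    show "closure {z. ccw a z b} \<subseteq> carc a b" by (rule closure_minimal[OF _ cl]) (auto simp: carc_def)
    have "closure {0<..<cang a b} = {0..cang a b}" using P(3) by simp
    then show "carc a b \<subseteq> closure {z. ccw a z b}"
      unfolding P(1,2) using image_closure_subset[OF cont closed_closure closure_subset, of "{0<..<cang a b}"] by simp
  qed
qed

lemma open_arc_complement: "a \<in> S1 \<Longrightarrow> b \<in> S1 \<Longrightarrow> a \<noteq> b \<Longrightarrow> z \<in> S1 \<Longrightarrow> ccw a z b \<longleftrightarrow> z \<notin> carc b a"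
  using ccw_total[of a z b] ccw_asym[of a z b] ccw_distinct[of a z b] ccw_rotate[of b z a] ccw_rotate[of z a b] ccw_rotate[of a b z]
  unfolding carc_def by (auto dest: ccw_rotate ccw_asym)

text \<open>Each piece is relatively open, and so is the union of the other pieces; hence a
  connected set containing one piece cannot reach another.\<close>

lemma components_disjoint_union:
  assumes con: "\<And>C. C \<in> \<C> \<Longrightarrow> connected C \<and> C \<noteq> {}"
    and op: "\<And>C. C \<in> \<C> \<Longrightarrow> \<exists>V. open V \<and> V \<inter> S = C" and S: "\<Union>\<C> \<subseteq> S"
    and dis: "\<And>C D. C \<in> \<C> \<Longrightarrow> D \<in> \<C> \<Longrightarrow> C \<noteq> D \<Longrightarrow> C \<inter> D = {}"
  shows "components (\<Union>\<C>) = \<C>"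
proof -
  obtain V where V: "\<And>C. C \<in> \<C> \<Longrightarrow> open (V C)" "\<And>C. C \<in> \<C> \<Longrightarrow> V C \<inter> S = C" using op by metis
  have comp: "C \<in> components (\<Union>\<C>)" if C: "C \<in> \<C>" for C
    unfolding in_components_maximal
  proof (intro conjI allI impI)
    show "C \<noteq> {}" "C \<subseteq> \<Union>\<C>" "connected C" using con C by auto
    fix d assume d: "d \<noteq> {} \<and> C \<subseteq> d \<and> d \<subseteq> \<Union>\<C> \<and> connected d"
    define W where "W = (\<Union>D\<in>\<C> - {C}. V D)"
    have "open W" using V by (auto simp: W_def)
    moreover have "d \<subseteq> V C \<union> W" using d V(2) C by (fastforce simp: W_def)
    moreover have "V C \<inter> W \<inter> d = {}"
    proof -
      have "z \<in> C \<inter> D" if "z \<in> V C" "z \<in> V D" "z \<in> d" "D \<in> \<C>" for z D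
        using that V(2)[OF C] V(2)[OF that(4)] d S by blast
      then show ?thesis using dis[OF C] unfolding W_def by blast
    qed
    moreover have "V C \<inter> d \<noteq> {}" using d V(2)[OF C] con[OF C] by blast
    ultimately have "W \<inter> d = {}" using connectedD[of d "V C" W] d V(1)[OF C] by blast
    then have "d \<subseteq> V C" using \<open>d \<subseteq> V C \<union> W\<close> by blast
    then show "d = C" using V(2)[OF C] d S by blast
  qed
  show ?thesis
  proof
    show "components (\<Union>\<C>) \<subseteq> \<C>"
    proof
      fix D assume D: "D \<in> components (\<Union>\<C>)"
      then obtain z where z: "z \<in> D" using in_components_nonempty by blast
      then obtain C where "C \<in> \<C>" "z \<in> C" using in_components_subset[OF D] by blast
      then show "D \<in> \<C>" using comp D z components_nonoverlap[of D "\<Union>\<C>" C] by blast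
    qed
  qed (use comp in blast)
qed

lemma closed_arc_iff: "closed_arc I \<longleftrightarrow> (\<exists>p q. p \<in> S1 \<and> q \<in> S1 \<and> p \<noteq> q \<and> I = carc p q)"
  by (simp add: closed_arc_def carc_def)

lemma union_k_arcs_image:
  assumes f: "homeo_plus f" and u: "union_k_arcs k X" shows "union_k_arcs k (f ` X)"
proof -
  obtain I where I': "\<forall>i<k. closed_arc (I i)" "\<forall>i<k. \<forall>j<k. i \<noteq> j \<longrightarrow> I i \<inter> I j = {}" "X = (\<Union>i<k. I i)"
    using u unfolding union_k_arcs_def by blast
  then have I: "\<And>i. i < k \<Longrightarrow> closed_arc (I i)" "\<And>i j. i < k \<Longrightarrow> j < k \<Longrightarrow> i \<noteq> j \<Longrightarrow> I i \<inter> I j = {}"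
    by blast+
  have S: "I i \<subseteq> S1" if "i < k" for i using I(1)[OF that] ccw_S1 by (auto simp: closed_arc_iff carc_def)
  have 1: "closed_arc (f ` I i)" if i: "i < k" for i
  proof -
    obtain p q where pq: "p \<in> S1" "q \<in> S1" "p \<noteq> q" "I i = carc p q" using I(1)[OF i] by (auto simp: closed_arc_iff)
    then show ?thesis using homeo_plus_image_carc[OF f pq(1,2)] homeo_plus_S1[OF f] homeo_plus_inj[OF f]
      unfolding closed_arc_iff by metis
  qed
  have 2: "f ` I i \<inter> f ` I j = {}" if ij: "i < k" "j < k" "i \<noteq> j" for i j
  proof -
    have "False" if "z \<in> I i" "w \<in> I j" "f z = f w" for z w
      using that S[OF ij(1)] S[OF ij(2)] homeo_plus_inj[OF f, of z w] I(2)[OF ij] by blast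
    then show ?thesis by blast
  qed
  have "f ` X = (\<Union>i<k. f ` I i)" using I'(3) by blast
  then show ?thesis unfolding union_k_arcs_def using 1 2 by (intro exI[of _ "\<lambda>i. f ` I i"]) blast
qed

lemma union_k_arcs_of_family:
  assumes "finite \<C>" "\<And>C. C \<in> \<C> \<Longrightarrow> closed_arc C" "\<And>C D. C \<in> \<C> \<Longrightarrow> D \<in> \<C> \<Longrightarrow> C \<noteq> D \<Longrightarrow> C \<inter> D = {}"
  shows "union_k_arcs (card \<C>) (\<Union>\<C>)"
proof -
  obtain I where I: "bij_betw I {0..<card \<C>} \<C>" using ex_bij_betw_nat_finite[OF assms(1)] by blast
  have im: "I i \<in> \<C>" if "i < card \<C>" for i using I that by (auto simp: bij_betw_def)
  have inj: "I i \<noteq> I j" if "i < card \<C>" "j < card \<C>" "i \<noteq> j" for i j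
    using I that by (auto simp: bij_betw_def inj_on_def)
  have "\<Union>\<C> = (\<Union>i<card \<C>. I i)" using I by (auto simp: bij_betw_def atLeast0LessThan[symmetric])
  moreover have "\<forall>i<card \<C>. closed_arc (I i)" using assms(2) im by simp
  moreover have "\<forall>i<card \<C>. \<forall>j<card \<C>. i \<noteq> j \<longrightarrow> I i \<inter> I j = {}" using assms(3) im inj by simp
  ultimately show ?thesis unfolding union_k_arcs_def by (intro exI[of _ I] conjI)
qed

section \<open>The Markov system\<close>

context good_orbit begin

lemma f_J: "f t ` J g = J (t # g)"
proof -
  have i: "f t z \<in> J (t # g) \<longleftrightarrow> z \<in> J g" if "z \<in> S1" for z using act_J[of z "[t]" g] that by simp
  show ?thesis
  proof
    show "f t ` J g \<subseteq> J (t # g)" using i J_S1 by blast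
    show "J (t # g) \<subseteq> f t ` J g"
    proof
      fix z assume z: "z \<in> J (t # g)"
      then have "z \<in> S1" by (rule J_S1)
      then have "f (ginv t) z \<in> S1" "z = f t (f (ginv t) z)" using f_ginv(2)[of z t] by auto
      then show "z \<in> f t ` J g" using i z by (metis image_eqI)
    qed
  qed
qed

lemma J_topology: "connected (J g)" "J g \<noteq> {}" "\<exists>V. open V \<and> V \<inter> S1 = J g"
  "closure (J g) = carc (act g ym) (act g yp)"
proof -
  have e: "act g ym \<in> S1" "act g yp \<in> S1" "act g ym \<noteq> act g yp" using ym_neq_yp act_inj by simp_all
  show "connected (J g)" "closure (J g) = carc (act g ym) (act g yp)" using arc_topology[OF e] by (simp_all add: J_def)
  show "J g \<noteq> {}" using q_in_J by blast
  have "- carc (act g yp) (act g ym) \<inter> S1 = J g"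
    using open_arc_complement[OF e] ccw_S1 unfolding J_def by blast
  moreover have "open (- carc (act g yp) (act g ym))" using arc_topology(2)[OF e(2,1)] e(3) by (simp add: open_Compl)
  ultimately show "\<exists>V. open V \<and> V \<inter> S1 = J g" by blast
qed

lemma complement_A: "S1 - (A GA \<union> A GB \<union> A GBi) = gaps_of (GP \<union> GQ)"
proof -
  have "z \<in> gaps_of (GP \<union> GQ) \<or> z \<in> A GA \<or> z \<in> A GB \<or> z \<in> A GBi" if "z \<in> S1" for z
    using A_cover[OF that] by (metis gen.exhaust)
  moreover have "gaps_of (GP \<union> GQ) \<subseteq> S1" using J_S1 by (auto simp: gaps_of_def)
  ultimately show ?thesis using A_gaps by blast
qed

lemma components_gaps: "components (S1 - (A GA \<union> A GB \<union> A GBi)) = J ` (GP \<union> GQ)"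
  unfolding complement_A gaps_of_def
proof (rule components_disjoint_union[where S = S1])
  fix C assume C: "C \<in> J ` (GP \<union> GQ)"
  then show "connected C \<and> C \<noteq> {}" "\<exists>V. open V \<and> V \<inter> S1 = C" using J_topology by blast+
  fix D assume D: "D \<in> J ` (GP \<union> GQ)" "C \<noteq> D"
  then show "C \<inter> D = {}" using C J_share coset_eq_J by blast
qed (use J_S1 in blast)

lemma types:
  assumes "g \<in> GP \<union> GQ" obtains t t' where "RT g t" "LT g t'" "t \<noteq> t'" "t = GA \<or> t' = GA \<longleftrightarrow> g \<in> GP" "g \<in> GQ \<longleftrightarrow> {t, t'} = {GB, GBi}"
proof (cases "g \<in> GP")
  case True
  then obtain t t' where t: "RT g t" "LT g t'" "t = GA \<longleftrightarrow> t' \<noteq> GA" using GP_types by blast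
  have "g \<notin> GQ"
  proof
    assume "g \<in> GQ"
    then obtain y where "RT g (ginv y)" "LT g y" "in_B y" using GQ_types by blast
    then show False using t RT_unique LT_unique by (metis in_B.simps(1) in_B_ginv)
  qed
  moreover have "{t, t'} \<noteq> {GB, GBi}" using t(3) by auto
  ultimately show ?thesis using that[OF t(1,2)] t(3) True by auto
next
  case False
  then have "g \<in> GQ" using assms by blast
  then obtain y where y: "RT g (ginv y)" "LT g y" "in_B y" using GQ_types by blast
  then show ?thesis using that[OF y(1,2)] False \<open>g \<in> GQ\<close> by (cases y) auto
qed

text \<open>Taking the closure adds only the two ends of the gap, and these lie in the sets
  belonging to its right and left types.\<close>

lemma closure_J_A:
  assumes g: "g \<in> GP \<union> GQ" and t: "RT g t" "LT g t'"
  shows "closure (J g) \<inter> A x \<noteq> {} \<longleftrightarrow> x = t \<or> x = t'" "closure (J g) \<inter> A x \<subseteq> {act g ym, act g yp}"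
proof -
  have r: "act g yp \<in> A t" "act g ym \<in> A t'" using right_end left_end g t by auto
  have cl: "closure (J g) = J g \<union> {act g ym, act g yp}" unfolding J_topology(4) by (auto simp: carc_def J_def)
  have "J g \<inter> A x = {}" using A_gaps g unfolding gaps_of_def by blast
  then show *: "closure (J g) \<inter> A x \<subseteq> {act g ym, act g yp}" using cl by blast
  show "closure (J g) \<inter> A x \<noteq> {} \<longleftrightarrow> x = t \<or> x = t'"
  proof
    assume "closure (J g) \<inter> A x \<noteq> {}"
    then have "act g ym \<in> A x \<or> act g yp \<in> A x" using * by blast
    then show "x = t \<or> x = t'" using r A_disjoint by blast
  next
    assume "x = t \<or> x = t'" then show "closure (J g) \<inter> A x \<noteq> {}" using r cl by blast
  qed
qed

lemma principal_gaps:
  "{J'. J' \<in> J ` (GP \<union> GQ) \<and> closure J' \<inter> A GA \<noteq> {} \<and> closure J' \<inter> (A GB \<union> A GBi) \<noteq> {}} = J ` GP"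
proof -
  have "closure (J g) \<inter> A GA \<noteq> {} \<and> closure (J g) \<inter> (A GB \<union> A GBi) \<noteq> {} \<longleftrightarrow> g \<in> GP" if g: "g \<in> GP \<union> GQ" for g
  proof -
    obtain t t' where t: "RT g t" "LT g t'" "t \<noteq> t'" "t = GA \<or> t' = GA \<longleftrightarrow> g \<in> GP" using types[OF g] by metis
    have "closure (J g) \<inter> (A GB \<union> A GBi) \<noteq> {} \<longleftrightarrow> closure (J g) \<inter> A GB \<noteq> {} \<or> closure (J g) \<inter> A GBi \<noteq> {}" by blast
    then show ?thesis using closure_J_A(1)[OF g t(1,2)] t(3,4) by (cases t; cases t') auto
  qed
  then show ?thesis by blast
qed

lemma complementary_gaps:
  "{J'. J' \<in> J ` (GP \<union> GQ) \<and> closure J' \<inter> A GB \<noteq> {} \<and> closure J' \<inter> A GBi \<noteq> {}} = J ` GQ"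
proof -
  have "closure (J g) \<inter> A GB \<noteq> {} \<and> closure (J g) \<inter> A GBi \<noteq> {} \<longleftrightarrow> g \<in> GQ" if g: "g \<in> GP \<union> GQ" for g
  proof -
    obtain t t' where t: "RT g t" "LT g t'" "g \<in> GQ \<longleftrightarrow> {t, t'} = {GB, GBi}" using types[OF g] by metis
    then show ?thesis using closure_J_A(1)[OF g t(1,2)] by auto
  qed
  then show ?thesis by blast
qed

text \<open>The two ends of a gap carry different types, so two components of the same set cannot be
  separated by a single gap.\<close>

lemma not_consecutive:
  assumes "C \<in> components X" "D \<in> components X" "C \<subseteq> A x" "D \<subseteq> A x" "C \<noteq> D" "J' \<in> J ` (GP \<union> GQ)"
  shows "\<not> (closure J' \<inter> C \<noteq> {} \<and> closure J' \<inter> D \<noteq> {})"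
proof
  assume n: "closure J' \<inter> C \<noteq> {} \<and> closure J' \<inter> D \<noteq> {}"
  obtain g where g: "g \<in> GP \<union> GQ" "J' = J g" using assms(6) by blast
  obtain t t' where t: "RT g t" "LT g t'" "t \<noteq> t'" using types[OF g(1)] by metis
  have "C \<inter> D = {}" using components_nonoverlap[OF assms(1,2)] assms(5) by blast
  moreover have "closure J' \<inter> C \<subseteq> {act g ym, act g yp}" "closure J' \<inter> D \<subseteq> {act g ym, act g yp}"
    using closure_J_A(2)[OF g(1) t(1,2), of x] assms(3,4) g(2) by blast+
  ultimately have "act g ym \<in> A x" "act g yp \<in> A x" using n assms(3,4) by blast+
  moreover have "act g yp \<in> A t" "act g ym \<in> A t'" using right_end left_end g t by auto
  ultimately have "x = t" "x = t'" using A_disjoint by blast+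
  then show False using t(3) by simp
qed

text \<open>The number \<open>k\<close> counts the arcs of type \<open>GA\<close>;
  \<open>f GB\<close> then carries the same number to the other two sets.\<close>

lemma A_GA_arcs: "\<exists>k\<ge>1. union_k_arcs k (A GA)"
proof -
  define \<C> where "\<C> = {carc (act g yp) (act h ym) | g h. isarc (GP \<union> GQ) g h \<and> RT g GA}"
  have "\<C> \<subseteq> (\<lambda>(g, h). carc (act g yp) (act h ym)) ` ((GP \<union> GQ) \<times> (GP \<union> GQ))"
    unfolding \<C>_def isarc_def by auto
  then have fin: "finite \<C>" by (rule finite_subset) simp
  have "closed_arc C" if C: "C \<in> \<C>" for C
  proof -
    obtain g h where gh: "C = carc (act g yp) (act h ym)" "isarc (GP \<union> GQ) g h" "RT g GA"
      using C unfolding \<C>_def by blast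
    have "act g yp \<in> S1" "act h ym \<in> S1" by simp_all
    then show ?thesis using arc_nondegenerate[OF gh(2,3)] gh(1) unfolding closed_arc_iff by blast
  qed
  moreover have "C \<inter> D = {}" if CD: "C \<in> \<C>" "D \<in> \<C>" "C \<noteq> D" for C D
  proof (rule ccontr)
    assume "C \<inter> D \<noteq> {}"
    then obtain z where z: "z \<in> C" "z \<in> D" by blast
    obtain g h where gh: "C = carc (act g yp) (act h ym)" "isarc (GP \<union> GQ) g h" using CD(1) unfolding \<C>_def by blast
    obtain g' h' where gh': "D = carc (act g' yp) (act h' ym)" "isarc (GP \<union> GQ) g' h'" using CD(2) unfolding \<C>_def by blast
    show False using arcs_disjoint[OF gh(2) _ gh'(2), of z] z gh gh' CD(3) by simp
  qed
  ultimately have "union_k_arcs (card \<C>) (\<Union>\<C>)" using fin by (intro union_k_arcs_of_family) auto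
  moreover have "\<Union>\<C> = A GA" by (simp add: A_def \<C>_def)
  moreover have "A GA \<noteq> {}" using right_end[of "[]" GA] RT_P[of "[]" s] s Nil_GP by auto
  then have "card \<C> \<noteq> 0" using fin \<open>\<Union>\<C> = A GA\<close> by auto
  ultimately show ?thesis by (intro exI[of _ "card \<C>"]) auto
qed

text \<open>Reading \<open>s\<close> letter by letter walks through the gaps: lengthening the prefix
  by \<open>x\<close> applies the inverse of \<open>x\<close> to the gap. All gaps of
  \<open>GP\<close> are thus reached from that of the identity.\<close>

lemma principal_cycle:
  assumes R: "\<And>t g. g \<in> GP \<Longrightarrow> J (t # g) \<in> J ` GP \<Longrightarrow> (J g, J (t # g)) \<in> R"
    and JP: "J1 \<in> J ` GP" "J2 \<in> J ` GP"
  shows "(J1, J2) \<in> (R \<union> R\<inverse>)\<^sup>*"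
proof -
  have *: "s = u @ v \<Longrightarrow> v \<noteq> [] \<Longrightarrow> (J [], J (winv u)) \<in> (R \<union> R\<inverse>)\<^sup>*" for u v
  proof (induction u arbitrary: v rule: rev_induct)
    case (snoc x u)
    then have "(J [], J (winv u)) \<in> (R \<union> R\<inverse>)\<^sup>*" by simp
    moreover have P: "winv u \<in> GP" "winv (u @ [x]) \<in> GP"
    proof -
      have "s = u @ (x # v)" "x # v \<noteq> []" using snoc.prems by auto
      then show "winv u \<in> GP" unfolding GP_def by blast
      show "winv (u @ [x]) \<in> GP" using snoc.prems unfolding GP_def by blast
    qed
    then have "(J (winv u), J (ginv x # winv u)) \<in> R" by (intro R) auto
    ultimately show ?case by (simp add: rtrancl.rtrancl_into_rtrancl)
  qed simp
  have all: "(J [], J') \<in> (R \<union> R\<inverse>)\<^sup>*" if "J' \<in> J ` GP" for J'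
    using that * unfolding GP_def by blast
  have "sym ((R \<union> R\<inverse>)\<^sup>*)" by (intro sym_rtrancl) (auto simp: sym_def)
  then show ?thesis using all[OF JP(1)] all[OF JP(2)] by (meson rtrancl_trans symD)
qed

lemma markov: "markov_system (f GA) (f GB) (A GA) (A GB) (A GBi)"
proof -
  define X where "X = A GA \<union> A GB \<union> A GBi"
  define R where "R = {(J', g ` J') | J' g. J' \<in> J ` GP \<and> g \<in> {f GA, f GB, inv_into S1 (f GB)} \<and> g ` J' \<in> J ` GP}"
  have gaps: "components (S1 - X) = J ` (GP \<union> GQ)" unfolding X_def by (rule components_gaps)
  have inv: "inv_into S1 (f GB) z = f GBi z" if "z \<in> S1" for z
  proof (rule inv_into_f_eq)
    show "inj_on (f GB) S1" using f_inj by (auto simp: inj_on_def)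
    show "f GBi z \<in> S1" "f GB (f GBi z) = z" using that rel_GB_GBi by auto
  qed
  have Rt: "(J g, J (t # g)) \<in> R" if g: "g \<in> GP" "J (t # g) \<in> J ` GP" for t g
  proof -
    have "inv_into S1 (f GB) ` J g = f GBi ` J g" using inv J_S1 by (intro image_cong) auto
    then have "\<exists>f'\<in>{f GA, f GB, inv_into S1 (f GB)}. f' ` J g = f t ` J g" by (cases t) auto
    then obtain f' where f': "f' \<in> {f GA, f GB, inv_into S1 (f GB)}" "f' ` J g = J (t # g)" unfolding f_J by blast
    moreover from this have "f' ` J g \<in> J ` GP" using g(2) by simp
    ultimately have "(J g, f' ` J g) \<in> R"
      unfolding R_def using imageI[OF g(1), of J] by (intro CollectI exI[of _ "J g"] exI[of _ f'] conjI refl)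
    then show ?thesis using f'(2) by simp
  qed
  have E: "\<forall>J1\<in>J ` GP. \<forall>J2\<in>J ` GP. (J1, J2) \<in> (R \<union> R\<inverse>)\<^sup>*"
    using principal_cycle[OF Rt] by blast
  have B: "\<forall>C\<in>components X. \<forall>D\<in>components X. C \<subseteq> A x \<and> D \<subseteq> A x \<longrightarrow>
      \<not> (C \<noteq> D \<and> (\<exists>J'\<in>J ` (GP \<union> GQ). closure J' \<inter> C \<noteq> {} \<and> closure J' \<inter> D \<noteq> {}))" for x
    using not_consecutive by blast
  obtain k where k: "1 \<le> k" "union_k_arcs k (A GA)" using A_GA_arcs by blast
  have k': "union_k_arcs k (A GB)" "union_k_arcs k (A GBi)"
    using union_k_arcs_image[OF homeo k(2), of GB] union_k_arcs_image[OF homeo, of k "A GB" GB] image_A by auto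
  have nontriv: "\<exists>x\<in>S1. f t x \<noteq> x" for t
    using act_fixed[of "[t]" "[]"] by (intro bexI[of _ x0]) (auto simp: pt_def)
  have C: "f GA ` A GA = A GB \<union> A GBi \<union> \<Union>(J ` GQ)" using image_A_GA by (simp add: gaps_of_def)
  have rel3: "\<forall>x\<in>S1. f GB (f GB (f GB x)) = x" by (simp add: rel_GB rel_GB_GBi)
  have rel2: "\<forall>x\<in>S1. f GA (f GA x) = x" by (simp add: rel_GA)
  have dis: "A GA \<inter> A GB = {}" "A GA \<inter> A GBi = {}" "A GB \<inter> A GBi = {}" using A_disjoint by auto
  show ?thesis
    unfolding markov_system_def Let_def X_def[symmetric] gaps
      principal_gaps complementary_gaps R_def[symmetric]
    using homeo rel2 rel3 nontriv dis k k' B C image_A E by (intro conjI) blast+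
qed

end

section \<open>From the dynamical realization to the Markov system\<close>

lemma dyn_realization_free_orbit:
  assumes "dyn_realization c \<phi> x0"
  shows "free_orbit (\<lambda>s. \<phi> (Abs_G [s])) x0"
    and "reduced w \<Longrightarrow> z \<in> S1 \<Longrightarrow> foldr (\<lambda>s. \<phi> (Abs_G [s])) w z = \<phi> (Abs_G w) z"
proof -
  have act: "\<And>g. homeo_plus (\<phi> g)" "\<And>x. x \<in> S1 \<Longrightarrow> \<phi> gone x = x"
    "\<And>g h x. x \<in> S1 \<Longrightarrow> \<phi> (gmul g h) x = \<phi> g (\<phi> h x)"
    and tight: "x0 \<in> S1" "\<And>g. \<phi> g x0 = x0 \<Longrightarrow> g = gone"
    using assms by (auto simp: dyn_realization_def circle_action_def tight_at_def)
  have gm: "gmul (Abs_G u) (Abs_G v) = Abs_G (wmul u v)" if "reduced u" "reduced v" for u v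
    using that by (simp add: gmul_def Rep_Abs)
  have mul: "\<phi> (Abs_G u) (\<phi> (Abs_G v) z) = \<phi> (Abs_G (wmul u v)) z" if "reduced u" "reduced v" "z \<in> S1" for u v z
    using act(3)[OF that(3)] gm that by metis
  have fold: "foldr (\<lambda>s. \<phi> (Abs_G [s])) w z = \<phi> (Abs_G w) z" if "reduced w" "z \<in> S1" for w z
    using that(1)
  proof (induction w)
    case Nil then show ?case using act(2)[OF that(2)] by (simp add: gone_def)
  next
    case (Cons s w)
    then have "foldr (\<lambda>s. \<phi> (Abs_G [s])) (s # w) z = \<phi> (Abs_G [s]) (\<phi> (Abs_G w) z)" by (simp add: reduced_Cons)
    also have "\<dots> = \<phi> (Abs_G (wmul [s] w)) z" using Cons.prems that(2) by (intro mul) (auto simp: reduced_Cons)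
    also have "wmul [s] w = s # w" using Cons.prems by (simp add: lmul_reduced)
    finally show ?case .
  qed
  show "reduced w \<Longrightarrow> z \<in> S1 \<Longrightarrow> foldr (\<lambda>s. \<phi> (Abs_G [s])) w z = \<phi> (Abs_G w) z" by (rule fold)
  show "free_orbit (\<lambda>s. \<phi> (Abs_G [s])) x0"
  proof
    show "homeo_plus (\<phi> (Abs_G [s]))" for s by (rule act)
    show "x0 \<in> S1" by (rule tight)
    show "\<phi> (Abs_G [GA]) (\<phi> (Abs_G [GA]) z) = z" if "z \<in> S1" for z
      using mul[of "[GA]" "[GA]" z] that act(2)[of z] by (simp add: gone_def)
    show "\<phi> (Abs_G [GB]) (\<phi> (Abs_G [GB]) z) = \<phi> (Abs_G [GBi]) z" if "z \<in> S1" for z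
      using mul[of "[GB]" "[GB]" z] that by simp
    show "\<phi> (Abs_G [GB]) (\<phi> (Abs_G [GBi]) z) = z" if "z \<in> S1" for z
      using mul[of "[GB]" "[GBi]" z] that act(2)[of z] by (simp add: gone_def)
    fix u v assume r: "reduced u" "reduced v"
      and eq: "foldr (\<lambda>s. \<phi> (Abs_G [s])) u x0 = foldr (\<lambda>s. \<phi> (Abs_G [s])) v x0"
    then have e: "\<phi> (Abs_G u) x0 = \<phi> (Abs_G v) x0" using fold tight(1) by simp
    let ?i = "Abs_G (winv v)"
    have "\<phi> (Abs_G (wmul (winv v) u)) x0 = \<phi> (Abs_G (wmul (winv v) v)) x0"
      using mul[of "winv v" u x0] mul[of "winv v" v x0] r tight(1) e by simp
    also have "wmul (winv v) v = []" using wmul_winv[of "[]" v] r by simp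
    also have "\<phi> (Abs_G []) x0 = x0" using act(2)[OF tight(1)] by (simp add: gone_def)
    finally have "Abs_G (wmul (winv v) u) = Abs_G []" using tight(2) by (simp add: gone_def)
    then have "wmul (winv v) u = []" using Rep_Abs[of "wmul (winv v) u"] Rep_Abs[of "[]"] r reduced_wmul by simp
    then have "wmul (winv (winv v)) (wmul (winv v) u) = v" using r by simp
    then show "u = v" using wmul_winv[OF r(1), of "winv v"] by simp
  qed
qed

theorem theorem6p1:
  fixes c :: "G \<times> G \<times> G \<Rightarrow> int" and \<phi> :: "G \<Rightarrow> complex \<Rightarrow> complex" and x0 :: complex
  assumes "isolated_co c"
    and "dyn_realization c \<phi> x0"
  shows "\<exists>Aa Ab Abi. Aa \<subseteq> S1 \<and> Ab \<subseteq> S1 \<and> Abi \<subseteq> S1 \<and>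
           markov_system (\<phi> galpha) (\<phi> gbeta) Aa Ab Abi"
proof -
  define f where "f = (\<lambda>s. \<phi> (Abs_G [s]))"
  interpret O: free_orbit f x0 unfolding f_def by (rule dyn_realization_free_orbit(1)[OF assms(2)])
  have pt: "O.pt w = \<phi> (Abs_G w) x0" if "reduced w" for w
    unfolding O.pt_def unfolding f_def by (rule dyn_realization_free_orbit(2)[OF assms(2) that O.x0_S1])
  have c: "c (Abs_G u, Abs_G v, Abs_G w) = O.orbit_order u v w" if "reduced u" "reduced v" "reduced w" for u v w
    using assms(2) that by (simp add: dyn_realization_def O.orbit_order_def pt)
  obtain F where F: "finite F" "\<And>w. w \<in> F \<Longrightarrow> reduced w"
    "\<And>c'. circ_order c' \<Longrightarrow> (\<And>u v w. u \<in> F \<Longrightarrow> v \<in> F \<Longrightarrow> w \<in> F \<Longrightarrow>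
        c' (Abs_G u, Abs_G v, Abs_G w) = c (Abs_G u, Abs_G v, Abs_G w)) \<Longrightarrow> c' = c"
    using isolated_co_finite[OF assms(1)] by metis
  have det: "O.determined_by F" unfolding O.determined_by_def
  proof (intro allI impI)
    fix c' u v w
    assume c': "circ_order c'" "\<forall>u\<in>F. \<forall>v\<in>F. \<forall>w\<in>F. c' (Abs_G u, Abs_G v, Abs_G w) = O.orbit_order u v w"
      and r: "reduced u" "reduced v" "reduced w"
    have "c' = c" using c' c F(2) by (intro F(3)) auto
    then show "c' (Abs_G u, Abs_G v, Abs_G w) = O.orbit_order u v w" using c r by simp
  qed
  \<comment> \<open>Only the identity has the empty type, so a change of type starting at
    \<open>[]\<close> takes place at the identity itself and produces its successor.\<close>
  obtain w w' where w: "reduced w'" "ty w = ty []" "ty w' \<noteq> ty []" "\<And>u. reduced u \<Longrightarrow> \<not> ccw (O.pt w) (O.pt u) (O.pt w')"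
    using O.type_change[OF det F(1,2), of "[]" "[GA]"] by (metis ty_def list.distinct(1) option.distinct(1) reduced.simps(2,3))
  then have "w = []" "w' \<noteq> []" by (auto simp: ty_def split: if_splits)
  then have "O.jump w'" using w by (simp add: O.jump_def O.pt_Nil)
  with det F obtain x s F' where x: "free_orbit f x" "free_orbit.jump f x s" "free_orbit.determined_by f x F'"
    "finite F'" "\<forall>w\<in>F'. reduced w" "cyclically_good s"
    using exists_good_base_point[OF O.free_orbit_axioms] by metis
  interpret M: good_orbit f x s F'
    by (rule good_orbit.intro[OF x(1)], unfold_locales) (use x in auto)
  have "f GA = \<phi> galpha" "f GB = \<phi> gbeta" by (simp_all add: f_def galpha_def gbeta_def)
  then show ?thesis using M.markov M.A_S1 by metis
qed

end
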